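(* Let $N\ge 2$, $T>0$, $\nu\ge 0$. Let $w\in L^1_{loc}([0,\infty))$ be given, which is positive almost everywhere on $[0,\infty)$. Suppose $(v,p)$ is a weak solution to $(NS)_\nu$ on $\mathbb{R}^N\times(0,T)$ with $f\in L^1(0,T;L^1_{loc,\sigma}(\mathbb{R}^N))$ such that $$\int_0^T\int_{\mathbb{R}^N}\bigl(|v(x,t)|^2+|p(x,t)|\bigr)\left[w(|x|)+\frac{1}{|x|}\int_0^{|x|}w(s)\,ds+\frac{1}{|x|^2}\int_0^{|x|}\int_0^r w(s)\,ds\,dr\right]dx\,dt<\infty$$ and $$\int_{\mathbb{R}^N}p(x,t)\left[w(|x|)+\frac{N-1}{|x|}\int_0^{|x|}w(s)\,ds\right]dx\ge 0\quad\text{for } t\in(0,T).$$ Then $v(x,t)=0$ almost everywhere on $\mathbb{R}^N\times(0,T)$.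
   Context: For $N\ge 2$ and $\nu\ge0$, $(NS)_\nu$ denotes the Navier-Stokes equations on $\mathbb{R}^N$ (the Euler equations when $\nu=0$): $\partial_t v+(v\cdot\nabla)v=-\nabla p+\nu\Delta v+f$, $\operatorname{div} v=0$, with velocity $v=(v^1,\dots,v^N)(x,t)$, pressure $p(x,t)$, external force $f=(f^1,\dots,f^N)(x,t)$ and viscosity $\nu$. For $q\in[1,\infty]$, $L^q_{loc,\sigma}(\mathbb{R}^N)$ is the class of vector fields in $[L^q_{loc}(\mathbb{R}^N)]^N$ that are divergence free in the sense of distributions. For $a,b\in\mathbb{R}^N$, $a\otimes b$ is the $N\times N$ matrix with $(a\otimes b)_{ij}=a_ib_j$; for $N\times N$ matrices, $A:B=\sum_{i,j=1}^N A_{ij}B_{ij}$. Weak solution: a pair $(v,p)\in L^2(0,T;L^2_{loc,\sigma}(\mathbb{R}^N))\times L^1(0,T;L^1_{loc}(\mathbb{R}^N))$ is a weak solution of $(NS)_\nu$ on $\mathbb{R}^N\times(0,T)$ with $f\in L^1(0,T;L^1_{loc,\sigma}(\mathbb{R}^N))$ if $$-\int_0^T\!\int_{\mathbb{R}^N} v\cdot\phi(x)\,\xi'(t)\,dx\,dt-\int_0^T\!\int_{\mathbb{R}^N} v\otimes v:\nabla\phi(x)\,\xi(t)\,dx\,dt=\int_0^T\!\int_{\mathbb{R}^N} p\,\operatorname{div}\phi(x)\,\xi(t)\,dx\,dt+\nu\int_0^T\!\int_{\mathbb{R}^N} v\cdot\Delta\phi(x)\,\xi(t)\,dx\,dt+\int_0^T\!\int_{\mathbb{R}^N}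 f\cdot\phi(x)\,\xi(t)\,dx\,dt$$ for all $\xi\in C^1_0(0,T)$ and $\phi\in[C_0^\infty(\mathbb{R}^N)]^N$ (subscript $0$ denotes compact support). *)

theory Defs
  imports "HOL-Analysis.Analysis"
begin

definition partial_deriv :: "'n \<Rightarrow> (real ^ 'n::finite \<Rightarrow> 'b::real_normed_vector) \<Rightarrow> real ^ 'n \<Rightarrow> 'b" where
  "partial_deriv j g x = frechet_derivative g (at x) (axis j 1)"

primrec Ck :: "nat \<Rightarrow> (real ^ 'n::finite \<Rightarrow> 'b::real_normed_vector) \<Rightarrow> bool" where
  "Ck 0 g \<longleftrightarrow> continuous_on UNIV g"
| "Ck (Suc k) g \<longleftrightarrow> g differentiable_on UNIV \<and> (\<forall>j. Ck k (partial_deriv j g))"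

definition test_function :: "(real ^ 'n::finite \<Rightarrow> 'b::real_normed_vector) \<Rightarrow> bool" where
  "test_function g \<longleftrightarrow> (\<forall>k. Ck k g) \<and> compact (closure {x. g x \<noteq> 0})"

definition time_test_function :: "real \<Rightarrow> (real \<Rightarrow> real) \<Rightarrow> bool" where
  "time_test_function T \<xi> \<longleftrightarrow>
     \<xi> C1_differentiable_on UNIV \<and>
     compact (closure {t. \<xi> t \<noteq> 0}) \<and> closure {t. \<xi> t \<noteq> 0} \<subseteq> {0<..<T}"

definition grad :: "(real ^ 'n::finite \<Rightarrow> real) \<Rightarrow> real ^ 'n \<Rightarrow> real ^ 'n" where
  "grad \<psi> x = (\<chi> i. partial_deriv i \<psi> x)"

text \<open>Entry \<open>(i, j)\<close> is the \<open>j\<close>-th partial derivative of the \<open>i\<close>-th component; the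
  transposed convention gives the same weak formulation, since \<open>v \<otimes> v\<close> is symmetric.\<close>

definition jacobian_mat :: "(real ^ 'n::finite \<Rightarrow> real ^ 'n) \<Rightarrow> real ^ 'n \<Rightarrow> real ^ 'n ^ 'n" where
  "jacobian_mat \<phi> x = (\<chi> i j. partial_deriv j \<phi> x $ i)"

definition divergence :: "(real ^ 'n::finite \<Rightarrow> real ^ 'n) \<Rightarrow> real ^ 'n \<Rightarrow> real" where
  "divergence \<phi> x = (\<Sum>i\<in>UNIV. partial_deriv i \<phi> x $ i)"

definition laplacian :: "(real ^ 'n::finite \<Rightarrow> 'b::real_normed_vector) \<Rightarrow> real ^ 'n \<Rightarrow> 'b" where
  "laplacian \<phi> x = (\<Sum>i\<in>UNIV. partial_deriv i (partial_deriv i \<phi>) x)"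

definition tensor :: "real ^ 'n::finite \<Rightarrow> real ^ 'n \<Rightarrow> real ^ 'n ^ 'n" where
  "tensor a b = (\<chi> i j. a $ i * b $ j)"

definition double_dot :: "real ^ 'n::finite ^ 'n \<Rightarrow> real ^ 'n ^ 'n \<Rightarrow> real" where
  "double_dot A B = (\<Sum>i\<in>UNIV. \<Sum>j\<in>UNIV. A $ i $ j * B $ i $ j)"

text \<open>The exponent \<open>q\<close> is finite (\<open>1 \<le> q < \<infinity>\<close>). Elements of the spaces are represented by
  functions defined everywhere, whose values on null sets are irrelevant.\<close>

definition Lq_loc :: "real \<Rightarrow> (real ^ 'n::finite \<Rightarrow> 'b::euclidean_space) \<Rightarrow> bool" where
  "Lq_loc q u \<longleftrightarrow>
     u \<in> borel_measurable lebesgue \<and>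
     (\<forall>K. compact K \<longrightarrow> (\<integral>\<^sup>+x\<in>K. ennreal (norm (u x) powr q) \<partial>lebesgue) < \<infinity>)"

definition distr_div_free :: "(real ^ 'n::finite \<Rightarrow> real ^ 'n) \<Rightarrow> bool" where
  "distr_div_free u \<longleftrightarrow>
     (\<forall>\<psi> :: real ^ 'n \<Rightarrow> real. test_function \<psi> \<longrightarrow> (LINT x|lebesgue. u x \<bullet> grad \<psi> x) = 0)"

definition Lq_loc_sigma :: "real \<Rightarrow> (real ^ 'n::finite \<Rightarrow> real ^ 'n) \<Rightarrow> bool" where
  "Lq_loc_sigma q u \<longleftrightarrow> Lq_loc q u \<and> distr_div_free u"

text \<open>\<open>L\<^sup>q(0, T; L\<^sup>q\<^sub>l\<^sub>o\<^sub>c)\<close>: for each compact \<open>K\<close>, the \<open>L\<^sup>q(K)\<close>-norm of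
  \<open>u(\<cdot>, t)\<close> is an \<open>L\<^sup>q\<close> function of \<open>t\<close>.\<close>

definition Lq_time_Lq_loc ::
  "real \<Rightarrow> real \<Rightarrow> (real ^ 'n::finite \<Rightarrow> real \<Rightarrow> 'b::euclidean_space) \<Rightarrow> bool" where
  "Lq_time_Lq_loc q T u \<longleftrightarrow>
     (\<lambda>(x, t). u x t) \<in> borel_measurable (lebesgue_on (UNIV \<times> {0<..<T})) \<and>
     (\<forall>K. compact K \<longrightarrow>
        (\<integral>\<^sup>+t\<in>{0<..<T}. (\<integral>\<^sup>+x\<in>K. ennreal (norm (u x t) powr q) \<partial>lebesgue) \<partial>lebesgue) < \<infinity>)"

definition Lq_time_Lq_loc_sigma ::
  "real \<Rightarrow> real \<Rightarrow> (real ^ 'n::finite \<Rightarrow> real \<Rightarrow> real ^ 'n) \<Rightarrow> bool" where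
  "Lq_time_Lq_loc_sigma q T u \<longleftrightarrow>
     Lq_time_Lq_loc q T u \<and>
     (AE t in lebesgue. t \<in> {0<..<T} \<longrightarrow> Lq_loc_sigma q (\<lambda>x. u x t))"

definition spacetime_integral :: "real \<Rightarrow> (real ^ 'n::finite \<Rightarrow> real \<Rightarrow> real) \<Rightarrow> real" where
  "spacetime_integral T g = (LINT t:{0<..<T}|lebesgue. (LINT x|lebesgue. g x t))"

definition weak_solution_NS ::
  "real \<Rightarrow> real \<Rightarrow> (real ^ 'n::finite \<Rightarrow> real \<Rightarrow> real ^ 'n) \<Rightarrow>
   (real ^ 'n \<Rightarrow> real \<Rightarrow> real ^ 'n) \<Rightarrow> (real ^ 'n \<Rightarrow> real \<Rightarrow> real) \<Rightarrow> bool" where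
  "weak_solution_NS \<nu> T f v p \<longleftrightarrow>
     Lq_time_Lq_loc_sigma 2 T v \<and> Lq_time_Lq_loc 1 T p \<and> Lq_time_Lq_loc_sigma 1 T f \<and>
     (\<forall>(\<xi> :: real \<Rightarrow> real) (\<phi> :: real ^ 'n \<Rightarrow> real ^ 'n).
        time_test_function T \<xi> \<longrightarrow> test_function \<phi> \<longrightarrow>
          - spacetime_integral T (\<lambda>x t. (v x t \<bullet> \<phi> x) * deriv \<xi> t)
          - spacetime_integral T
              (\<lambda>x t. double_dot (tensor (v x t) (v x t)) (jacobian_mat \<phi> x) * \<xi> t)
          = spacetime_integral T (\<lambda>x t. p x t * divergence \<phi> x * \<xi> t)
            + \<nu> * spacetime_integral T (\<lambda>x t. (v x t \<bullet> laplacian \<phi> x) * \<xi> t)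
            + spacetime_integral T (\<lambda>x t. (f x t \<bullet> \<phi> x) * \<xi> t))"

end

theory Submission
  imports Defs
begin

text \<open>
  Test the equation with a radial field \<open>\<phi>(x) = h(|x|) x / |x|\<close>. Such a field is a gradient, so a
  divergence-free field is orthogonal to it and to its Laplacian, which is radial as well. The time
  derivative, the viscous term and the force disappear, and what is left is the identity
    \<open>\<integral>\<integral> h'(|x|) a + (h(|x|) / |x|) b dx dt = 0\<close>,
  where \<open>a = (v \<bullet> x)\<^sup>2/|x|\<^sup>2 + p\<close> is the radial stress and
  \<open>b = |v|\<^sup>2 - (v \<bullet> x)\<^sup>2/|x|\<^sup>2 + (N - 1) p\<close> is the sum of the tangential stresses. Choose for \<open>h\<close>
  the primitive of \<open>w\<close> that vanishes at zero. The pressure part of the identity is then exactly the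
  quantity that is nonnegative by hypothesis, and the velocity part is
    \<open>\<integral>\<integral> w (v \<bullet> x)\<^sup>2/|x|\<^sup>2 + (h / |x|) (|v|\<^sup>2 - (v \<bullet> x)\<^sup>2/|x|\<^sup>2)\<close>,
  which is nonnegative with coefficients \<open>w\<close> and \<open>h / |x|\<close> that are positive almost everywhere. Both
  parts vanish, and so does \<open>v\<close>.

  The difficulty is to admit this \<open>h\<close>: its derivative \<open>w\<close> is only locally integrable, and so is
  \<open>a\<close>, so approximating \<open>w\<close> by smooth functions does not control the product \<open>w(|x|) a\<close>. The
  equation itself supplies the missing regularity. Tested with the fields \<open>(\<rho>\<^sup>2 - |x|\<^sup>2) x\<close> on balls,
  which are limits of smooth fields (\<open>tent_balance\<close>), it determines the distribution of \<open>|x|\<^sup>2 a\<close>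
  over the radius: this signed measure on the half-line has the density \<open>r \<beta>(r)\<close>, where \<open>\<beta>(r)\<close> is
  the integral of \<open>a + b\<close> over the ball of radius \<open>r\<close> (\<open>disintegration\<close>). The density is locally
  bounded, hence the identity extends to every compactly supported \<open>h\<close> with integrable derivative whose
  product with \<open>a\<close> is integrable (\<open>radial_identity\<close>). Profiles that equal the primitive of \<open>w\<close> up to a
  small inner cutoff, and that return to zero linearly between \<open>n\<close> and \<open>2 n\<close>, then converge under the
  integrability hypothesis (\<open>weighted_identity\<close>). The only fact about spheres
  that enters is that a null set of radii is a null set of points (\<open>AE_lborel_norm\<close>).
\<close>

section \<open>Smooth functions of one real variable\<close>

text \<open>
  The test functions of the weak formulation must have partial derivatives of all orders. Those
  used below are built from functions of the single variable \<open>s = |x|\<^sup>2\<close>, so smoothness is first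
  developed for functions of one real variable, graded by the number of derivatives so that closure
  properties follow by induction.
\<close>

primrec smooth_upto :: "nat \<Rightarrow> (real \<Rightarrow> real) \<Rightarrow> bool" where
  "smooth_upto 0 F \<longleftrightarrow> continuous_on UNIV F"
| "smooth_upto (Suc k) F \<longleftrightarrow>
     (\<exists>F'. (\<forall>s. (F has_real_derivative F' s) (at s)) \<and> smooth_upto k F')"

definition smooth :: "(real \<Rightarrow> real) \<Rightarrow> bool" where
  "smooth F \<longleftrightarrow> (\<forall>k. smooth_upto k F)"

lemma smooth_upto_SucI:
  "(\<And>s. (F has_real_derivative F' s) (at s)) \<Longrightarrow> smooth_upto k F' \<Longrightarrow> smooth_upto (Suc k) F"
  by auto

lemma smooth_upto_SucD: "smooth_upto (Suc k) F \<Longrightarrow> smooth_upto k F"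
proof (induction k arbitrary: F)
  case 0
  then show ?case
    by (auto simp: continuous_on_eq_continuous_at intro: DERIV_isCont)
next
  case (Suc k)
  from Suc.prems obtain F' where "\<And>s. (F has_real_derivative F' s) (at s)" "smooth_upto (Suc k) F'"
    by auto
  with Suc.IH[of F'] show ?case by auto
qed

lemma smooth_upto_const: "smooth_upto k (\<lambda>_. c)"
proof (induction k arbitrary: c)
  case (Suc k)
  show ?case by (rule smooth_upto_SucI[OF _ Suc[of 0]]) auto
qed simp

lemma smooth_upto_ident: "smooth_upto k (\<lambda>s. s)"
proof (cases k)
  case (Suc m)
  show ?thesis unfolding Suc by (rule smooth_upto_SucI[OF _ smooth_upto_const[of m 1]]) auto
qed simp

lemma smooth_upto_add:
  "smooth_upto k F \<Longrightarrow> smooth_upto k G \<Longrightarrow> smooth_upto k (\<lambda>s. F s + G s)"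
proof (induction k arbitrary: F G)
  case (Suc k)
  then obtain F' G' where "\<And>s. (F has_real_derivative F' s) (at s)" "smooth_upto k F'"
    "\<And>s. (G has_real_derivative G' s) (at s)" "smooth_upto k G'" by auto
  then show ?case
    by (intro smooth_upto_SucI[of _ "\<lambda>s. F' s + G' s"] DERIV_add Suc.IH)
qed (auto intro: continuous_on_add)

lemma smooth_upto_mult:
  "smooth_upto k F \<Longrightarrow> smooth_upto k G \<Longrightarrow> smooth_upto k (\<lambda>s. F s * G s)"
proof (induction k arbitrary: F G)
  case (Suc k)
  then obtain F' G' where d: "\<And>s. (F has_real_derivative F' s) (at s)" "smooth_upto k F'"
    "\<And>s. (G has_real_derivative G' s) (at s)" "smooth_upto k G'" by auto
  have "smooth_upto k F" "smooth_upto k G" by (rule smooth_upto_SucD[OF Suc.prems(1)] smooth_upto_SucD[OF Suc.prems(2)])+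
  with d show ?case
    by (intro smooth_upto_SucI[of _ "\<lambda>s. F' s * G s + G' s * F s"] DERIV_mult smooth_upto_add Suc.IH)
qed (auto intro: continuous_on_mult)

lemma smooth_upto_affine:
  "smooth_upto k F \<Longrightarrow> smooth_upto k (\<lambda>s. F (c + m * s))"
proof (induction k arbitrary: F)
  case 0
  then show ?case by (auto intro!: continuous_intros elim: continuous_on_compose2)
next
  case (Suc k)
  then obtain F' where d: "\<And>s. (F has_real_derivative F' s) (at s)" "smooth_upto k F'" by auto
  show ?case
  proof (rule smooth_upto_SucI[of _ "\<lambda>s. F' (c + m * s) * m"])
    show "((\<lambda>s. F (c + m * s)) has_real_derivative F' (c + m * s) * m) (at s)" for s
      by (rule DERIV_chain2[OF d(1)]) (auto intro!: derivative_eq_intros)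
    show "smooth_upto k (\<lambda>s. F' (c + m * s) * m)"
      by (intro smooth_upto_mult smooth_upto_const Suc.IH d)
  qed
qed

lemma smooth_const: "smooth (\<lambda>_. c)"
  and smooth_ident: "smooth (\<lambda>s. s)"
  and smooth_add: "smooth F \<Longrightarrow> smooth G \<Longrightarrow> smooth (\<lambda>s. F s + G s)"
  and smooth_mult: "smooth F \<Longrightarrow> smooth G \<Longrightarrow> smooth (\<lambda>s. F s * G s)"
  and smooth_affine: "smooth F \<Longrightarrow> smooth (\<lambda>s. F (c + m * s))"
  by (auto simp: smooth_def smooth_upto_const smooth_upto_ident smooth_upto_add smooth_upto_mult
      smooth_upto_affine)

lemma smooth_imp_continuous: "smooth F \<Longrightarrow> continuous_on S F"
  unfolding smooth_def by (metis continuous_on_subset smooth_upto.simps(1) subset_UNIV)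

lemma smooth_deriv:
  assumes "smooth F"
  shows "(F has_real_derivative deriv F s) (at s)" and "smooth (deriv F)"
proof -
  have *: "(\<forall>s. (F has_real_derivative deriv F s) (at s)) \<and> smooth_upto k (deriv F)" for k
  proof -
    obtain F' where d: "\<And>s. (F has_real_derivative F' s) (at s)" "smooth_upto k F'"
      using assms[unfolded smooth_def, rule_format, of "Suc k"] by auto
    then have "deriv F = F'" by (auto intro: DERIV_imp_deriv)
    with d show ?thesis by auto
  qed
  then show "(F has_real_derivative deriv F s) (at s)" "smooth (deriv F)"
    unfolding smooth_def by auto
qed

lemma smooth_antideriv:
  assumes "\<And>s. (E has_real_derivative F s) (at s)" and "smooth F"
  shows "smooth E"
  unfolding smooth_def
proof
  fix k
  have "smooth_upto (Suc k) E"
    using assms by (intro smooth_upto_SucI) (auto simp: smooth_def)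
  then show "smooth_upto k E" by (rule smooth_upto_SucD)
qed

text \<open>
  Subtracting the value at \<open>c\<close> from an antiderivative makes it vanish on the whole half-line on which
  \<open>F\<close> does. A radial field \<open>F(|x|\<^sup>2) x\<close> thereby becomes the gradient of a compactly
  supported function.
\<close>

lemma smooth_antideriv_vanishing:
  assumes F: "smooth F" and van: "\<And>s. s \<ge> c \<Longrightarrow> F s = 0"
  obtains E where "smooth E" "\<And>s. (E has_real_derivative F s) (at s)" "\<And>s. s \<ge> c \<Longrightarrow> E s = 0"
proof -
  have cont: "continuous_on UNIV F" using F by (rule smooth_imp_continuous)
  obtain E0 where E0: "\<And>s. (E0 has_real_derivative F s) (at s)"
  proof -
    have "\<exists>g. \<forall>x. -\<infinity> < ereal x \<longrightarrow> ereal x < \<infinity> \<longrightarrow> (g has_vector_derivative F x) (at x)"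
      using einterval_antiderivative[of "-\<infinity>" "\<infinity>" F] cont
      by (auto simp: continuous_on_eq_continuous_at)
    then show ?thesis
      using that by (auto simp: has_real_derivative_iff_has_vector_derivative)
  qed
  define E where "E = (\<lambda>s. E0 s - E0 c)"
  have E: "(E has_real_derivative F s) (at s)" for s
    unfolding E_def using E0[of s] by (auto intro!: derivative_eq_intros)
  moreover have "E s = 0" if "s \<ge> c" for s
  proof (cases "s = c")
    case False
    with that have "c < s" by simp
    then obtain z where "z > c" "E0 s - E0 c = (s - c) * F z"
      using MVT2[of c s E0 F] E0 by blast
    then show ?thesis using van[of z] by (simp add: E_def)
  qed (simp add: E_def)
  ultimately show ?thesis using that smooth_antideriv[OF E F] by blast
qed

lemma deriv_vanishing:
  assumes "(F has_real_derivative D) (at s)" and "\<And>s. s \<ge> c \<Longrightarrow> F s = 0" and "s \<ge> c"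
  shows "D = (0::real)"
proof -
  have "(F has_real_derivative D) (at s within {s..})"
    using assms(1) by (rule has_field_derivative_at_within)
  moreover have "(F has_real_derivative 0) (at s within {s..})"
    by (rule has_field_derivative_transform_within[where f = "\<lambda>_. 0" and d = 1])
       (use assms in auto)
  ultimately show ?thesis
    by (rule has_field_derivative_unique) (simp add: at_within_Ici_at_right)
qed

text \<open>
  The case \<open>m = 0\<close> is the standard function that is flat at the origin. The factors \<open>1 / y ^ m\<close>
  are those that differentiation produces, so the family is closed under derivatives up to linear
  combinations.
\<close>

definition flat_exp :: "nat \<Rightarrow> real \<Rightarrow> real" where
  "flat_exp m y = (if y > 0 then exp (- 1 / y) / y ^ m else 0)"

lemma power_div_fact_le_exp:
  fixes x :: real
  assumes "x \<ge> 0"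
  shows "x ^ n / fact n \<le> exp x"
proof -
  have "(\<Sum>k\<in>{n}. x ^ k / fact k) \<le> (\<Sum>k. x ^ k / fact k)"
    using assms exp_converges[of x] by (intro sum_le_suminf) (auto simp: sums_iff field_simps)
  then show ?thesis
    using exp_converges[of x] by (simp add: sums_iff field_simps)
qed

text \<open>
  The exponential series dominates each of its terms, so \<open>flat_exp m\<close> vanishes at the
  origin to every order \<open>j\<close>.
\<close>

lemma flat_exp_bound: "0 \<le> flat_exp m y" "y > 0 \<Longrightarrow> flat_exp m y \<le> fact (m + j) * y ^ j"
proof -
  show "0 \<le> flat_exp m y" by (auto simp: flat_exp_def)
  assume y: "y > 0"
  have "(1 / y) ^ (m + j) / fact (m + j) \<le> exp (1 / y)"
    using y by (intro power_div_fact_le_exp) auto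
  then have "exp (- 1 / y) \<le> fact (m + j) * y ^ (m + j)"
    using y by (simp add: exp_minus field_simps power_one_over)
  then show "flat_exp m y \<le> fact (m + j) * y ^ j"
    using y by (simp add: flat_exp_def field_simps power_add)
qed

lemma flat_exp_deriv:
  "(flat_exp m has_real_derivative flat_exp (m + 2) y - real m * flat_exp (m + 1) y) (at y)"
proof -
  consider "y > 0" | "y < 0" | "y = 0" by linarith
  then show ?thesis
  proof cases
    case 1
    have pow: "((\<lambda>y. y ^ m) has_real_derivative real m * y ^ m / y) (at y)"
      using DERIV_pow[of m y] 1 by (cases m) (simp_all del: power_Suc add: power_Suc2)
    have exp: "((\<lambda>y. exp (- 1 / y)) has_real_derivative exp (- 1 / y) / y\<^sup>2) (at y)"
      using 1 by (auto intro!: derivative_eq_intros simp: power2_eq_square)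
    have "((\<lambda>y. exp (- 1 / y) / y ^ m) has_real_derivative
        flat_exp (m + 2) y - real m * flat_exp (m + 1) y) (at y)"
      using DERIV_divide[OF exp pow] 1
      by (simp add: flat_exp_def power2_eq_square diff_divide_distrib mult_ac)
    then show ?thesis
      by (rule has_field_derivative_transform_within_open[of _ _ _ "{0<..}"])
         (use 1 in \<open>auto simp: flat_exp_def\<close>)
  next
    case 2
    have "((\<lambda>_. 0) has_real_derivative flat_exp (m + 2) y - real m * flat_exp (m + 1) y) (at y)"
      using 2 by (auto simp: flat_exp_def)
    then show ?thesis
      by (rule has_field_derivative_transform_within_open[of _ _ _ "{..<0}"])
         (use 2 in \<open>auto simp: flat_exp_def\<close>)
  next
    case 3
    have bd: "\<bar>flat_exp m h / h\<bar> \<le> fact (m + 2) * \<bar>h\<bar>" for h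
    proof (cases "h > 0")
      case True
      then show ?thesis using flat_exp_bound(1)[of m h] flat_exp_bound(2)[of h m 2]
        by (simp add: field_simps power2_eq_square)
    qed (simp add: flat_exp_def mult_nonneg_nonpos del: fact_Suc add_2_eq_Suc')
    have "((\<lambda>h. flat_exp m h / h) \<longlongrightarrow> 0) (at 0)"
    proof (rule tendsto_rabs_zero_cancel, rule tendsto_sandwich[where f = "\<lambda>_. 0"])
      show "((\<lambda>h. fact (m + 2) * \<bar>h\<bar>) \<longlongrightarrow> (0::real)) (at 0)"
        by (auto intro!: tendsto_eq_intros)
    qed (use bd in auto)
    then show ?thesis
      using 3 by (simp add: DERIV_def flat_exp_def)
  qed
qed

lemma smooth_flat_exp: "smooth (flat_exp m)"
proof -
  have "smooth_upto k (flat_exp m)" for k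
  proof (induction k arbitrary: m)
    case 0
    show ?case using flat_exp_deriv
      by (auto simp: continuous_on_eq_continuous_at intro: DERIV_isCont)
  next
    case (Suc k)
    have "smooth_upto k (\<lambda>y. flat_exp (m + 2) y + (- real m) * flat_exp (m + 1) y)"
      by (intro smooth_upto_add smooth_upto_mult smooth_upto_const Suc)
    then show ?case using flat_exp_deriv[of m]
      by (intro smooth_upto_SucI[of _ "\<lambda>y. flat_exp (m + 2) y + (- real m) * flat_exp (m + 1) y"]) auto
  qed
  then show ?thesis by (auto simp: smooth_def)
qed

section \<open>Radial test fields\<close>

text \<open>
  The definition of \<open>Ck\<close> speaks about Frechet derivatives along the axes. This introduction
  rule replaces them by any known total derivative.
\<close>

lemma Ck_SucI:
  fixes g :: "real ^ 'n::finite \<Rightarrow> 'b::real_normed_vector"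
  assumes "\<And>x. (g has_derivative g' x) (at x)" and "\<And>j. Ck k (\<lambda>x. g' x (axis j 1))"
  shows "Ck (Suc k) g"
proof -
  have "partial_deriv j g = (\<lambda>x. g' x (axis j 1))" for j
    unfolding partial_deriv_def using assms(1) by (metis frechet_derivative_at)
  with assms show ?thesis
    by (auto simp: differentiable_on_def differentiable_def)
qed

lemma Ck_SucD:
  fixes g :: "real ^ 'n::finite \<Rightarrow> 'b::real_normed_vector"
  assumes "Ck (Suc k) g"
  shows "Ck k g"
  using assms
proof (induction k arbitrary: g)
  case 0
  then show ?case by (auto intro: differentiable_imp_continuous_on)
qed auto

lemma Ck_has_derivative:
  fixes g :: "real ^ 'n::finite \<Rightarrow> 'b::real_normed_vector"
  assumes "Ck (Suc k) g"
  shows "(g has_derivative frechet_derivative g (at x)) (at x)"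
    and "Ck k (\<lambda>x. frechet_derivative g (at x) (axis j 1))"
  using assms by (auto simp: differentiable_on_def frechet_derivative_works partial_deriv_def[abs_def])

lemma Ck_const:
  fixes c :: "'b::real_normed_vector"
  shows "Ck k (\<lambda>_ :: real ^ 'n::finite. c)"
proof (induction k arbitrary: c)
  case (Suc k)
  show ?case by (rule Ck_SucI[OF has_derivative_const]) (rule Suc)
qed simp

lemma Ck_linear:
  fixes L :: "real ^ 'n::finite \<Rightarrow> 'b::real_normed_vector"
  assumes "bounded_linear L"
  shows "Ck k L"
proof (cases k)
  case 0
  then show ?thesis using assms by (simp add: linear_continuous_on)
next
  case (Suc m)
  show ?thesis unfolding Suc
    by (rule Ck_SucI[OF bounded_linear_imp_has_derivative[OF assms]]) (rule Ck_const)
qed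

lemma Ck_add:
  fixes g h :: "real ^ 'n::finite \<Rightarrow> 'b::real_normed_vector"
  shows "Ck k g \<Longrightarrow> Ck k h \<Longrightarrow> Ck k (\<lambda>x. g x + h x)"
proof (induction k arbitrary: g h)
  case (Suc k)
  note g = Ck_has_derivative[OF Suc.prems(1)] and h = Ck_has_derivative[OF Suc.prems(2)]
  show ?case
    by (rule Ck_SucI[OF has_derivative_add[OF g(1) h(1)]]) (rule Suc.IH[OF g(2) h(2)])
qed (auto intro: continuous_on_add)

lemma Ck_scaleR:
  fixes f :: "real ^ 'n::finite \<Rightarrow> real" and g :: "real ^ 'n \<Rightarrow> 'b::real_normed_vector"
  shows "Ck k f \<Longrightarrow> Ck k g \<Longrightarrow> Ck k (\<lambda>x. f x *\<^sub>R g x)"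
proof (induction k arbitrary: f g)
  case (Suc k)
  note f = Ck_has_derivative[OF Suc.prems(1)] and g = Ck_has_derivative[OF Suc.prems(2)]
  show ?case
    by (rule Ck_SucI[OF has_derivative_scaleR[OF f(1) g(1)]])
       (intro Ck_add Suc.IH f(2) g(2) Ck_SucD[OF Suc.prems(1)] Ck_SucD[OF Suc.prems(2)])
qed (auto intro: continuous_on_scaleR)

lemma radial_has_derivative:
  fixes x :: "'a::real_inner"
  assumes "(F has_real_derivative D) (at (x \<bullet> x))"
  shows "((\<lambda>x. F (x \<bullet> x)) has_derivative (\<lambda>h. 2 * D * (x \<bullet> h))) (at x)"
proof -
  have "((\<lambda>x. x \<bullet> x) has_derivative (\<lambda>h. x \<bullet> h + h \<bullet> x)) (at x)"
    by (rule has_derivative_inner[OF has_derivative_ident has_derivative_ident])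
  from has_derivative_compose[OF this has_field_derivative_imp_has_derivative[OF assms]]
  show ?thesis by (simp add: inner_commute algebra_simps)
qed

text \<open>
  The \<open>j\<close>-th partial derivative of \<open>F(|x|\<^sup>2)\<close> is \<open>2 x\<^sub>j F'(|x|\<^sup>2)\<close>, a product
  of a linear function and a function of the same kind. Hence the induction runs over all smooth
  \<open>F\<close> at once.
\<close>

lemma Ck_radial:
  assumes "smooth F"
  shows "Ck k (\<lambda>x :: real ^ 'n::finite. F (x \<bullet> x))"
  using assms
proof (induction k arbitrary: F)
  case 0
  then show ?case
    by (auto intro!: continuous_on_compose2[OF smooth_imp_continuous[of F UNIV]] continuous_intros)
next
  case (Suc k)
  have lin: "bounded_linear (\<lambda>x :: real ^ 'n. 2 * (x \<bullet> axis j 1))" for j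
    by (intro bounded_linear_intros)
  show ?case
  proof (rule Ck_SucI[OF radial_has_derivative[OF smooth_deriv(1)[OF Suc.prems]]])
    show "Ck k (\<lambda>x :: real ^ 'n. 2 * deriv F (x \<bullet> x) * (x \<bullet> axis j 1))" for j
      using Ck_scaleR[OF Suc.IH[OF smooth_deriv(2)[OF Suc.prems]] Ck_linear[OF lin], of j]
      by (simp add: mult_ac)
  qed
qed

lemma test_functionI_radial:
  fixes g :: "real ^ 'n::finite \<Rightarrow> 'b::real_normed_vector"
  assumes "\<And>k. Ck k g" and van: "\<And>x. x \<bullet> x \<ge> c \<Longrightarrow> g x = 0"
  shows "test_function g"
proof -
  have "norm x \<le> sqrt \<bar>c\<bar>" if "g x \<noteq> 0" for x
  proof -
    have "(norm x)\<^sup>2 \<le> \<bar>c\<bar>"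
      using van[of x] that by (force simp: dot_square_norm)
    then show ?thesis by (rule real_le_rsqrt)
  qed
  then have "{x. g x \<noteq> 0} \<subseteq> cball 0 (sqrt \<bar>c\<bar>)" by auto
  then have "compact (closure {x. g x \<noteq> 0})"
    by (metis bounded_cball bounded_subset compact_closure)
  with assms(1) show ?thesis by (simp add: test_function_def)
qed

text \<open>
  Writing the argument as \<open>|x|\<^sup>2\<close> rather than \<open>|x|\<close> keeps the field smooth at the origin.
\<close>

definition radial_field :: "(real \<Rightarrow> real) \<Rightarrow> real ^ 'n::finite \<Rightarrow> real ^ 'n" where
  "radial_field F x = F (x \<bullet> x) *\<^sub>R x"

lemma test_function_radial:
  assumes "smooth F" and "\<And>s. s \<ge> c \<Longrightarrow> F s = 0"
  shows "test_function (\<lambda>x :: real ^ 'n::finite. F (x \<bullet> x))"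
  by (rule test_functionI_radial[where c = c]) (use assms Ck_radial in auto)

lemma test_function_radial_field:
  assumes "smooth F" and "\<And>s. s \<ge> c \<Longrightarrow> F s = 0"
  shows "test_function (radial_field F :: real ^ 'n::finite \<Rightarrow> _)"
  unfolding radial_field_def[abs_def]
  by (rule test_functionI_radial[where c = c])
     (use assms in \<open>auto intro!: Ck_scaleR Ck_radial Ck_linear[OF bounded_linear_ident]\<close>)

lemma partial_deriv_eqI:
  "(g has_derivative g') (at x) \<Longrightarrow> partial_deriv j g x = g' (axis j 1)"
  unfolding partial_deriv_def by (metis frechet_derivative_at)

lemma radial_field_eq_grad:
  assumes "\<And>s. (E has_real_derivative F s / 2) (at s)"
  shows "radial_field F = (grad (\<lambda>x. E (x \<bullet> x)) :: real ^ 'n::finite \<Rightarrow> _)"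
proof
  fix x :: "real ^ 'n"
  have "partial_deriv i (\<lambda>x. E (x \<bullet> x)) x = F (x \<bullet> x) * x $ i" for i
    using partial_deriv_eqI[OF radial_has_derivative[OF assms], of i x]
    by (simp add: inner_axis)
  then show "radial_field F x = grad (\<lambda>x. E (x \<bullet> x)) x"
    by (simp add: radial_field_def grad_def vec_eq_iff)
qed

text \<open>
  A radial field is a gradient of a test function, and a divergence-free field annihilates
  gradients.
\<close>

lemma distr_div_free_radial_field:
  fixes u :: "real ^ 'n::finite \<Rightarrow> real ^ 'n"
  assumes u: "distr_div_free u" and F: "smooth F" "\<And>s. s \<ge> c \<Longrightarrow> F s = 0"
  shows "(LINT x|lebesgue. u x \<bullet> radial_field F x) = 0"
proof -
  have "smooth (\<lambda>s. F s * (1/2))" by (intro smooth_mult F smooth_const)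
  then obtain E where E: "smooth E" "\<And>s. (E has_real_derivative F s * (1/2)) (at s)"
    "\<And>s. s \<ge> c \<Longrightarrow> E s = 0"
    by (rule smooth_antideriv_vanishing[where c = c]) (use F(2) in auto)
  have "test_function (\<lambda>x :: real ^ 'n. E (x \<bullet> x))"
    by (rule test_function_radial) (use E in auto)
  with u have "(LINT x|lebesgue. u x \<bullet> grad (\<lambda>x. E (x \<bullet> x)) x) = 0"
    by (simp add: distr_div_free_def)
  then show ?thesis
    using radial_field_eq_grad[of E F, where 'n = 'n] E(2) by simp
qed

lemma radial_field_has_derivative:
  assumes "\<And>s. (F has_real_derivative F' s) (at s)"
  shows "(radial_field F has_derivative
    (\<lambda>h. F (x \<bullet> x) *\<^sub>R h + (2 * F' (x \<bullet> x) * (x \<bullet> h)) *\<^sub>R x)) (at x)"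
  unfolding radial_field_def[abs_def]
  by (rule has_derivative_scaleR[OF radial_has_derivative[OF assms] has_derivative_ident])

lemma partial_deriv_radial_field:
  assumes "\<And>s. (F has_real_derivative F' s) (at s)"
  shows "partial_deriv j (radial_field F) =
    (\<lambda>x. F (x \<bullet> x) *\<^sub>R axis j 1 + (2 * x $ j) *\<^sub>R radial_field F' x)"
  using partial_deriv_eqI[OF radial_field_has_derivative[OF assms]]
  by (auto simp: fun_eq_iff inner_axis radial_field_def mult_ac)

lemma divergence_radial_field:
  fixes x :: "real ^ 'n::finite"
  assumes "\<And>s. (F has_real_derivative F' s) (at s)"
  shows "divergence (radial_field F) x = real CARD('n) * F (x \<bullet> x) + 2 * (x \<bullet> x) * F' (x \<bullet> x)"
  unfolding divergence_def partial_deriv_radial_field[OF assms]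
  by (simp add: radial_field_def sum.distrib inner_vec_def sum_distrib_left sum_distrib_right mult_ac)

lemma double_dot_jacobian_radial_field:
  fixes a x :: "real ^ 'n::finite"
  assumes "\<And>s. (F has_real_derivative F' s) (at s)"
  shows "double_dot (tensor a a) (jacobian_mat (radial_field F) x) =
    F (x \<bullet> x) * (a \<bullet> a) + 2 * F' (x \<bullet> x) * (a \<bullet> x)\<^sup>2"
proof -
  have "a $ i * a $ j * partial_deriv j (radial_field F) x $ i =
      F (x \<bullet> x) * (if i = j then a $ i * a $ j else 0)
      + 2 * F' (x \<bullet> x) * ((a $ i * x $ i) * (a $ j * x $ j))" for i j
    unfolding partial_deriv_radial_field[OF assms]
    by (simp add: radial_field_def axis_def algebra_simps)
  then have "double_dot (tensor a a) (jacobian_mat (radial_field F) x) =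
      (\<Sum>i\<in>UNIV. \<Sum>j\<in>UNIV. F (x \<bullet> x) * (if i = j then a $ i * a $ j else 0))
      + (\<Sum>i\<in>UNIV. \<Sum>j\<in>UNIV. 2 * F' (x \<bullet> x) * ((a $ i * x $ i) * (a $ j * x $ j)))"
    unfolding double_dot_def tensor_def jacobian_mat_def by (simp add: sum.distrib)
  also have "\<dots> = F (x \<bullet> x) * (\<Sum>i\<in>UNIV. a $ i * a $ i)
      + 2 * F' (x \<bullet> x) * ((\<Sum>i\<in>UNIV. a $ i * x $ i) * (\<Sum>j\<in>UNIV. a $ j * x $ j))"
  proof (intro arg_cong2[where f = "(+)"])
    show "(\<Sum>i\<in>UNIV. \<Sum>j\<in>UNIV. F (x \<bullet> x) * (if i = j then a $ i * a $ j else 0)) =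
        F (x \<bullet> x) * (\<Sum>i\<in>UNIV. a $ i * a $ i)"
      by (simp add: sum_distrib_left if_distrib cong: if_cong)
    show "(\<Sum>i\<in>UNIV. \<Sum>j\<in>UNIV. 2 * F' (x \<bullet> x) * ((a $ i * x $ i) * (a $ j * x $ j))) =
        2 * F' (x \<bullet> x) * ((\<Sum>i\<in>UNIV. a $ i * x $ i) * (\<Sum>j\<in>UNIV. a $ j * x $ j))"
      unfolding sum_product by (simp only: sum_distrib_left)
  qed
  finally show ?thesis
    by (simp add: inner_vec_def power2_eq_square)
qed

text \<open>
  The Laplacian of a radial field is again radial. The viscous term of the weak formulation is
  therefore annihilated by a divergence-free velocity for the same reason as the other linear
  terms.
\<close>

lemma laplacian_radial_field:
  fixes x :: "real ^ 'n::finite"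
  assumes F': "\<And>s. (F has_real_derivative F' s) (at s)"
    and F'': "\<And>s. (F' has_real_derivative F'' s) (at s)"
  shows "laplacian (radial_field F) x =
    radial_field (\<lambda>s. (2 * real CARD('n) + 4) * F' s + 4 * s * F'' s) x"
proof -
  have pp: "partial_deriv i (partial_deriv i (radial_field F)) x =
      (4 * x $ i * F' (x \<bullet> x)) *\<^sub>R axis i 1 + (2 * F' (x \<bullet> x)) *\<^sub>R x
      + (4 * (x $ i * x $ i) * F'' (x \<bullet> x)) *\<^sub>R x" for i
  proof -
    have "((\<lambda>x. F (x \<bullet> x) *\<^sub>R axis i 1 + (2 * x $ i) *\<^sub>R radial_field F' x) has_derivative
      (\<lambda>h. (2 * F' (x \<bullet> x) * (x \<bullet> h)) *\<^sub>R axis i 1 +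
        ((2 * x $ i) *\<^sub>R (F' (x \<bullet> x) *\<^sub>R h + (2 * F'' (x \<bullet> x) * (x \<bullet> h)) *\<^sub>R x)
         + (2 * h $ i) *\<^sub>R radial_field F' x))) (at x)"
      by (intro has_derivative_add has_derivative_scaleR_left has_derivative_scaleR
          radial_has_derivative F' radial_field_has_derivative F'' has_derivative_mult_right
          bounded_linear_imp_has_derivative bounded_linear_vec_nth)
    from partial_deriv_eqI[OF this, of i] show ?thesis
      unfolding partial_deriv_radial_field[OF F']
      by (simp add: inner_axis radial_field_def vec_eq_iff algebra_simps)
  qed
  have "(\<Sum>i\<in>UNIV. (4 * x $ i * F' (x \<bullet> x)) *\<^sub>R axis i (1::real)) = (4 * F' (x \<bullet> x)) *\<^sub>R x"
    by (simp add: vec_eq_iff axis_def if_distrib sum.delta cong: if_cong)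
  moreover have "(\<Sum>i\<in>UNIV. (4 * (x $ i * x $ i) * F'' (x \<bullet> x)) *\<^sub>R x) =
      (4 * (x \<bullet> x) * F'' (x \<bullet> x)) *\<^sub>R x"
    by (simp add: inner_vec_def sum_distrib_left sum_distrib_right flip: scaleR_sum_left)
  ultimately show ?thesis
    unfolding laplacian_def pp
    by (simp add: sum.distrib radial_field_def sum_constant_scaleR algebra_simps del: sum_constant)
qed

section \<open>Signed push-forwards and null sets of radii\<close>

text \<open>
  Two signed measures given by densities on different spaces are compared after transport to the
  line. Moving the negative parts to the other side of the equation turns the comparison into one
  between two positive measures, each of which is a sum.
\<close>

definition sum_measure :: "real measure \<Rightarrow> real measure \<Rightarrow> real measure" where
  "sum_measure A B = measure_of UNIV (sets borel) (\<lambda>E. emeasure A E + emeasure B E)"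

lemma sets_sum_measure [simp, measurable_cong]: "sets (sum_measure A B) = sets borel"
  unfolding sum_measure_def by (metis sets.sets_measure_of_eq space_borel)

lemma emeasure_sum_measure:
  assumes "sets A = sets borel" "sets B = sets borel" "E \<in> sets borel"
  shows "emeasure (sum_measure A B) E = emeasure A E + emeasure B E"
  unfolding sum_measure_def
proof (rule emeasure_measure_of_sigma)
  show "sigma_algebra UNIV (sets (borel :: real measure))"
    by (metis sets.sigma_algebra_axioms space_borel)
  show "positive (sets borel) (\<lambda>E. emeasure A E + emeasure B E)"
    by (simp add: positive_def)
  show "countably_additive (sets borel) (\<lambda>E. emeasure A E + emeasure B E)"
    unfolding countably_additive_def
  proof safe
    fix S :: "nat \<Rightarrow> real set"
    assume S: "range S \<subseteq> sets borel" "disjoint_family S"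
    show "(\<Sum>i. emeasure A (S i) + emeasure B (S i)) = emeasure A (\<Union>(range S)) + emeasure B (\<Union>(range S))"
      using S assms by (simp add: suminf_add suminf_emeasure flip: suminf_add)
  qed
qed (rule assms(3))

lemma nn_integral_sum_measure:
  assumes A: "sets A = sets borel" and B: "sets B = sets borel"
    and k: "k \<in> borel_measurable borel"
  shows "(\<integral>\<^sup>+x. k x \<partial>sum_measure A B) = (\<integral>\<^sup>+x. k x \<partial>A) + (\<integral>\<^sup>+x. k x \<partial>B)"
  using k
proof (induction k rule: borel_measurable_induct)
  case (cong f g)
  then show ?case by (metis UNIV_I ext space_borel)
next
  case (set E)
  then show ?case using A B by (simp add: emeasure_sum_measure)
next
  case (mult u c)
  have "u \<in> borel_measurable A" "u \<in> borel_measurable B" "u \<in> borel_measurable (sum_measure A B)"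
    using mult(2) A B by (auto cong: measurable_cong_sets)
  then show ?case using mult by (simp add: nn_integral_cmult distrib_left)
next
  case (add u v)
  have "u \<in> borel_measurable A" "u \<in> borel_measurable B" "u \<in> borel_measurable (sum_measure A B)"
    "v \<in> borel_measurable A" "v \<in> borel_measurable B" "v \<in> borel_measurable (sum_measure A B)"
    using add A B by (auto cong: measurable_cong_sets)
  then show ?case using add by (simp add: nn_integral_add ac_simps)
next
  case (seq U)
  have m: "U i \<in> borel_measurable A" "U i \<in> borel_measurable B"
    "U i \<in> borel_measurable (sum_measure A B)" for i
    using seq A B by (auto cong: measurable_cong_sets)
  have SUP: "(SUP i. U i) = (\<lambda>x. SUP i. U i x)"
    by (auto simp: fun_eq_iff image_comp)
  have *: "(\<integral>\<^sup>+x. (SUP i. U i x) \<partial>D) = (SUP i. \<integral>\<^sup>+x. U i x \<partial>D)"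
    if "\<And>i. U i \<in> borel_measurable D" for D
    using nn_integral_monotone_convergence_SUP[OF seq(3) that] by simp
  have inc: "incseq (\<lambda>i. \<integral>\<^sup>+x. U i x \<partial>D)" for D
    using seq(3) by (auto simp: incseq_def le_fun_def intro!: nn_integral_mono)
  then show ?case
    unfolding SUP *[OF m(1)] *[OF m(2)] *[OF m(3)] seq.IH
    using inc by (intro ennreal_SUP_add) auto
qed

text \<open>
  With the negative parts moved across, only finite nonnegative quantities occur, and the equation can
  be read as one between integrals over positive measures.
\<close>

lemma integral_eq_iff_nn_integral:
  fixes f :: "'a \<Rightarrow> real" and g :: "'b \<Rightarrow> real"
  assumes f: "integrable M f" and g: "integrable N g"
  shows "(\<integral>x. f x \<partial>M) = (\<integral>y. g y \<partial>N) \<longleftrightarrow>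
    (\<integral>\<^sup>+x. f x \<partial>M) + (\<integral>\<^sup>+y. - g y \<partial>N) = (\<integral>\<^sup>+x. - f x \<partial>M) + (\<integral>\<^sup>+y. g y \<partial>N)"
proof -
  have fin: "(\<integral>\<^sup>+x. f x \<partial>M) \<noteq> \<infinity>" "(\<integral>\<^sup>+x. - f x \<partial>M) \<noteq> \<infinity>"
    "(\<integral>\<^sup>+y. g y \<partial>N) \<noteq> \<infinity>" "(\<integral>\<^sup>+y. - g y \<partial>N) \<noteq> \<infinity>"
    using f g by (simp_all add: real_integrable_def)
  have arith: "enn2real a - enn2real a' = enn2real b - enn2real b' \<longleftrightarrow> a + b' = a' + b"
    if "a \<noteq> \<infinity>" "a' \<noteq> \<infinity>" "b \<noteq> \<infinity>" "b' \<noteq> \<infinity>" for a a' b b'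
    using that
    by (cases a; cases a'; cases b; cases b') (auto simp flip: ennreal_plus)
  show ?thesis
    unfolding real_lebesgue_integral_def[OF f] real_lebesgue_integral_def[OF g]
    by (rule arith[OF fin])
qed

text \<open>
  Negative values of \<open>f\<close> count as zero here; the negative part of a signed density is the
  push-forward of \<open>- f\<close>.
\<close>

definition push_density :: "'a measure \<Rightarrow> ('a \<Rightarrow> real) \<Rightarrow> ('a \<Rightarrow> real) \<Rightarrow> real measure" where
  "push_density M X f = distr (density M (\<lambda>\<omega>. ennreal (f \<omega>))) borel X"

lemma sets_push_density [simp, measurable_cong]: "sets (push_density M X f) = sets borel"
  by (simp add: push_density_def)

lemma nn_integral_push_density:
  fixes k :: "real \<Rightarrow> real"
  assumes [measurable]: "f \<in> borel_measurable M" "X \<in> borel_measurable M" "k \<in> borel_measurable borel"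
    and k: "\<And>x. k x \<ge> 0"
  shows "(\<integral>\<^sup>+x. k x \<partial>push_density M X f) = (\<integral>\<^sup>+\<omega>. ennreal (k (X \<omega>) * f \<omega>) \<partial>M)"
  unfolding push_density_def
  by (simp add: nn_integral_distr nn_integral_density ennreal_mult'' k mult.commute)

text \<open>
  Half-lines generate the Borel sets and are stable under intersection, so two finite measures that
  agree on them coincide. Integrals of nonnegative Borel functions then coincide as well, even if the
  function is unbounded.
\<close>

lemma signed_pushforward_eqI_nonneg:
  fixes X :: "'a \<Rightarrow> real" and Y :: "'b \<Rightarrow> real"
    and f :: "'a \<Rightarrow> real" and g :: "'b \<Rightarrow> real"
  assumes f: "integrable M f" and g: "integrable N g"
    and X[measurable]: "X \<in> borel_measurable M" and Y[measurable]: "Y \<in> borel_measurable N"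
    and eq: "\<And>c. (\<integral>\<omega>. indicator {c<..} (X \<omega>) * f \<omega> \<partial>M) = (\<integral>\<omega>. indicator {c<..} (Y \<omega>) * g \<omega> \<partial>N)"
    and k[measurable]: "k \<in> borel_measurable borel" and k0: "\<And>x. k x \<ge> 0"
    and kf: "integrable M (\<lambda>\<omega>. k (X \<omega>) * f \<omega>)" and kg: "integrable N (\<lambda>\<omega>. k (Y \<omega>) * g \<omega>)"
  shows "(\<integral>\<omega>. k (X \<omega>) * f \<omega> \<partial>M) = (\<integral>\<omega>. k (Y \<omega>) * g \<omega> \<partial>N)"
proof -
  have [measurable]: "f \<in> borel_measurable M" "g \<in> borel_measurable N" using f g by auto
  let ?S1 = "sum_measure (push_density M X f) (push_density N Y (\<lambda>y. - g y))"
  let ?S2 = "sum_measure (push_density M X (\<lambda>x. - f x)) (push_density N Y g)"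
  have S: "(\<integral>\<^sup>+x. h x \<partial>?S1) = (\<integral>\<^sup>+x. h x \<partial>?S2) \<longleftrightarrow>
      (\<integral>\<omega>. h (X \<omega>) * f \<omega> \<partial>M) = (\<integral>\<omega>. h (Y \<omega>) * g \<omega> \<partial>N)"
    if [measurable]: "h \<in> borel_measurable borel" and "\<And>x. h x \<ge> 0"
      and "integrable M (\<lambda>\<omega>. h (X \<omega>) * f \<omega>)" "integrable N (\<lambda>\<omega>. h (Y \<omega>) * g \<omega>)"
    for h :: "real \<Rightarrow> real"
    unfolding integral_eq_iff_nn_integral[OF that(3,4)]
    by (simp add: nn_integral_sum_measure nn_integral_push_density that(2))
  have int: "integrable M (\<lambda>\<omega>. indicator {c<..} (X \<omega>) * f \<omega>)" "integrable N (\<lambda>\<omega>. indicator {c<..} (Y \<omega>) * g \<omega>)" for c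
    by (rule Bochner_Integration.integrable_bound[OF f], simp, simp add: indicator_def)
       (rule Bochner_Integration.integrable_bound[OF g], simp, simp add: indicator_def)
  have ind: "(\<integral>\<^sup>+x. ennreal (indicator {c<..} x) \<partial>D) = emeasure D {c<..}"
    if "sets D = sets borel" for D :: "real measure" and c
    using that by (simp add: ennreal_indicator)
  have "?S1 = ?S2"
  proof (rule measure_eqI_lessThan)
    fix c :: real
    show "emeasure ?S1 {c<..} = emeasure ?S2 {c<..}"
      using S[of "indicator {c<..}", OF _ _ int] eq[of c] by (simp add: ind)
    have "(\<integral>\<^sup>+\<omega>. ennreal (indicator {c<..} (X \<omega>) * f \<omega>) \<partial>M) \<noteq> \<infinity>"
      "(\<integral>\<^sup>+\<omega>. ennreal (- (indicator {c<..} (Y \<omega>) * g \<omega>)) \<partial>N) \<noteq> \<infinity>"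
      using int[of c] by (simp_all only: real_integrable_def not_False_eq_True)
    then show "emeasure ?S1 {c<..} < \<infinity>"
      unfolding ind[symmetric, OF sets_sum_measure]
      by (simp add: nn_integral_sum_measure nn_integral_push_density less_top)
  qed auto
  then show ?thesis
    using S[OF k k0 kf kg] by simp
qed

lemma signed_pushforward_eqI:
  fixes X :: "'a \<Rightarrow> real" and Y :: "'b \<Rightarrow> real"
    and f :: "'a \<Rightarrow> real" and g :: "'b \<Rightarrow> real"
  assumes f: "integrable M f" and g: "integrable N g"
    and X[measurable]: "X \<in> borel_measurable M" and Y[measurable]: "Y \<in> borel_measurable N"
    and eq: "\<And>c. (\<integral>\<omega>. indicator {c<..} (X \<omega>) * f \<omega> \<partial>M) = (\<integral>\<omega>. indicator {c<..} (Y \<omega>) * g \<omega> \<partial>N)"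
    and k[measurable]: "k \<in> borel_measurable borel"
    and kf: "integrable M (\<lambda>\<omega>. k (X \<omega>) * f \<omega>)" and kg: "integrable N (\<lambda>\<omega>. k (Y \<omega>) * g \<omega>)"
  shows "(\<integral>\<omega>. k (X \<omega>) * f \<omega> \<partial>M) = (\<integral>\<omega>. k (Y \<omega>) * g \<omega> \<partial>N)"
proof -
  have [measurable]: "f \<in> borel_measurable M" "g \<in> borel_measurable N" using f g by auto
  have *: "integrable M (\<lambda>\<omega>. max 0 (s * k (X \<omega>)) * f \<omega>)" "integrable N (\<lambda>\<omega>. max 0 (s * k (Y \<omega>)) * g \<omega>)"
    if "s = 1 \<or> s = - 1" for s
    using that
    by (auto intro!: Bochner_Integration.integrable_bound[OF kf]
        Bochner_Integration.integrable_bound[OF kg] AE_I2 mult_right_mono simp: abs_mult)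
  have eq': "(\<integral>\<omega>. max 0 (s * k (X \<omega>)) * f \<omega> \<partial>M) = (\<integral>\<omega>. max 0 (s * k (Y \<omega>)) * g \<omega> \<partial>N)"
    if "s = 1 \<or> s = - 1" for s
    by (rule signed_pushforward_eqI_nonneg[where k = "\<lambda>x. max 0 (s * k x)",
          OF f g X Y eq _ _ *[OF that]]) auto
  have split: "k x * y = max 0 (1 * k x) * y - max 0 (- 1 * k x) * y" for x y
    by (auto simp: max_def)
  show ?thesis
    unfolding split
    using Bochner_Integration.integral_diff[OF *(1)[of 1] *(1)[of "- 1"]]
      Bochner_Integration.integral_diff[OF *(2)[of 1] *(2)[of "- 1"]] eq'[of 1] eq'[of "- 1"]
    by simp
qed

text \<open>
  For every \<open>x \<noteq> 0\<close>, almost every dilation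
  factor \<open>r\<close> keeps \<open>r |x|\<close> outside the null set of radii; by Fubini some \<open>r > 0\<close> does so for
  almost every \<open>x\<close>, and a dilation by \<open>r\<close> preserves null sets.
\<close>

lemma AE_lborel_norm:
  fixes P :: "real \<Rightarrow> bool"
  assumes "AE r in lborel. r > 0 \<longrightarrow> P r"
  shows "AE x in (lborel :: 'a::euclidean_space measure). P (norm x)"
proof -
  obtain N where N: "N \<in> null_sets lborel" and NP: "{r. \<not> (r > 0 \<longrightarrow> P r)} \<subseteq> N"
    using assms by (auto elim!: AE_E simp: null_sets_def)
  have [measurable]: "N \<in> sets borel" using N by auto
  have N_AE: "AE r in lborel. r \<notin> N" using N by (rule AE_not_in)
  interpret lborel_pair: pair_sigma_finite "lborel :: real measure" "lborel :: 'a measure" ..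
  have "AE x in (lborel :: 'a measure). AE r in lborel. r * norm x \<notin> N"
    using AE_lborel_singleton[of 0]
  proof eventually_elim
    case (elim x)
    have "AE r in lborel. 0 + norm x * r \<notin> N"
      by (rule AE_borel_affine) (use elim N_AE in auto)
    then show ?case by (simp add: mult.commute)
  qed
  then have "AE r in lborel. AE x in (lborel :: 'a measure). r * norm x \<notin> N"
    by (subst lborel_pair.AE_commute) measurable
  then have "AE r in lborel. r > 0 \<longrightarrow> (AE x in (lborel :: 'a measure). r * norm x \<notin> N)"
    by eventually_elim auto
  moreover have "\<not> (AE r in lborel. \<not> r > (0::real))"
  proof
    assume "AE r in lborel. \<not> r > (0::real)"
    then have "AE r in lborel. \<not> (r \<in> {0<..<1::real})"
      by eventually_elim auto
    then have "emeasure lborel {0<..<1::real} = 0"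
      by (subst (asm) AE_iff_null_sets[symmetric]) auto
    then show False by simp
  qed
  ultimately have "\<exists>r>0. AE x in (lborel :: 'a measure). r * norm x \<notin> N"
    using eventually_mono[of "\<lambda>r. r > 0 \<longrightarrow> (AE x in (lborel :: 'a measure). r * norm x \<notin> N)"
        "ae_filter lborel" "\<lambda>r. \<not> r > 0"] by blast
  then obtain r where r: "r > 0" and "AE x in (lborel :: 'a measure). r * norm x \<notin> N"
    by blast
  then have "{x :: 'a. r * norm x \<in> N} \<in> null_sets lborel"
    by (simp add: AE_iff_null_sets)
  then have "negligible {x :: 'a. r * norm x \<in> N}"
    by (simp add: negligible_iff_null_sets null_sets_completionI)
  then have "negligible ((\<lambda>x. r *\<^sub>R x) ` {x :: 'a. r * norm x \<in> N})"
    by (intro negligible_differentiable_image_negligible) auto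
  moreover have "{x :: 'a. norm x \<in> N} \<subseteq> (\<lambda>x. r *\<^sub>R x) ` {x :: 'a. r * norm x \<in> N}"
  proof
    fix x :: 'a assume "x \<in> {x. norm x \<in> N}"
    then have "x = r *\<^sub>R (x /\<^sub>R r)" "r * norm (x /\<^sub>R r) \<in> N" using r by (auto simp flip: mult.assoc)
    then show "x \<in> (\<lambda>x. r *\<^sub>R x) ` {x :: 'a. r * norm x \<in> N}" by blast
  qed
  ultimately have "negligible {x :: 'a. norm x \<in> N}" by (rule negligible_subset)
  then have "{x :: 'a. norm x \<in> N} \<in> null_sets lborel"
    by (simp add: negligible_iff_null_sets null_sets_completion_iff)
  from AE_not_in[OF this] AE_lborel_singleton[of "0::'a"] show ?thesis
  proof eventually_elim
    case (elim x)
    then have "norm x \<notin> {r. \<not> (r > 0 \<longrightarrow> P r)}" using NP by blast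
    with elim show ?case by simp
  qed
qed

text \<open>
  Since Lebesgue measure is complete, a function that agrees almost everywhere with a measurable one
  is measurable. If neither function is measurable, both integrals are zero by convention.
\<close>

lemma integral_lebesgue_cong_AE:
  fixes f g :: "'a::euclidean_space \<Rightarrow> real"
  assumes eq: "AE x in lebesgue. f x = g x"
  shows "integral\<^sup>L lebesgue f = integral\<^sup>L lebesgue g"
proof -
  have *: "g \<in> borel_measurable lebesgue" if "f \<in> borel_measurable lebesgue" "AE x in lebesgue. f x = g x"
    for f g :: "'a \<Rightarrow> real"
  proof (rule measurableI)
    fix B :: "real set" assume "B \<in> sets borel"
    with that(1) have fB: "f -` B \<inter> space lebesgue \<in> sets lebesgue" by (rule measurable_sets)
    have AE_B: "AE x in lebesgue. x \<in> f -` B \<inter> space lebesgue \<longleftrightarrow> x \<in> g -` B \<inter> space lebesgue"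
      using that(2) by eventually_elim simp
    show "g -` B \<inter> space lebesgue \<in> sets lebesgue"
      by (rule completion.in_sets_AE[OF AE_B fB]) (rule Int_lower2)
  qed auto
  show ?thesis
  proof (cases "f \<in> borel_measurable lebesgue")
    case True
    from integral_cong_AE[OF this *[OF this eq] eq] show ?thesis .
  next
    case False
    moreover have "AE x in lebesgue. g x = f x" using eq by eventually_elim simp
    ultimately have "\<not> integrable lebesgue f" "\<not> integrable lebesgue g"
      using *[of g f] borel_measurable_integrable by blast+
    then show ?thesis by (simp add: not_integrable_integral_eq)
  qed
qed

section \<open>The radial momentum balance with an integrable derivative\<close>

lemma (in pair_sigma_finite) integrable_product:
  fixes f g :: "_ \<Rightarrow> real"
  assumes f: "integrable M1 f" and g: "integrable M2 g"
  shows "integrable (M1 \<Otimes>\<^sub>M M2) (\<lambda>(x, y). f x * g y)"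
proof -
  have [measurable]: "f \<in> borel_measurable M1" "g \<in> borel_measurable M2" using f g by auto
  show ?thesis
    by (rule Fubini_integrable) (use f g in \<open>auto simp: norm_mult abs_mult\<close>)
qed

text \<open>
  Fubini on the region \<open>R(\<omega>) < r\<close>. It is the only form in which the order of integration in
  radius and space is exchanged below.
\<close>

lemma Fubini_tail:
  fixes q R :: "'a \<Rightarrow> real" and g :: "real \<Rightarrow> real"
  assumes "sigma_finite_measure M" and q: "integrable M q" and g: "integrable lborel g"
    and R: "R \<in> borel_measurable M"
  shows "(\<integral>r. g r * (\<integral>\<omega>. (if R \<omega> < r then q \<omega> else 0) \<partial>M) \<partial>lborel) =
    (\<integral>\<omega>. q \<omega> * (\<integral>r. (if R \<omega> < r then g r else 0) \<partial>lborel) \<partial>M)"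
proof -
  interpret sigma_finite_measure M by fact
  interpret pair_sigma_finite M "lborel :: real measure" ..
  have [measurable]: "q \<in> borel_measurable M" "g \<in> borel_measurable lborel" "R \<in> borel_measurable M"
    using q g R by auto
  have "integrable (M \<Otimes>\<^sub>M lborel) (\<lambda>(\<omega>, r). if R \<omega> < r then q \<omega> * g r else 0)"
    by (rule Bochner_Integration.integrable_bound[OF integrable_product[OF q g]]) auto
  from Fubini_integral[OF this]
  have "(\<integral>r. (\<integral>\<omega>. (if R \<omega> < r then q \<omega> * g r else 0) \<partial>M) \<partial>lborel) =
      (\<integral>\<omega>. (\<integral>r. (if R \<omega> < r then q \<omega> * g r else 0) \<partial>lborel) \<partial>M)" .
  moreover have "(\<integral>\<omega>. (if R \<omega> < r then q \<omega> * g r else 0) \<partial>M) =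
      g r * (\<integral>\<omega>. (if R \<omega> < r then q \<omega> else 0) \<partial>M)" for r
    unfolding integral_mult_right_zero[symmetric] by (rule Bochner_Integration.integral_cong) auto
  moreover have "(\<integral>r. (if R \<omega> < r then q \<omega> * g r else 0) \<partial>lborel) =
      q \<omega> * (\<integral>r. (if R \<omega> < r then g r else 0) \<partial>lborel)" for \<omega>
    unfolding integral_mult_right_zero[symmetric] by (rule Bochner_Integration.integral_cong) auto
  ultimately show ?thesis by simp
qed

lemma has_bochner_integral_inverse_square:
  fixes m :: real
  assumes "m > 0"
  shows "has_bochner_integral lborel (\<lambda>s. if m < s then 1 / s\<^sup>2 else 0) (1 / m)"
proof -
  have "(\<integral>\<^sup>+s. ennreal (1 / s\<^sup>2) * indicator {m..} s \<partial>lborel) = ennreal (0 - (- 1 / m))"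
  proof (rule nn_integral_FTC_atLeast)
    show "((\<lambda>s. - 1 / s) has_real_derivative 1 / s\<^sup>2) (at s)" if "m \<le> s" for s
      using that assms by (auto intro!: derivative_eq_intros simp: power2_eq_square)
    show "((\<lambda>s::real. - 1 / s) \<longlongrightarrow> 0) at_top"
      by (intro tendsto_divide_0[OF tendsto_const] filterlim_at_top_imp_at_infinity filterlim_ident)
  qed auto
  also have "(\<integral>\<^sup>+s. ennreal (1 / s\<^sup>2) * indicator {m..} s \<partial>lborel) =
      (\<integral>\<^sup>+s. ennreal (if m < s then 1 / s\<^sup>2 else 0) \<partial>lborel)"
    by (rule nn_integral_cong_AE, use AE_lborel_singleton[of m] in eventually_elim)
       (auto simp: indicator_def)
  finally show ?thesis
    using assms by (intro has_bochner_integral_nn_integral) auto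
qed

text \<open>
  For a function \<open>g\<close> that vanishes on the negative half-line this is the primitive that starts
  at zero.
\<close>

definition primitive :: "(real \<Rightarrow> real) \<Rightarrow> real \<Rightarrow> real" where
  "primitive g r = (\<integral>s. (if s < r then g s else 0) \<partial>lborel)"

lemma integrable_restrict:
  fixes f :: "'a \<Rightarrow> real"
  assumes "integrable M f" and [measurable]: "Measurable.pred M P"
  shows "integrable M (\<lambda>x. if P x then f x else 0)"
  by (rule Bochner_Integration.integrable_bound[OF assms(1)]) (use assms in auto)

lemma primitive_measurable [measurable]:
  assumes [measurable]: "g \<in> borel_measurable borel"
  shows "primitive g \<in> borel_measurable borel"
  unfolding primitive_def[abs_def] by measurable

lemma abs_primitive_le:
  assumes "integrable lborel g"
  shows "\<bar>primitive g r\<bar> \<le> (\<integral>s. \<bar>g s\<bar> \<partial>lborel)"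
proof -
  have "\<bar>primitive g r\<bar> \<le> (\<integral>s. \<bar>if s < r then g s else 0\<bar> \<partial>lborel)"
    unfolding primitive_def by (rule integral_abs_bound)
  also have "\<dots> \<le> (\<integral>s. \<bar>g s\<bar> \<partial>lborel)"
    by (rule integral_mono) (use assms in \<open>auto intro!: integrable_abs integrable_restrict\<close>)
  finally show ?thesis .
qed

lemma primitive_support:
  assumes g: "integrable lborel g" and supp: "\<And>s. s \<notin> {\<delta>..\<rho>} \<Longrightarrow> g s = 0"
    and mean: "(\<integral>s. g s \<partial>lborel) = 0" and "r \<notin> {\<delta>..\<rho>}"
  shows "primitive g r = 0"
proof (cases "r < \<delta>")
  case True
  then have "(\<lambda>s. if s < r then g s else 0) = (\<lambda>_. 0)" using supp by fastforce
  then show ?thesis by (simp add: primitive_def)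
next
  case False
  then have "r > \<rho>" using assms(4) by auto
  then have "(\<lambda>s. if s < r then g s else 0) = g" using supp by fastforce
  then show ?thesis using mean by (simp add: primitive_def)
qed

text \<open>
  With \<open>h\<close> the primitive of \<open>g\<close>, the function \<open>D = g/s - h/s\<^sup>2\<close> is the almost everywhere
  derivative of \<open>H(s) = h(s)/s\<close>, the profile of the vector field with radial component \<open>h\<close>.
  Since \<open>g\<close> is merely integrable, the fundamental theorem of calculus for \<open>H\<close> is obtained by
  Fubini from the integral of \<open>1/s\<^sup>2\<close> over half-lines.
\<close>

lemma primitive_over_radius_tail:
  assumes [measurable]: "g \<in> borel_measurable borel" and g: "integrable lborel g"
    and supp: "\<And>s. s \<notin> {\<delta>..\<rho>} \<Longrightarrow> g s = 0" and \<delta>: "\<delta> > 0"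
    and mean: "(\<integral>s. g s \<partial>lborel) = 0"
  defines "D \<equiv> \<lambda>s. g s / s - primitive g s / s\<^sup>2"
  shows "integrable lborel D"
    and "r > 0 \<Longrightarrow> (\<integral>s. (if r < s then D s else 0) \<partial>lborel) = - primitive g r / r"
proof -
  define C where "C = (\<integral>s. \<bar>g s\<bar> \<partial>lborel)"
  have psupp: "primitive g r = 0" if "r \<notin> {\<delta>..\<rho>}" for r
    by (rule primitive_support[OF g _ mean that]) (rule supp)
  have pb: "\<bar>primitive g s\<bar> \<le> C" for s
    unfolding C_def using abs_primitive_le[OF g] .
  then have C: "C \<ge> 0" by (meson abs_ge_zero order_trans)
  have i1: "integrable lborel (\<lambda>s. g s / s)"
  proof (rule Bochner_Integration.integrable_bound)
    show "integrable lborel (\<lambda>s. g s / \<delta>)" using g by simp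
    show "AE s in lborel. norm (g s / s) \<le> norm (g s / \<delta>)"
    proof (rule AE_I2)
      fix s show "norm (g s / s) \<le> norm (g s / \<delta>)"
        by (cases "s \<in> {\<delta>..\<rho>}") (use \<delta> supp in \<open>auto simp: frac_le\<close>)
    qed
  qed simp
  have i2: "integrable lborel (\<lambda>s. primitive g s / s\<^sup>2)"
  proof (rule Bochner_Integration.integrable_bound)
    show "integrable lborel (\<lambda>s. indicator {\<delta>..\<rho>} s * (C / \<delta>\<^sup>2))"
      by (intro integrable_mult_left integrable_real_indicator emeasure_bounded_finite) auto
    show "AE s in lborel. norm (primitive g s / s\<^sup>2) \<le> norm (indicator {\<delta>..\<rho>} s * (C / \<delta>\<^sup>2))"
    proof (rule AE_I2)
      fix s show "norm (primitive g s / s\<^sup>2) \<le> norm (indicator {\<delta>..\<rho>} s * (C / \<delta>\<^sup>2))"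
        by (cases "s \<in> {\<delta>..\<rho>}") (use \<delta> psupp pb C in \<open>auto simp: frac_le power_mono\<close>)
    qed
  qed simp
  show "integrable lborel D" unfolding D_def using i1 i2 by simp
  assume r: "r > 0"
  have kern: "integrable lborel (\<lambda>s. if r < s then 1 / s\<^sup>2 else 0)"
    using has_bochner_integral_inverse_square[OF r] by (simp add: has_bochner_integral_iff)
  \<comment> \<open>The double integral of g(u)/s^2 over u < s and r < s: integrating in s first gives g(u)/max(u, r).\<close>
  have "(\<integral>s. (if r < s then primitive g s / s\<^sup>2 else 0) \<partial>lborel) =
      (\<integral>s. (if r < s then 1 / s\<^sup>2 else 0) * (\<integral>u. (if u < s then g u else 0) \<partial>lborel) \<partial>lborel)"
    by (rule Bochner_Integration.integral_cong) (auto simp: primitive_def)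
  also have "\<dots> = (\<integral>u. g u * (\<integral>s. (if u < s then if r < s then 1 / s\<^sup>2 else 0 else 0) \<partial>lborel) \<partial>lborel)"
    by (rule Fubini_tail[OF _ g kern]) (auto simp: sigma_finite_lborel)
  also have "\<dots> = (\<integral>u. (if u < r then g u else 0) / r + (if r < u then g u / u else 0) \<partial>lborel)"
  proof (rule integral_cong_AE)
    have *: "(\<integral>s. (if u < s then if r < s then 1 / s\<^sup>2 else 0 else 0) \<partial>lborel) = 1 / max u r" for u
    proof -
      have "(\<lambda>s. if u < s then if r < s then 1 / s\<^sup>2 else 0 else 0) =
          (\<lambda>s. if max u r < s then 1 / s\<^sup>2 else 0)" by auto
      then show ?thesis
        using has_bochner_integral_inverse_square[of "max u r"] r by (simp add: has_bochner_integral_iff)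
    qed
    show "AE u in lborel. g u * (\<integral>s. (if u < s then if r < s then 1 / s\<^sup>2 else 0 else 0) \<partial>lborel) =
        (if u < r then g u else 0) / r + (if r < u then g u / u else 0)"
      using AE_lborel_singleton[of r] unfolding *
      by eventually_elim (auto simp: max_def)
  qed (measurable)
  also have "\<dots> = primitive g r / r + (\<integral>u. (if r < u then g u / u else 0) \<partial>lborel)"
    unfolding primitive_def
    by (subst Bochner_Integration.integral_add)
       (use g i1 in \<open>auto intro!: integrable_divide integrable_restrict simp: primitive_def\<close>)
  finally have "(\<integral>s. (if r < s then primitive g s / s\<^sup>2 else 0) \<partial>lborel) =
      primitive g r / r + (\<integral>u. (if r < u then g u / u else 0) \<partial>lborel)" .
  moreover have "(\<integral>s. (if r < s then D s else 0) \<partial>lborel) =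
      (\<integral>s. (if r < s then g s / s else 0) - (if r < s then primitive g s / s\<^sup>2 else 0) \<partial>lborel)"
    by (rule Bochner_Integration.integral_cong) (auto simp: D_def)
  moreover have "\<dots> = (\<integral>s. (if r < s then g s / s else 0) \<partial>lborel)
      - (\<integral>s. (if r < s then primitive g s / s\<^sup>2 else 0) \<partial>lborel)"
    by (rule Bochner_Integration.integral_diff) (auto intro!: integrable_restrict i1 i2)
  ultimately show "(\<integral>s. (if r < s then D s else 0) \<partial>lborel) = - primitive g r / r"
    by simp
qed

lemma integral_linear_Ioo:
  fixes u \<rho> :: real
  assumes "0 \<le> u"
  shows "(\<integral>r. (if u < r then if 0 < r \<and> r < \<rho> then r else 0 else 0) \<partial>lborel) =
    (if u < \<rho> then (\<rho>\<^sup>2 - u\<^sup>2) / 2 else 0)"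
proof (cases "u < \<rho>")
  case True
  have "(\<integral>r. r * indicator {u..\<rho>} r \<partial>lborel) = \<rho>\<^sup>2 / 2 - u\<^sup>2 / 2"
    using True by (intro integral_FTC_Icc_real) (auto intro!: derivative_eq_intros)
  moreover have "(\<integral>r. (if u < r then if 0 < r \<and> r < \<rho> then r else 0 else 0) \<partial>lborel) =
      (\<integral>r. r * indicator {u..\<rho>} r \<partial>lborel)"
  proof (rule integral_cong_AE)
    show "AE r in lborel. (if u < r then if 0 < r \<and> r < \<rho> then r else 0 else 0) = r * indicator {u..\<rho>} r"
      using AE_lborel_singleton[of u] AE_lborel_singleton[of \<rho>]
      by eventually_elim (use assms in \<open>auto simp: indicator_def\<close>)
  qed auto
  ultimately show ?thesis using True by (simp add: diff_divide_distrib)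
next
  case False
  then have "(\<lambda>r. if u < r then if 0 < r \<and> r < \<rho> then r else 0 else 0) = (\<lambda>_. 0)" by auto
  then show ?thesis using False by simp
qed

text \<open>
  The radial balance of momentum in a form that forgets about fluids. On spheres of radius \<open>R\<close>
  the weights \<open>a\<close> and \<open>b\<close> stand for the radial stress and for the sum of the tangential
  stresses. The assumption \<open>tent\<close> is the weak equation tested with the field
  \<open>(\<rho>\<^sup>2 - |x|\<^sup>2) x\<close> on the ball of radius \<open>\<rho>\<close>.
\<close>

locale radial_pair = sigma_finite_measure M for M :: "'a measure" +
  fixes R a b :: "'a \<Rightarrow> real"
  assumes R [measurable]: "R \<in> borel_measurable M"
    and R_nonneg: "\<And>\<omega>. R \<omega> \<ge> 0"
    and R_atomless: "\<And>c. AE \<omega> in M. R \<omega> \<noteq> c"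
    and a_int: "\<And>\<rho>. integrable M (\<lambda>\<omega>. if R \<omega> < \<rho> then a \<omega> else 0)"
    and b_int: "\<And>\<rho>. integrable M (\<lambda>\<omega>. if R \<omega> < \<rho> then b \<omega> else 0)"
    and a_meas [measurable]: "a \<in> borel_measurable M"
    and b_meas [measurable]: "b \<in> borel_measurable M"
    and tent: "\<And>\<rho>. \<rho> > 0 \<Longrightarrow>
      (\<integral>\<omega>. (if R \<omega> < \<rho> then 2 * (R \<omega>)\<^sup>2 * a \<omega> else 0) \<partial>M) =
      (\<integral>\<omega>. (if R \<omega> < \<rho> then (\<rho>\<^sup>2 - (R \<omega>)\<^sup>2) * (a \<omega> + b \<omega>) else 0) \<partial>M)"
begin

definition inner_mass :: "real \<Rightarrow> real" where
  "inner_mass r = (\<integral>\<omega>. (if R \<omega> < r then a \<omega> + b \<omega> else 0) \<partial>M)"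

lemma inner_mass_measurable [measurable]: "inner_mass \<in> borel_measurable borel"
  unfolding inner_mass_def[abs_def] by measurable

lemma ab_int: "integrable M (\<lambda>\<omega>. if R \<omega> < \<rho> then a \<omega> + b \<omega> else 0)"
proof -
  have "(\<lambda>\<omega>. if R \<omega> < \<rho> then a \<omega> + b \<omega> else 0) =
      (\<lambda>\<omega>. (if R \<omega> < \<rho> then a \<omega> else 0) + (if R \<omega> < \<rho> then b \<omega> else 0))" by auto
  then show ?thesis using a_int b_int by simp
qed

lemma inner_mass_bound:
  assumes "r \<le> \<rho>"
  shows "\<bar>inner_mass r\<bar> \<le> (\<integral>\<omega>. \<bar>if R \<omega> < \<rho> then a \<omega> + b \<omega> else 0\<bar> \<partial>M)"
proof -
  have "\<bar>inner_mass r\<bar> \<le> (\<integral>\<omega>. \<bar>if R \<omega> < r then a \<omega> + b \<omega> else 0\<bar> \<partial>M)"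
    unfolding inner_mass_def by (rule integral_abs_bound)
  also have "\<dots> \<le> (\<integral>\<omega>. \<bar>if R \<omega> < \<rho> then a \<omega> + b \<omega> else 0\<bar> \<partial>M)"
    by (rule integral_mono) (use assms in \<open>auto intro!: integrable_abs ab_int\<close>)
  finally show ?thesis .
qed

lemma bounded_on_ball_integrable:
  assumes f: "\<And>\<rho>. integrable M (\<lambda>\<omega>. if R \<omega> < \<rho> then f \<omega> else (0::real))"
    and [measurable]: "k \<in> borel_measurable borel"
    and bd: "\<And>r. 0 \<le> r \<Longrightarrow> r < \<rho> \<Longrightarrow> \<bar>k r\<bar> \<le> C"
  shows "integrable M (\<lambda>\<omega>. if R \<omega> < \<rho> then k (R \<omega>) * f \<omega> else 0)"
proof (rule Bochner_Integration.integrable_bound)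
  show "integrable M (\<lambda>\<omega>. C * (if R \<omega> < \<rho> then f \<omega> else 0))"
    using f by simp
  have "(\<lambda>\<omega>. k (R \<omega>) * (if R \<omega> < \<rho> then f \<omega> else 0)) \<in> borel_measurable M"
    using borel_measurable_integrable[OF f[of \<rho>]] by measurable
  then show "(\<lambda>\<omega>. if R \<omega> < \<rho> then k (R \<omega>) * f \<omega> else 0) \<in> borel_measurable M"
    by (simp add: if_distrib cong: if_cong)
  show "AE \<omega> in M. norm (if R \<omega> < \<rho> then k (R \<omega>) * f \<omega> else 0) \<le> norm (C * (if R \<omega> < \<rho> then f \<omega> else 0))"
  proof (rule AE_I2)
    fix \<omega>
    have "\<bar>k (R \<omega>)\<bar> * \<bar>f \<omega>\<bar> \<le> \<bar>C\<bar> * \<bar>f \<omega>\<bar>" if "R \<omega> < \<rho>"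
      using bd[OF R_nonneg that] by (intro mult_right_mono) auto
    then show "norm (if R \<omega> < \<rho> then k (R \<omega>) * f \<omega> else 0) \<le> norm (C * (if R \<omega> < \<rho> then f \<omega> else 0))"
      by (simp add: abs_mult)
  qed
qed

text \<open>
  Writing \<open>\<rho>\<^sup>2 - R\<^sup>2\<close> as the integral of \<open>2 r\<close> from \<open>R\<close> to \<open>\<rho>\<close> turns the tent identity
  into an identity for the distribution of \<open>R\<^sup>2 a\<close> over the radius: its distribution function is
  absolutely continuous, with density \<open>r inner_mass(r)\<close>.
\<close>

lemma second_moment_ball:
  "(\<integral>\<omega>. (if R \<omega> < \<rho> then (R \<omega>)\<^sup>2 * a \<omega> else 0) \<partial>M) =
    (\<integral>r. (if 0 < r \<and> r < \<rho> then r * inner_mass r else 0) \<partial>lborel)"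
proof (cases "\<rho> > 0")
  case True
  let ?q = "\<lambda>\<omega>. if R \<omega> < \<rho> then a \<omega> + b \<omega> else 0"
  let ?g = "\<lambda>r. if 0 < r \<and> r < \<rho> then r else 0"
  have g: "integrable lborel ?g"
  proof (rule Bochner_Integration.integrable_bound)
    show "integrable lborel (\<lambda>r. indicator {0..\<rho>} r * \<rho>)"
      by (intro integrable_mult_left integrable_real_indicator emeasure_bounded_finite) auto
  qed auto
  have "(\<integral>r. (if 0 < r \<and> r < \<rho> then r * inner_mass r else 0) \<partial>lborel) =
      (\<integral>r. ?g r * (\<integral>\<omega>. (if R \<omega> < r then ?q \<omega> else 0) \<partial>M) \<partial>lborel)"
    unfolding inner_mass_def
    by (rule Bochner_Integration.integral_cong)
       (auto intro!: arg_cong[where f = "\<lambda>x. _ * x"] Bochner_Integration.integral_cong)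
  also have "\<dots> = (\<integral>\<omega>. ?q \<omega> * (\<integral>r. (if R \<omega> < r then ?g r else 0) \<partial>lborel) \<partial>M)"
    by (rule Fubini_tail[OF sigma_finite_measure_axioms ab_int g R])
  also have "\<dots> = (\<integral>\<omega>. (if R \<omega> < \<rho> then (\<rho>\<^sup>2 - (R \<omega>)\<^sup>2) * (a \<omega> + b \<omega>) else 0) / 2 \<partial>M)"
    unfolding integral_linear_Ioo[OF R_nonneg]
    by (rule Bochner_Integration.integral_cong) auto
  also have "\<dots> = (\<integral>\<omega>. (if R \<omega> < \<rho> then 2 * (R \<omega>)\<^sup>2 * a \<omega> else 0) \<partial>M) / 2"
    using tent[OF True] by simp
  also have "\<dots> = (\<integral>\<omega>. (if R \<omega> < \<rho> then (R \<omega>)\<^sup>2 * a \<omega> else 0) \<partial>M)"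
    unfolding integral_divide_zero[symmetric] by (rule Bochner_Integration.integral_cong) auto
  finally show ?thesis by simp
next
  case False
  then have "(\<lambda>\<omega>. if R \<omega> < \<rho> then (R \<omega>)\<^sup>2 * a \<omega> else 0) = (\<lambda>_. 0)"
    "(\<lambda>r. if 0 < r \<and> r < \<rho> then r * inner_mass r else 0) = (\<lambda>_. 0)"
    using R_nonneg by (auto simp: fun_eq_iff) (meson leD order_trans not_le)+
  then show ?thesis by simp
qed

lemma second_moment_int:
  "integrable M (\<lambda>\<omega>. if R \<omega> < \<rho> then (R \<omega>)\<^sup>2 * a \<omega> else 0)"
  by (rule bounded_on_ball_integrable[where k = "\<lambda>r. r\<^sup>2" and C = "\<rho>\<^sup>2"])
     (auto intro: a_int power_mono)

lemma first_moment_inner_mass_int: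
  "integrable lborel (\<lambda>r. if 0 < r \<and> r < \<rho> then r * inner_mass r else 0)"
proof (rule Bochner_Integration.integrable_bound)
  define C where "C = (\<integral>\<omega>. \<bar>if R \<omega> < \<rho> then a \<omega> + b \<omega> else 0\<bar> \<partial>M)"
  show "integrable lborel (\<lambda>r. indicator {0..\<rho>} r * (\<rho> * C))"
    by (intro integrable_mult_left integrable_real_indicator emeasure_bounded_finite) auto
  show "AE r in lborel. norm (if 0 < r \<and> r < \<rho> then r * inner_mass r else 0)
      \<le> norm (indicator {0..\<rho>} r * (\<rho> * C))"
  proof (rule AE_I2)
    fix r
    have "\<bar>r * inner_mass r\<bar> \<le> \<rho> * C" if "0 < r" "r < \<rho>"
      using inner_mass_bound[of r \<rho>] that by (simp add: C_def abs_mult mult_mono)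
    then show "norm (if 0 < r \<and> r < \<rho> then r * inner_mass r else 0)
        \<le> norm (indicator {0..\<rho>} r * (\<rho> * C))"
      by auto
  qed
qed measurable

text \<open>
  Finite measures on the line are determined by their distribution functions. This is the gain of
  regularity on which the theorem rests: \<open>a\<close> is only locally integrable, but its averages over
  spheres are bounded on compact sets of positive radii, so they can be integrated against a weight that is
  only integrable.
\<close>

lemma disintegration:
  assumes [measurable]: "k \<in> borel_measurable borel"
    and ka: "integrable M (\<lambda>\<omega>. k (R \<omega>) * (if R \<omega> < \<rho> then (R \<omega>)\<^sup>2 * a \<omega> else 0))"
    and kr: "integrable lborel (\<lambda>r. k r * (if 0 < r \<and> r < \<rho> then r * inner_mass r else 0))"
  shows "(\<integral>\<omega>. k (R \<omega>) * (if R \<omega> < \<rho> then (R \<omega>)\<^sup>2 * a \<omega> else 0) \<partial>M) =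
    (\<integral>r. k r * (if 0 < r \<and> r < \<rho> then r * inner_mass r else 0) \<partial>lborel)"
proof (rule signed_pushforward_eqI[where Y = "\<lambda>r. r" and k = k,
      OF second_moment_int first_moment_inner_mass_int R _ _ _ ka kr])
  fix c :: real
  let ?m = "min c \<rho>"
  have "(\<integral>\<omega>. indicator {c<..} (R \<omega>) * (if R \<omega> < \<rho> then (R \<omega>)\<^sup>2 * a \<omega> else 0) \<partial>M) =
      (\<integral>\<omega>. (if R \<omega> < \<rho> then (R \<omega>)\<^sup>2 * a \<omega> else 0) - (if R \<omega> < ?m then (R \<omega>)\<^sup>2 * a \<omega> else 0) \<partial>M)"
  proof (rule integral_cong_AE)
    show "AE \<omega> in M. indicator {c<..} (R \<omega>) * (if R \<omega> < \<rho> then (R \<omega>)\<^sup>2 * a \<omega> else 0) =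
      (if R \<omega> < \<rho> then (R \<omega>)\<^sup>2 * a \<omega> else 0) - (if R \<omega> < ?m then (R \<omega>)\<^sup>2 * a \<omega> else 0)"
      using R_atomless[of c] by eventually_elim (auto simp: indicator_def)
  qed measurable
  also have "\<dots> = (\<integral>r. (if 0 < r \<and> r < \<rho> then r * inner_mass r else 0)
      - (if 0 < r \<and> r < ?m then r * inner_mass r else 0) \<partial>lborel)"
    unfolding Bochner_Integration.integral_diff[OF second_moment_int second_moment_int]
      Bochner_Integration.integral_diff[OF first_moment_inner_mass_int first_moment_inner_mass_int]
      second_moment_ball ..
  also have "\<dots> = (\<integral>r. indicator {c<..} r * (if 0 < r \<and> r < \<rho> then r * inner_mass r else 0) \<partial>lborel)"
  proof (rule integral_cong_AE)
    show "AE r in lborel. (if 0 < r \<and> r < \<rho> then r * inner_mass r else 0)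
      - (if 0 < r \<and> r < ?m then r * inner_mass r else 0) =
      indicator {c<..} r * (if 0 < r \<and> r < \<rho> then r * inner_mass r else 0)"
      using AE_lborel_singleton[of c] by eventually_elim (auto simp: indicator_def)
  qed measurable
  finally show "(\<integral>\<omega>. indicator {c<..} (R \<omega>) * (if R \<omega> < \<rho> then (R \<omega>)\<^sup>2 * a \<omega> else 0) \<partial>M) =
    (\<integral>r. indicator {c<..} r * (if 0 < r \<and> r < \<rho> then r * inner_mass r else 0) \<partial>lborel)" .
qed auto

text \<open>
  The weak equation for the radial field with radial component \<open>h\<close>, the primitive of an
  integrable \<open>g\<close>: formally \<open>g(R)\<close> is its radial derivative and \<open>h(R)/R\<close> its tangential
  derivative. The mean-zero condition makes \<open>h\<close> compactly supported. The identity is the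
  disintegration for the test function \<open>D/r\<close>, with \<open>D\<close> the derivative of \<open>h/r\<close>, followed by
  Fubini.
\<close>

theorem radial_identity:
  assumes [measurable]: "g \<in> borel_measurable borel" and g: "integrable lborel g"
    and supp: "\<And>s. s \<notin> {\<delta>..\<rho>} \<Longrightarrow> g s = 0" and \<delta>: "\<delta> > 0"
    and mean: "(\<integral>s. g s \<partial>lborel) = 0"
    and ga: "integrable M (\<lambda>\<omega>. g (R \<omega>) * a \<omega>)"
  shows "integrable M (\<lambda>\<omega>. primitive g (R \<omega>) / R \<omega> * b \<omega>)"
    and "(\<integral>\<omega>. g (R \<omega>) * a \<omega> \<partial>M) + (\<integral>\<omega>. primitive g (R \<omega>) / R \<omega> * b \<omega> \<partial>M) = 0"
proof -
  define C where "C = (\<integral>s. \<bar>g s\<bar> \<partial>lborel)"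
  define P where "P = \<rho> + 1"
  define D where "D = (\<lambda>s. g s / s - primitive g s / s\<^sup>2)"
  have D_meas [measurable]: "D \<in> borel_measurable borel" unfolding D_def by measurable
  have psupp: "primitive g r = 0" if "r \<notin> {\<delta>..\<rho>}" for r
    by (rule primitive_support[OF g _ mean that]) (rule supp)
  have pb: "\<bar>primitive g s\<bar> \<le> C" for s
    unfolding C_def using abs_primitive_le[OF g] .
  then have C: "C \<ge> 0" by (meson abs_ge_zero order_trans)
  have D: "integrable lborel D"
    unfolding D_def
    by (rule primitive_over_radius_tail(1)[OF assms(1) g _ \<delta> mean]) (rule supp)
  have D_tail: "(\<integral>s. (if r < s then D s else 0) \<partial>lborel) = - primitive g r / r" if "r > 0" for r
    unfolding D_def
    by (rule primitive_over_radius_tail(2)[OF assms(1) g _ \<delta> mean that]) (rule supp)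
  have Dsupp: "D s = 0" if "s \<notin> {\<delta>..\<rho>}" for s
    using supp[OF that] psupp[OF that] by (simp add: D_def)
  have quot: "\<bar>primitive g r / r\<bar> \<le> C / \<delta>" for r
  proof (cases "r \<in> {\<delta>..\<rho>}")
    case True
    with \<delta> pb[of r] C show ?thesis by (auto intro!: frac_le)
  next
    case False
    with psupp C \<delta> show ?thesis by simp
  qed
  have out: "primitive g (R \<omega>) / R \<omega> = 0" if "\<not> R \<omega> < P" for \<omega>
    using psupp[of "R \<omega>"] that by (auto simp: P_def)
  have hf: "integrable M (\<lambda>\<omega>. primitive g (R \<omega>) / R \<omega> * f \<omega>)"
    if "\<And>\<rho>. integrable M (\<lambda>\<omega>. if R \<omega> < \<rho> then f \<omega> else 0)" for f
  proof -
    have "\<bar>primitive g r / r\<bar> \<le> C / \<delta>" if "0 \<le> r" "r < P" for r by (rule quot)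
    then have int: "integrable M (\<lambda>\<omega>. if R \<omega> < P then primitive g (R \<omega>) / R \<omega> * f \<omega> else 0)"
      by (intro bounded_on_ball_integrable[where k = "\<lambda>r. primitive g r / r" and C = "C / \<delta>", OF that])
         measurable
    have eq: "(\<lambda>\<omega>. if R \<omega> < P then primitive g (R \<omega>) / R \<omega> * f \<omega> else 0) =
        (\<lambda>\<omega>. primitive g (R \<omega>) / R \<omega> * f \<omega>)"
    proof
      fix \<omega>
      show "(if R \<omega> < P then primitive g (R \<omega>) / R \<omega> * f \<omega> else 0) = primitive g (R \<omega>) / R \<omega> * f \<omega>"
        using out[of \<omega>] by auto
    qed
    show ?thesis using int unfolding eq .
  qed
  have ha: "integrable M (\<lambda>\<omega>. primitive g (R \<omega>) / R \<omega> * a \<omega>)"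
    and hb: "integrable M (\<lambda>\<omega>. primitive g (R \<omega>) / R \<omega> * b \<omega>)"
    by (rule hf, rule a_int) (rule hf, rule b_int)
  show "integrable M (\<lambda>\<omega>. primitive g (R \<omega>) / R \<omega> * b \<omega>)" by (fact hb)

  \<comment> \<open>Since D(R) R a = g(R) a - (h(R)/R) a, the left side of the disintegration contains the wanted term.\<close>
  have left: "D (R \<omega>) / R \<omega> * (if R \<omega> < P then (R \<omega>)\<^sup>2 * a \<omega> else 0) =
      g (R \<omega>) * a \<omega> - primitive g (R \<omega>) / R \<omega> * a \<omega>" for \<omega>
  proof (cases "R \<omega> \<in> {\<delta>..\<rho>}")
    case True
    then have "R \<omega> > 0" "R \<omega> < P" using \<delta> by (auto simp: P_def)
    then show ?thesis by (simp add: D_def power2_eq_square divide_simps) (simp add: algebra_simps)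
  next
    case False
    then show ?thesis using Dsupp supp psupp by simp
  qed
  have right: "D r / r * (if 0 < r \<and> r < P then r * inner_mass r else 0) = D r * inner_mass r" for r
  proof (cases "r \<in> {\<delta>..\<rho>}")
    case True
    then show ?thesis using \<delta> by (auto simp: P_def)
  next
    case False
    then show ?thesis using Dsupp by simp
  qed
  have Dm_int: "integrable lborel (\<lambda>r. D r * inner_mass r)"
  proof (rule Bochner_Integration.integrable_bound)
    define B where "B = (\<integral>\<omega>. \<bar>if R \<omega> < \<rho> then a \<omega> + b \<omega> else 0\<bar> \<partial>M)"
    show "integrable lborel (\<lambda>r. D r * B)" using D by simp
    show "AE r in lborel. norm (D r * inner_mass r) \<le> norm (D r * B)"
    proof (rule AE_I2)
      fix r show "norm (D r * inner_mass r) \<le> norm (D r * B)"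
        using Dsupp[of r] inner_mass_bound[of r \<rho>]
        by (cases "r \<in> {\<delta>..\<rho>}") (auto simp: abs_mult B_def intro!: mult_left_mono)
    qed
  qed measurable
  have "(\<integral>\<omega>. g (R \<omega>) * a \<omega> \<partial>M) - (\<integral>\<omega>. primitive g (R \<omega>) / R \<omega> * a \<omega> \<partial>M) =
      (\<integral>\<omega>. D (R \<omega>) / R \<omega> * (if R \<omega> < P then (R \<omega>)\<^sup>2 * a \<omega> else 0) \<partial>M)"
    unfolding left by (rule Bochner_Integration.integral_diff[OF ga ha, symmetric])
  also have "\<dots> = (\<integral>r. D r / r * (if 0 < r \<and> r < P then r * inner_mass r else 0) \<partial>lborel)"
  proof (rule disintegration[where k = "\<lambda>r. D r / r"])
    show "integrable M (\<lambda>\<omega>. D (R \<omega>) / R \<omega> * (if R \<omega> < P then (R \<omega>)\<^sup>2 * a \<omega> else 0))"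
      unfolding left by (rule Bochner_Integration.integrable_diff[OF ga ha])
    show "integrable lborel (\<lambda>r. D r / r * (if 0 < r \<and> r < P then r * inner_mass r else 0))"
      unfolding right by (rule Dm_int)
  qed measurable
  also have "\<dots> = (\<integral>r. D r * (\<integral>\<omega>. (if R \<omega> < r then if R \<omega> < P then a \<omega> + b \<omega> else 0 else 0) \<partial>M) \<partial>lborel)"
    unfolding right
  proof (rule Bochner_Integration.integral_cong[OF refl])
    fix r
    show "D r * inner_mass r = D r * (\<integral>\<omega>. (if R \<omega> < r then if R \<omega> < P then a \<omega> + b \<omega> else 0 else 0) \<partial>M)"
    proof (cases "r < P")
      case True
      then have "(\<lambda>\<omega>. if R \<omega> < r then if R \<omega> < P then a \<omega> + b \<omega> else 0 else 0) =
          (\<lambda>\<omega>. if R \<omega> < r then a \<omega> + b \<omega> else 0)" by auto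
      then show ?thesis by (simp add: inner_mass_def)
    next
      case False
      then show ?thesis using Dsupp[of r] by (simp add: P_def)
    qed
  qed
  also have "\<dots> = (\<integral>\<omega>. (if R \<omega> < P then a \<omega> + b \<omega> else 0) *
      (\<integral>r. (if R \<omega> < r then D r else 0) \<partial>lborel) \<partial>M)"
    by (rule Fubini_tail[OF sigma_finite_measure_axioms ab_int D R])
  also have "\<dots> = (\<integral>\<omega>. - (primitive g (R \<omega>) / R \<omega> * a \<omega>) - primitive g (R \<omega>) / R \<omega> * b \<omega> \<partial>M)"
  proof (rule integral_cong_AE)
    show "AE \<omega> in M. (if R \<omega> < P then a \<omega> + b \<omega> else 0) *
        (\<integral>r. (if R \<omega> < r then D r else 0) \<partial>lborel) =
        - (primitive g (R \<omega>) / R \<omega> * a \<omega>) - primitive g (R \<omega>) / R \<omega> * b \<omega>"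
      using R_atomless[of 0]
    proof eventually_elim
      case (elim \<omega>)
      then have "R \<omega> > 0" using R_nonneg[of \<omega>] by simp
      then have tail: "(\<integral>r. (if R \<omega> < r then D r else 0) \<partial>lborel) = - (primitive g (R \<omega>) / R \<omega>)"
        using D_tail by simp
      show ?case
      proof (cases "R \<omega> < P")
        case True
        then show ?thesis unfolding tail by (simp only: if_True) (simp add: algebra_simps del: times_divide_eq_left times_divide_eq_right)
      next
        case False
        then show ?thesis unfolding tail out[OF False] by simp
      qed
    qed
  qed measurable
  also have "\<dots> = - (\<integral>\<omega>. primitive g (R \<omega>) / R \<omega> * a \<omega> \<partial>M) - (\<integral>\<omega>. primitive g (R \<omega>) / R \<omega> * b \<omega> \<partial>M)"
    unfolding Bochner_Integration.integral_diff[OF Bochner_Integration.integrable_minus[OF ha] hb]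
    by (simp only: integral_minus)
  finally show "(\<integral>\<omega>. g (R \<omega>) * a \<omega> \<partial>M) + (\<integral>\<omega>. primitive g (R \<omega>) / R \<omega> * b \<omega> \<partial>M) = 0"
    by simp
qed

end

section \<open>Exhausting the weight by compactly supported profiles\<close>

lemma integral_const_window:
  fixes l u c :: real
  shows "integrable lborel (\<lambda>s. if l < s \<and> s \<le> u then c else 0)"
    and "l \<le> u \<Longrightarrow> (\<integral>s. (if l < s \<and> s \<le> u then c else 0) \<partial>lborel) = c * (u - l)"
proof -
  have eq: "(\<lambda>s. if l < s \<and> s \<le> u then c else 0) = (\<lambda>s. indicator {l<..u} s * c)"
    by (auto simp: indicator_def)
  show "integrable lborel (\<lambda>s. if l < s \<and> s \<le> u then c else 0)"
    unfolding eq by (intro integrable_mult_left integrable_real_indicator emeasure_bounded_finite) auto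
  show "(\<integral>s. (if l < s \<and> s \<le> u then c else 0) \<partial>lborel) = c * (u - l)" if "l \<le> u"
    unfolding eq using that by simp
qed

text \<open>
  The weight is cut off away from zero and infinity and then compensated by a negative constant on
  \<open>(n, 2 n]\<close>. Its primitive follows the primitive of the weight up to radius \<open>n\<close> and returns to
  zero linearly.
\<close>

definition mean_zero_cutoff :: "(real \<Rightarrow> real) \<Rightarrow> real \<Rightarrow> real \<Rightarrow> real" where
  "mean_zero_cutoff w n s = (if 1 / n < s \<and> s \<le> n then w s else 0)
     - (if n < s \<and> s \<le> 2 * n then (\<integral>u. (if 1 / n < u \<and> u \<le> n then w u else 0) \<partial>lborel) / n else 0)"

context
  fixes w :: "real \<Rightarrow> real"
  assumes w [measurable]: "w \<in> borel_measurable borel" and w_nonneg: "\<And>s. w s \<ge> 0"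
    and w_int: "\<And>\<rho>. integrable lborel (\<lambda>s. if 0 < s \<and> s < \<rho> then w s else 0)"
begin

definition mass :: "real \<Rightarrow> real" where
  "mass r = (\<integral>s. (if 0 < s \<and> s < r then w s else 0) \<partial>lborel)"

lemma mass_measurable [measurable]: "mass \<in> borel_measurable borel"
  unfolding mass_def[abs_def] by measurable

lemma mass_nonneg: "mass r \<ge> 0"
  unfolding mass_def using w_nonneg by (intro Bochner_Integration.integral_nonneg) auto

lemma window_int: "integrable lborel (\<lambda>s. if l < s \<and> s \<le> u then w s else 0)" if "l \<ge> 0"
proof (rule Bochner_Integration.integrable_bound)
  show "integrable lborel (\<lambda>s. if 0 < s \<and> s < u + 1 then w s else 0)" by (rule w_int)
qed (use that w_nonneg in auto)

context
  fixes n :: real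
  assumes n: "n \<ge> 1"
begin

definition cutoff_height :: real where
  "cutoff_height = (\<integral>u. (if 1 / n < u \<and> u \<le> n then w u else 0) \<partial>lborel) / n"

lemma cutoff_height_nonneg: "cutoff_height \<ge> 0"
  unfolding cutoff_height_def using n w_nonneg
  by (intro divide_nonneg_nonneg Bochner_Integration.integral_nonneg) auto

lemma window_le_mass:
  "(\<integral>u. (if 1 / n < u \<and> u \<le> n \<and> u < r then w u else 0) \<partial>lborel) \<le> mass r"
  unfolding mass_def
proof (rule integral_mono)
  show "integrable lborel (\<lambda>u. if 1 / n < u \<and> u \<le> n \<and> u < r then w u else 0)"
  proof (rule Bochner_Integration.integrable_bound)
    show "integrable lborel (\<lambda>u. if 1 / n < u \<and> u \<le> n then w u else 0)"
      using n by (intro window_int) auto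
  qed auto
  have "0 < u" if "1 / n < u" for u
    using n that by (meson divide_pos_pos less_trans order_less_le_trans zero_less_one)
  then show "(if 1 / n < u \<and> u \<le> n \<and> u < r then w u else 0) \<le> (if 0 < u \<and> u < r then w u else 0)" for u
    using w_nonneg[of u] by auto
qed (rule w_int)

text \<open>
  On \<open>(n, 2 n]\<close> the compensating constant is at most \<open>2 mass(r)/r\<close>. Hence the error made by the
  cutoff is dominated by a quantity that is integrable by hypothesis and tends to zero pointwise.
\<close>

lemma cutoff_height_le:
  assumes "n < r" "r \<le> 2 * n"
  shows "cutoff_height \<le> 2 * mass r / r"
proof -
  have "(\<integral>u. (if 1 / n < u \<and> u \<le> n then w u else 0) \<partial>lborel) =
      (\<integral>u. (if 1 / n < u \<and> u \<le> n \<and> u < r then w u else 0) \<partial>lborel)"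
    using assms by (intro Bochner_Integration.integral_cong) auto
  with window_le_mass[of r] have "cutoff_height \<le> mass r / n"
    unfolding cutoff_height_def using n by (simp add: divide_right_mono)
  also have "\<dots> \<le> mass r * (2 / r)"
  proof -
    have "1 / n \<le> 2 / r" using n assms by (simp add: field_simps)
    then have "mass r * (1 / n) \<le> mass r * (2 / r)" using mass_nonneg by (rule mult_left_mono)
    then show ?thesis by simp
  qed
  finally show ?thesis by (simp add: mult.commute)
qed

lemma cutoff_eq: "mean_zero_cutoff w n = (\<lambda>s. (if 1 / n < s \<and> s \<le> n then w s else 0)
     - (if n < s \<and> s \<le> 2 * n then cutoff_height else 0))"
  by (simp add: mean_zero_cutoff_def cutoff_height_def fun_eq_iff)

lemma cutoff_measurable [measurable]: "mean_zero_cutoff w n \<in> borel_measurable borel"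
  unfolding cutoff_eq by measurable

lemma cutoff_int: "integrable lborel (mean_zero_cutoff w n)"
  unfolding cutoff_eq using n
  by (intro Bochner_Integration.integrable_diff window_int integral_const_window) auto

lemma cutoff_mean: "(\<integral>s. mean_zero_cutoff w n s \<partial>lborel) = 0"
proof -
  have "(\<integral>s. mean_zero_cutoff w n s \<partial>lborel) =
      (\<integral>s. (if 1 / n < s \<and> s \<le> n then w s else 0) \<partial>lborel) - cutoff_height * (2 * n - n)"
    unfolding cutoff_eq using n
    by (subst Bochner_Integration.integral_diff) (auto intro!: window_int integral_const_window simp: integral_const_window(2))
  then show ?thesis using n by (simp add: cutoff_height_def)
qed

lemma cutoff_support: "s \<notin> {1 / n..2 * n} \<Longrightarrow> mean_zero_cutoff w n s = 0"
proof -
  have "1 / n \<le> n" using n by (meson divide_le_eq_1 order_trans zero_less_one less_le_trans)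
  then show "s \<notin> {1 / n..2 * n} \<Longrightarrow> mean_zero_cutoff w n s = 0"
    using n by (auto simp: mean_zero_cutoff_def)
qed

lemma primitive_cutoff:
  "primitive (mean_zero_cutoff w n) r =
    (\<integral>u. (if 1 / n < u \<and> u \<le> n \<and> u < r then w u else 0) \<partial>lborel)
    - cutoff_height * max 0 (min r (2 * n) - n)"
proof -
  have i1: "integrable lborel (\<lambda>u. if 1 / n < u \<and> u \<le> n \<and> u < r then w u else 0)"
  proof (rule Bochner_Integration.integrable_bound)
    show "integrable lborel (\<lambda>u. if 1 / n < u \<and> u \<le> n then w u else 0)"
      using n by (intro window_int) auto
  qed auto
  have "primitive (mean_zero_cutoff w n) r =
      (\<integral>u. (if 1 / n < u \<and> u \<le> n \<and> u < r then w u else 0)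
        - (if n < u \<and> u \<le> n + max 0 (min r (2 * n) - n) then cutoff_height else 0) \<partial>lborel)"
    unfolding primitive_def
  proof (rule integral_cong_AE)
    show "AE u in lborel. (if u < r then mean_zero_cutoff w n u else 0) =
        (if 1 / n < u \<and> u \<le> n \<and> u < r then w u else 0)
        - (if n < u \<and> u \<le> n + max 0 (min r (2 * n) - n) then cutoff_height else 0)"
      using AE_lborel_singleton[of r]
      by eventually_elim (auto simp: cutoff_eq max_def min_def)
  qed measurable
  also have "\<dots> = (\<integral>u. (if 1 / n < u \<and> u \<le> n \<and> u < r then w u else 0) \<partial>lborel)
    - (\<integral>u. (if n < u \<and> u \<le> n + max 0 (min r (2 * n) - n) then cutoff_height else 0) \<partial>lborel)"
    by (rule Bochner_Integration.integral_diff[OF i1 integral_const_window(1)])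
  finally show ?thesis by (simp add: integral_const_window(2))
qed

lemma primitive_cutoff_le: "primitive (mean_zero_cutoff w n) r \<le> mass r"
  using window_le_mass[of r] cutoff_height_nonneg unfolding primitive_cutoff
  by (smt (verit) mult_nonneg_nonneg)

lemma primitive_cutoff_nonneg: "primitive (mean_zero_cutoff w n) r \<ge> 0"
proof (cases "r \<le> n")
  case True
  then show ?thesis unfolding primitive_cutoff
    using w_nonneg by (simp add: max_def min_def)
next
  case False
  then have "(\<integral>u. (if 1 / n < u \<and> u \<le> n \<and> u < r then w u else 0) \<partial>lborel) = cutoff_height * n"
    unfolding cutoff_height_def using n by (auto intro!: Bochner_Integration.integral_cong)
  moreover have "max 0 (min r (2 * n) - n) \<le> n" using n by auto
  ultimately show ?thesis unfolding primitive_cutoff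
    using cutoff_height_nonneg by (simp add: mult_left_mono)
qed

lemma abs_cutoff_le: "s \<ge> 0 \<Longrightarrow> \<bar>mean_zero_cutoff w n s\<bar> \<le> w s + 2 * (mass s / s)"
  using cutoff_height_le[of s] cutoff_height_nonneg w_nonneg[of s] mass_nonneg[of s]
  by (auto simp: cutoff_eq)

end

lemma cutoff_tendsto:
  assumes "s > 0"
  shows "(\<lambda>n. mean_zero_cutoff w (real (Suc n)) s) \<longlonglongrightarrow> w s"
proof (rule tendsto_eventually)
  have "eventually (\<lambda>n. max s (1 / s) < real (Suc n)) sequentially"
    by (rule eventually_compose_filterlim[OF eventually_gt_at_top filterlim_compose[OF filterlim_real_sequentially filterlim_Suc]])
  then show "eventually (\<lambda>n. mean_zero_cutoff w (real (Suc n)) s = w s) sequentially"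
  proof eventually_elim
    case (elim n)
    then have "1 / real (Suc n) < s" "s < real (Suc n)"
      using assms by (auto simp: field_simps)
    then show ?case by (simp add: mean_zero_cutoff_def)
  qed
qed

lemma primitive_cutoff_tendsto:
  "(\<lambda>n. primitive (mean_zero_cutoff w (real (Suc n))) r) \<longlonglongrightarrow> mass r"
proof -
  let ?A = "\<lambda>n. \<integral>u. (if 1 / real (Suc n) < u \<and> u \<le> real (Suc n) \<and> u < r then w u else 0) \<partial>lborel"
  have "?A \<longlonglongrightarrow> mass r"
    unfolding mass_def
  proof (rule integral_dominated_convergence[OF _ _ w_int[of r]])
    show "AE u in lborel. (\<lambda>n. if 1 / real (Suc n) < u \<and> u \<le> real (Suc n) \<and> u < r then w u else 0)
        \<longlonglongrightarrow> (if 0 < u \<and> u < r then w u else 0)"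
    proof (rule AE_I2, cases)
      fix u :: real assume u: "0 < u"
      have "eventually (\<lambda>n. max u (1 / u) < real (Suc n)) sequentially"
        by (rule eventually_compose_filterlim[OF eventually_gt_at_top filterlim_compose[OF filterlim_real_sequentially filterlim_Suc]])
      then show "(\<lambda>n. if 1 / real (Suc n) < u \<and> u \<le> real (Suc n) \<and> u < r then w u else 0)
          \<longlonglongrightarrow> (if 0 < u \<and> u < r then w u else 0)"
      proof (intro tendsto_eventually, eventually_elim)
        case (elim n)
        then have "1 / real (Suc n) < u" "u < real (Suc n)"
          using u by (auto simp: field_simps)
        then show ?case using u by simp
      qed
    next
      fix u :: real assume u: "\<not> 0 < u"
      have "\<not> 1 / real (Suc n) < u" for n
        using u by (smt (verit) divide_nonneg_nonneg of_nat_0_le_iff)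
      with u show "(\<lambda>n. if 1 / real (Suc n) < u \<and> u \<le> real (Suc n) \<and> u < r then w u else 0)
          \<longlonglongrightarrow> (if 0 < u \<and> u < r then w u else 0)"
        by simp
    qed
    show "AE u in lborel. norm (if 1 / real (Suc n) < u \<and> u \<le> real (Suc n) \<and> u < r then w u else 0)
        \<le> (if 0 < u \<and> u < r then w u else 0)" for n
    proof (rule AE_I2)
      fix u
      have "0 < u" if "1 / real (Suc n) < u"
        using that by (smt (verit) divide_nonneg_nonneg of_nat_0_le_iff)
      then show "norm (if 1 / real (Suc n) < u \<and> u \<le> real (Suc n) \<and> u < r then w u else 0)
        \<le> (if 0 < u \<and> u < r then w u else 0)" using w_nonneg[of u] by auto
    qed
  qed measurable
  moreover have "eventually (\<lambda>n. ?A n = primitive (mean_zero_cutoff w (real (Suc n))) r) sequentially"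
  proof -
    have "eventually (\<lambda>n. r < real (Suc n)) sequentially"
      by (rule eventually_compose_filterlim[OF eventually_gt_at_top filterlim_compose[OF filterlim_real_sequentially filterlim_Suc]])
    then show ?thesis
      by eventually_elim (auto simp: primitive_cutoff max_def min_def)
  qed
  ultimately show ?thesis by (rule Lim_transform_eventually)
qed

end

text \<open>
  The radial field with component \<open>mass w\<close>, the primitive of the weight, is an admissible test field:
  its cutoffs are, and every term passes to the limit by dominated convergence.
\<close>

theorem (in radial_pair) weighted_identity:
  assumes w [measurable]: "w \<in> borel_measurable borel" and w_nonneg: "\<And>s. w s \<ge> 0"
    and w_int: "\<And>\<rho>. integrable lborel (\<lambda>s. if 0 < s \<and> s < \<rho> then w s else 0)"
    and wa: "integrable M (\<lambda>\<omega>. w (R \<omega>) * a \<omega>)"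
    and Wa: "integrable M (\<lambda>\<omega>. mass w (R \<omega>) / R \<omega> * a \<omega>)"
    and Wb: "integrable M (\<lambda>\<omega>. mass w (R \<omega>) / R \<omega> * b \<omega>)"
  shows "(\<integral>\<omega>. w (R \<omega>) * a \<omega> \<partial>M) + (\<integral>\<omega>. mass w (R \<omega>) / R \<omega> * b \<omega> \<partial>M) = 0"
proof -
  note [measurable] = mass_measurable[OF w w_nonneg w_int]
  define g where "g n = mean_zero_cutoff w (real (Suc n))" for n
  have [measurable]: "g n \<in> borel_measurable borel" for n
    unfolding g_def by (rule cutoff_measurable[OF w w_nonneg w_int]) auto
  have pos: "AE \<omega> in M. R \<omega> > 0"
    using R_atomless[of 0]
  proof eventually_elim
    case (elim \<omega>)
    then show ?case using R_nonneg[of \<omega>] by simp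
  qed
  let ?dom = "\<lambda>\<omega>. \<bar>w (R \<omega>) * a \<omega>\<bar> + 2 * \<bar>mass w (R \<omega>) / R \<omega> * a \<omega>\<bar>"
  have dom: "integrable M ?dom" using wa Wa by (intro Bochner_Integration.integrable_add integrable_mult_right integrable_abs) auto
  have bd: "\<bar>g n (R \<omega>) * a \<omega>\<bar> \<le> ?dom \<omega>" for n \<omega>
  proof -
    have "\<bar>g n (R \<omega>)\<bar> \<le> w (R \<omega>) + 2 * (mass w (R \<omega>) / R \<omega>)"
      unfolding g_def by (rule abs_cutoff_le[OF w w_nonneg w_int _ R_nonneg]) auto
    then have "\<bar>g n (R \<omega>)\<bar> * \<bar>a \<omega>\<bar> \<le> (w (R \<omega>) + 2 * (mass w (R \<omega>) / R \<omega>)) * \<bar>a \<omega>\<bar>"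
      by (rule mult_right_mono) simp
    also have "\<dots> = ?dom \<omega>"
      using w_nonneg R_nonneg mass_nonneg[OF w w_nonneg w_int] by (simp add: abs_mult algebra_simps)
    finally show ?thesis by (simp add: abs_mult)
  qed
  have ga: "integrable M (\<lambda>\<omega>. g n (R \<omega>) * a \<omega>)" for n
    by (rule Bochner_Integration.integrable_bound[OF dom]) (use bd in auto)
  have id: "(\<integral>\<omega>. g n (R \<omega>) * a \<omega> \<partial>M) + (\<integral>\<omega>. primitive (g n) (R \<omega>) / R \<omega> * b \<omega> \<partial>M) = 0" for n
  proof (rule radial_identity(2)[where \<delta> = "1 / real (Suc n)" and \<rho> = "2 * real (Suc n)"])
    show "integrable lborel (g n)" "(\<integral>s. g n s \<partial>lborel) = 0"
      unfolding g_def by (rule cutoff_int[OF w w_nonneg w_int] cutoff_mean[OF w w_nonneg w_int], simp)+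
    show "g n s = 0" if "s \<notin> {1 / real (Suc n)..2 * real (Suc n)}" for s
      unfolding g_def by (rule cutoff_support[OF w w_nonneg w_int _ that]) simp
  qed (use ga in auto)
  have lim_a: "(\<lambda>n. \<integral>\<omega>. g n (R \<omega>) * a \<omega> \<partial>M) \<longlonglongrightarrow> (\<integral>\<omega>. w (R \<omega>) * a \<omega> \<partial>M)"
  proof (rule integral_dominated_convergence[OF _ _ dom])
    show "AE \<omega> in M. (\<lambda>n. g n (R \<omega>) * a \<omega>) \<longlonglongrightarrow> w (R \<omega>) * a \<omega>"
      using pos
    proof eventually_elim
      case (elim \<omega>)
      show ?case unfolding g_def
        by (intro tendsto_mult tendsto_const cutoff_tendsto[OF w w_nonneg w_int elim])
    qed
  qed (use bd in auto)
  have lim_b: "(\<lambda>n. \<integral>\<omega>. primitive (g n) (R \<omega>) / R \<omega> * b \<omega> \<partial>M)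
      \<longlonglongrightarrow> (\<integral>\<omega>. mass w (R \<omega>) / R \<omega> * b \<omega> \<partial>M)"
  proof (rule integral_dominated_convergence[OF _ _ integrable_abs[OF Wb]])
    show "AE \<omega> in M. (\<lambda>n. primitive (g n) (R \<omega>) / R \<omega> * b \<omega>) \<longlonglongrightarrow> mass w (R \<omega>) / R \<omega> * b \<omega>"
      using pos
    proof eventually_elim
      case (elim \<omega>)
      then show ?case unfolding g_def
        by (intro tendsto_mult tendsto_divide tendsto_const primitive_cutoff_tendsto[OF w w_nonneg w_int]) auto
    qed
    show "AE \<omega> in M. norm (primitive (g n) (R \<omega>) / R \<omega> * b \<omega>) \<le> \<bar>mass w (R \<omega>) / R \<omega> * b \<omega>\<bar>" for n
    proof (rule AE_I2)
      fix \<omega>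
      have "0 \<le> primitive (g n) (R \<omega>)" "primitive (g n) (R \<omega>) \<le> mass w (R \<omega>)"
        unfolding g_def
        by (rule primitive_cutoff_nonneg[OF w w_nonneg w_int] primitive_cutoff_le[OF w w_nonneg w_int], simp)+
      then show "norm (primitive (g n) (R \<omega>) / R \<omega> * b \<omega>) \<le> \<bar>mass w (R \<omega>) / R \<omega> * b \<omega>\<bar>"
        using R_nonneg[of \<omega>] by (auto simp: abs_mult intro!: mult_right_mono divide_right_mono)
    qed
  qed measurable
  have "(\<lambda>n. 0) \<longlonglongrightarrow> (\<integral>\<omega>. w (R \<omega>) * a \<omega> \<partial>M) + (\<integral>\<omega>. mass w (R \<omega>) / R \<omega> * b \<omega> \<partial>M)"
    using tendsto_add[OF lim_a lim_b] unfolding id .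
  then show ?thesis by (simp add: LIMSEQ_const_iff)
qed

section \<open>Borel representatives and space-time integrals\<close>

text \<open>
  The weak formulation integrates over space first and time last, whereas the product measure puts
  space first; hence the order of the quantifiers.
\<close>

lemma AE_lborel_pair_swap:
  fixes P :: "'a::euclidean_space \<times> 'b::euclidean_space \<Rightarrow> bool"
  assumes "AE z in lborel. P z"
  shows "AE t in lborel. AE x in lborel. P (x, t)"
proof -
  obtain N where N: "N \<in> null_sets (lborel :: ('a \<times> 'b) measure)" and NP: "{z. \<not> P z} \<subseteq> N"
    using assms by (auto elim!: AE_E simp: null_sets_def)
  have [measurable]: "N \<in> sets (lborel \<Otimes>\<^sub>M lborel)" unfolding lborel_prod using N by auto
  have "AE z in (lborel :: 'a measure) \<Otimes>\<^sub>M (lborel :: 'b measure). z \<notin> N"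
    unfolding lborel_prod using N by (rule AE_not_in)
  then have "AE x in (lborel :: 'a measure). AE t in (lborel :: 'b measure). (x, t) \<notin> N"
    by (rule lborel_pair.AE_pair)
  then have "AE t in (lborel :: 'b measure). AE x in (lborel :: 'a measure). (x, t) \<notin> N"
    by (subst lborel_pair.AE_commute[symmetric]) measurable
  then show ?thesis
  proof eventually_elim
    case (elim t)
    then show ?case by eventually_elim (use NP in auto)
  qed
qed

lemma AE_lborel_fst:
  fixes P :: "'a::euclidean_space \<Rightarrow> bool"
  assumes "AE x in lborel. P x"
  shows "AE z in (lborel :: ('a \<times> 'b::euclidean_space) measure). P (fst z)"
proof -
  obtain N where N: "N \<in> null_sets (lborel :: 'a measure)" and NP: "{x. \<not> P x} \<subseteq> N"
    using assms by (auto elim!: AE_E simp: null_sets_def)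
  have [measurable]: "N \<in> sets lborel" using N by auto
  have "AE z in (lborel :: 'a measure) \<Otimes>\<^sub>M (lborel :: 'b measure). fst z \<notin> N"
  proof (rule lborel_pair.AE_pair_measure)
    show "{z \<in> space ((lborel :: 'a measure) \<Otimes>\<^sub>M (lborel :: 'b measure)). fst z \<notin> N}
        \<in> sets (lborel \<Otimes>\<^sub>M lborel)" by measurable
    show "AE x in (lborel :: 'a measure). AE t in (lborel :: 'b measure). fst (x, t) \<notin> N"
      using AE_not_in[OF N] by eventually_elim simp
  qed
  then show ?thesis
    unfolding lborel_prod by eventually_elim (use NP in auto)
qed

lemma borel_representative:
  fixes u :: "'a::euclidean_space \<Rightarrow> 'b::euclidean_space"
  assumes "u \<in> borel_measurable lebesgue"
  obtains U where "U \<in> borel_measurable borel" "AE x in lborel. u x = U x"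
proof -
  have "\<exists>U. U \<in> borel_measurable borel \<and> (AE x in lborel. u x \<bullet> b = U x)" for b
  proof -
    have "(\<lambda>x. u x \<bullet> b) \<in> borel_measurable (completion lborel)" using assms by measurable
    from completion_ex_borel_measurable_real[OF this] show ?thesis by auto
  qed
  then obtain U where U: "\<And>b. U b \<in> borel_measurable borel" "\<And>b. AE x in lborel. u x \<bullet> b = U b x"
    by metis
  have "AE x in lborel. \<forall>b\<in>Basis. u x \<bullet> b = U b x"
    using U(2) by (subst AE_finite_all) auto
  then have "AE x in lborel. u x = (\<Sum>b\<in>Basis. U b x *\<^sub>R b)"
    by eventually_elim (metis (no_types, lifting) euclidean_representation sum.cong)
  moreover have "(\<lambda>x. \<Sum>b\<in>Basis. U b x *\<^sub>R b) \<in> borel_measurable borel"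
    using U(1) by measurable
  ultimately show ?thesis using that by blast
qed

lemma spacetime_borel_representative:
  fixes u :: "real ^ 'n::finite \<Rightarrow> real \<Rightarrow> 'b::euclidean_space"
  assumes "(\<lambda>(x, t). u x t) \<in> borel_measurable (lebesgue_on (UNIV \<times> {0<..<T}))"
  obtains U where "U \<in> borel_measurable borel"
    "AE z in lborel. snd z \<in> {0<..<T} \<longrightarrow> u (fst z) (snd z) = U z"
    "\<And>z. snd z \<notin> {0<..<T} \<Longrightarrow> U z = 0"
proof -
  let ?S = "UNIV \<times> {0<..<T} :: ((real ^ 'n) \<times> real) set"
  have S [measurable]: "?S \<in> sets borel" by (intro borel_open open_Times) auto
  then have "(\<lambda>z. if z \<in> ?S then u (fst z) (snd z) else 0) \<in> borel_measurable lebesgue"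
    using assms by (subst borel_measurable_if) (auto simp: case_prod_unfold)
  then obtain U where U [measurable]: "U \<in> borel_measurable borel"
    and eq: "AE z in lborel. (if z \<in> ?S then u (fst z) (snd z) else 0) = U z"
    by (rule borel_representative)
  show ?thesis
  proof
    show "(\<lambda>z. if z \<in> ?S then U z else 0) \<in> borel_measurable borel"
      by measurable
    show "AE z in lborel. snd z \<in> {0<..<T} \<longrightarrow> u (fst z) (snd z) = (if z \<in> ?S then U z else 0)"
      using eq by eventually_elim (auto simp: mem_Times_iff)
  qed (auto simp: mem_Times_iff)
qed

text \<open>
  For almost every time the Borel representative and the original function agree for almost every
  point, so the iterated Lebesgue integral becomes a Borel one. The extension by zero outside
  \<open>(0, T)\<close> absorbs the restriction in time.
\<close>

lemma spacetime_integral_eq: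
  fixes G :: "(real ^ 'n::finite) \<times> real \<Rightarrow> real"
  assumes G: "integrable lborel G"
    and eq: "AE z in lborel. snd z \<in> {0<..<T} \<longrightarrow> g (fst z) (snd z) = G z"
    and out: "\<And>z. snd z \<notin> {0<..<T} \<Longrightarrow> G z = 0"
  shows "spacetime_integral T g = (\<integral>z. G z \<partial>lborel)"
proof -
  have G': "integrable ((lborel :: (real ^ 'n) measure) \<Otimes>\<^sub>M (lborel :: real measure)) (case_prod (\<lambda>x t. G (x, t)))"
    using G by (simp add: lborel_prod)
  have [measurable]: "G \<in> borel_measurable ((lborel :: (real ^ 'n) measure) \<Otimes>\<^sub>M (lborel :: real measure))"
    using G by (simp add: lborel_prod)
  have "spacetime_integral T g = (\<integral>t. (\<integral>x. G (x, t) \<partial>lborel) \<partial>lebesgue)"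
    unfolding spacetime_integral_def set_lebesgue_integral_def
  proof (rule integral_lebesgue_cong_AE)
    show "AE t in lebesgue. indicator {0<..<T} t *\<^sub>R (\<integral>x. g x t \<partial>lebesgue) = (\<integral>x. G (x, t) \<partial>lborel)"
      using AE_completion[OF AE_lborel_pair_swap[OF eq]]
    proof eventually_elim
      case (elim t)
      show ?case
      proof (cases "t \<in> {0<..<T}")
        case True
        have "(\<integral>x. g x t \<partial>lebesgue) = (\<integral>x. G (x, t) \<partial>lebesgue)"
          by (rule integral_lebesgue_cong_AE, use AE_completion[OF elim] in eventually_elim)
             (use True in auto)
        also have "\<dots> = (\<integral>x. G (x, t) \<partial>lborel)"
          by (rule integral_completion) measurable
        finally show ?thesis using True by simp
      qed (simp add: out)
    qed
  qed
  also have "\<dots> = (\<integral>t. (\<integral>x. G (x, t) \<partial>lborel) \<partial>lborel)"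
    by (rule integral_completion) measurable
  also have "\<dots> = (\<integral>z. G z \<partial>lborel)"
    using lborel_pair.integral_snd[OF G'] by (simp add: lborel_prod)
  finally show ?thesis .
qed

text \<open>
  An inequality suffices for transferring finiteness, because the nonnegative integral is monotone even
  for nonmeasurable functions.
\<close>

lemma spacetime_nn_integral_le:
  fixes G :: "(real ^ 'n::finite) \<times> real \<Rightarrow> ennreal"
  assumes G: "G \<in> borel_measurable borel"
    and le: "AE z in lborel. snd z \<in> {0<..<T} \<longrightarrow> G z \<le> g (fst z) (snd z)"
    and out: "\<And>z. snd z \<notin> {0<..<T} \<Longrightarrow> G z = 0"
  shows "(\<integral>\<^sup>+z. G z \<partial>lborel) \<le> (\<integral>\<^sup>+t\<in>{0<..<T}. (\<integral>\<^sup>+x. g x t \<partial>lebesgue) \<partial>lebesgue)"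
proof -
  have G': "G \<in> borel_measurable ((lborel :: (real ^ 'n) measure) \<Otimes>\<^sub>M (lborel :: real measure))"
    using G by (simp add: lborel_prod)
  have "(\<integral>\<^sup>+z. G z \<partial>lborel) = (\<integral>\<^sup>+t. (\<integral>\<^sup>+x. G (x, t) \<partial>lborel) \<partial>lborel)"
    using lborel_pair.nn_integral_snd[OF G'] by (simp add: lborel_prod)
  also have "\<dots> \<le> (\<integral>\<^sup>+t\<in>{0<..<T}. (\<integral>\<^sup>+x. g x t \<partial>lborel) \<partial>lborel)"
  proof (rule nn_integral_mono_AE)
    show "AE t in lborel. (\<integral>\<^sup>+x. G (x, t) \<partial>lborel) \<le> (\<integral>\<^sup>+x. g x t \<partial>lborel) * indicator {0<..<T} t"
      using AE_lborel_pair_swap[OF le]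
    proof eventually_elim
      case (elim t)
      show ?case
      proof (cases "t \<in> {0<..<T}")
        case True
        have "(\<integral>\<^sup>+x. G (x, t) \<partial>lborel) \<le> (\<integral>\<^sup>+x. g x t \<partial>lborel)"
          by (rule nn_integral_mono_AE, use elim in eventually_elim) (use True in auto)
        then show ?thesis using True by simp
      qed (simp add: out)
    qed
  qed
  finally show ?thesis by (simp add: nn_integral_completion)
qed

section \<open>Cutoffs and the weak formulation for radial fields\<close>

lemma flat_exp_le_1: "flat_exp 0 y \<le> 1" "flat_exp 1 y \<le> 1"
  using flat_exp_bound(2)[of y 0 0] flat_exp_bound(2)[of y 1 0] by (cases "y > 0"; simp add: flat_exp_def)+

lemma flat_exp_tendsto:
  "(flat_exp 0 \<longlongrightarrow> 1) at_top" "(flat_exp 1 \<longlongrightarrow> 0) at_top"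
proof -
  have inv: "((\<lambda>y::real. - 1 / y) \<longlongrightarrow> 0) at_top"
    by (intro tendsto_divide_0[OF tendsto_const] filterlim_at_top_imp_at_infinity filterlim_ident)
  have "((\<lambda>y::real. exp (- 1 / y)) \<longlongrightarrow> exp 0) at_top" by (intro tendsto_exp inv)
  moreover have "eventually (\<lambda>y. exp (- 1 / y) = flat_exp 0 y) at_top"
    using eventually_gt_at_top[of "0::real"] by eventually_elim (simp add: flat_exp_def)
  ultimately show 0: "(flat_exp 0 \<longlongrightarrow> 1) at_top" using Lim_transform_eventually by fastforce
  have "((\<lambda>y. - (flat_exp 0 y * (- 1 / y))) \<longlongrightarrow> - (1 * 0)) at_top"
    by (intro tendsto_minus tendsto_mult 0 inv)
  moreover have "eventually (\<lambda>y. - (flat_exp 0 y * (- 1 / y)) = flat_exp 1 y) at_top"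
    using eventually_gt_at_top[of "0::real"] by eventually_elim (simp add: flat_exp_def)
  ultimately show "(flat_exp 1 \<longlongrightarrow> 0) at_top" using Lim_transform_eventually by fastforce
qed

lemma filterlim_scaled_nat:
  fixes y c :: real
  assumes "y > 0"
  shows "filterlim (\<lambda>n. c + real (Suc n) * y) at_top sequentially"
proof -
  have "filterlim (\<lambda>n. real (Suc n)) at_top sequentially"
    by (rule filterlim_compose[OF filterlim_real_sequentially filterlim_Suc])
  then have "filterlim (\<lambda>n. real (Suc n) * y) at_top sequentially"
    by (rule filterlim_at_top_mult_tendsto_pos[OF tendsto_const assms])
  then show ?thesis by (rule filterlim_tendsto_add_at_top[OF tendsto_const])
qed

text \<open>
  The shift by one unit keeps the support of the \<open>n\<close>-th cutoff a distance \<open>1/(n + 1)\<close> away from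
  the ends of the time interval.
\<close>

definition time_cutoff :: "real \<Rightarrow> nat \<Rightarrow> real \<Rightarrow> real" where
  "time_cutoff T n t = flat_exp 0 (- 1 + real (Suc n) * t) * flat_exp 0 (- 1 + real (Suc n) * (T - t))"

lemma smooth_time_cutoff: "smooth (time_cutoff T n)"
proof -
  have "smooth (\<lambda>t. flat_exp 0 (- 1 + real (Suc n) * t)
      * flat_exp 0 ((- 1 + real (Suc n) * T) + (- real (Suc n)) * t))"
    by (intro smooth_mult smooth_affine smooth_flat_exp)
  then show ?thesis by (simp add: time_cutoff_def[abs_def] algebra_simps)
qed

lemma time_test_function_cutoff: "time_test_function T (time_cutoff T n)"
  unfolding time_test_function_def
proof (intro conjI)
  let ?\<xi> = "time_cutoff T n" and ?k = "real (Suc n)"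
  show "?\<xi> C1_differentiable_on UNIV"
    unfolding C1_differentiable_on_def
    using smooth_deriv[OF smooth_time_cutoff] smooth_imp_continuous
    by (metis has_real_derivative_iff_has_vector_derivative)
  have "{t. ?\<xi> t \<noteq> 0} \<subseteq> {1 / ?k..T - 1 / ?k}"
  proof
    fix t assume "t \<in> {t. ?\<xi> t \<noteq> 0}"
    then have "1 < ?k * t" "1 < ?k * (T - t)"
      by (auto simp: time_cutoff_def flat_exp_def split: if_splits)
    then have "1 / ?k < t" "1 / ?k < T - t"
      by (auto simp: field_simps)
    then show "t \<in> {1 / ?k..T - 1 / ?k}" by auto
  qed
  then have cl: "closure {t. ?\<xi> t \<noteq> 0} \<subseteq> {1 / ?k..T - 1 / ?k}"
    by (rule closure_minimal) simp
  then show "compact (closure {t. ?\<xi> t \<noteq> 0})"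
    by (meson bounded_closed_interval bounded_subset closed_closure compact_eq_bounded_closed)
  have "0 < 1 / ?k" by simp
  then have "{1 / ?k..T - 1 / ?k} \<subseteq> {0<..<T}"
    by (smt (verit) atLeastAtMost_iff greaterThanLessThan_iff subsetI)
  with cl show "closure {t. ?\<xi> t \<noteq> 0} \<subseteq> {0<..<T}" by blast
qed

lemma time_cutoff_bound: "\<bar>time_cutoff T n t\<bar> \<le> 1"
proof -
  have "time_cutoff T n t \<le> 1 * 1" "0 \<le> time_cutoff T n t"
    unfolding time_cutoff_def by (intro mult_mono mult_nonneg_nonneg flat_exp_le_1 flat_exp_bound zero_le_one)+
  then show ?thesis by simp
qed

lemma time_cutoff_tendsto:
  assumes "t \<in> {0<..<T}"
  shows "(\<lambda>n. time_cutoff T n t) \<longlonglongrightarrow> 1"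
proof -
  have "(\<lambda>n. flat_exp 0 (- 1 + real (Suc n) * t) * flat_exp 0 (- 1 + real (Suc n) * (T - t)))
      \<longlonglongrightarrow> 1 * 1"
    by (intro tendsto_mult filterlim_compose[OF flat_exp_tendsto(1)] filterlim_scaled_nat)
       (use assms in auto)
  then show ?thesis by (simp add: time_cutoff_def)
qed

text \<open>
  Smooth approximations of the tent \<open>s \<mapsto> max 0 (c - s)\<close>. They are obtained by multiplying
  \<open>c - s\<close> with a smooth approximation of the indicator of \<open>s < c\<close>; since \<open>flat_exp 0\<close> is flat at the
  origin and \<open>y flat_exp 2 y = flat_exp 1 y\<close> is bounded, the derivatives stay bounded.
\<close>

definition tent_approx :: "real \<Rightarrow> nat \<Rightarrow> real \<Rightarrow> real" where
  "tent_approx c n s = (c - s) * flat_exp 0 (real (Suc n) * (c - s))"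

lemma smooth_tent_approx: "smooth (tent_approx c n)"
proof -
  have "smooth (\<lambda>s. (c + (- 1) * s) * flat_exp 0 (real (Suc n) * c + (- real (Suc n)) * s))"
    by (intro smooth_mult smooth_affine smooth_flat_exp smooth_ident)
  then show ?thesis by (simp add: tent_approx_def[abs_def] algebra_simps)
qed

lemma tent_approx_deriv:
  "(tent_approx c n has_real_derivative
    - (flat_exp 0 (real (Suc n) * (c - s)) + flat_exp 1 (real (Suc n) * (c - s)))) (at s)"
proof -
  let ?k = "real (Suc n)"
  have d: "((\<lambda>s. flat_exp 0 (?k * (c - s))) has_real_derivative flat_exp 2 (?k * (c - s)) * (- ?k)) (at s)"
    using flat_exp_deriv[of 0 "?k * (c - s)"]
    by (intro DERIV_chain2[where f = "flat_exp 0"]) (auto intro!: derivative_eq_intros simp: numeral_2_eq_2)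
  have "y * flat_exp 2 y = flat_exp 1 y" for y
    by (simp add: flat_exp_def power2_eq_square)
  from this[of "?k * (c - s)"]
  have "(c - s) * (flat_exp 2 (?k * (c - s)) * (- ?k)) = - flat_exp 1 (?k * (c - s))"
    by (simp add: mult_ac del: of_nat_Suc)
  moreover have "((\<lambda>s. c - s) has_real_derivative - 1) (at s)"
    by (auto intro!: derivative_eq_intros)
  note DERIV_mult[OF this d]
  ultimately show ?thesis
    unfolding tent_approx_def[abs_def] by (simp add: mult.commute del: of_nat_Suc)
qed

lemma tent_approx_bounds:
  assumes "s \<le> c"
  shows "\<bar>tent_approx c n s\<bar> \<le> c - s" and "\<bar>deriv (tent_approx c n) s\<bar> \<le> 2"
proof -
  show "\<bar>tent_approx c n s\<bar> \<le> c - s"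
    unfolding tent_approx_def abs_mult using assms flat_exp_le_1(1) flat_exp_bound(1)[of 0]
    by (simp add: mult_left_le)
  show "\<bar>deriv (tent_approx c n) s\<bar> \<le> 2"
    unfolding DERIV_imp_deriv[OF tent_approx_deriv]
    using flat_exp_le_1[of "real (Suc n) * (c - s)"] flat_exp_bound(1)[of _ "real (Suc n) * (c - s)"]
    by (smt (verit))
qed

lemma tent_approx_vanishing: "s \<ge> c \<Longrightarrow> tent_approx c n s = 0"
  by (cases "s = c") (auto simp: tent_approx_def flat_exp_def zero_less_mult_iff)

lemma tent_approx_tendsto:
  assumes "s < c"
  shows "(\<lambda>n. tent_approx c n s) \<longlonglongrightarrow> c - s"
    and "(\<lambda>n. deriv (tent_approx c n) s) \<longlonglongrightarrow> - 1"
proof -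
  have lim: "filterlim (\<lambda>n. real (Suc n) * (c - s)) at_top sequentially"
    using filterlim_scaled_nat[of "c - s" 0] assms by simp
  have "(\<lambda>n. (c - s) * flat_exp 0 (real (Suc n) * (c - s))) \<longlonglongrightarrow> (c - s) * 1"
    by (intro tendsto_mult tendsto_const filterlim_compose[OF flat_exp_tendsto(1) lim])
  then show "(\<lambda>n. tent_approx c n s) \<longlonglongrightarrow> c - s" by (simp add: tent_approx_def)
  have "(\<lambda>n. - (flat_exp 0 (real (Suc n) * (c - s)) + flat_exp 1 (real (Suc n) * (c - s))))
      \<longlonglongrightarrow> - (1 + 0)"
    by (intro tendsto_minus tendsto_add filterlim_compose[OF flat_exp_tendsto(1) lim]
        filterlim_compose[OF flat_exp_tendsto(2) lim])
  then show "(\<lambda>n. deriv (tent_approx c n) s) \<longlonglongrightarrow> - 1"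
    by (simp add: DERIV_imp_deriv[OF tent_approx_deriv])
qed

lemma spacetime_integral_zero:
  assumes "AE t in lebesgue. t \<in> {0<..<T} \<longrightarrow> (\<integral>x. g x t \<partial>lebesgue) = 0"
  shows "spacetime_integral T g = 0"
  unfolding spacetime_integral_def set_lebesgue_integral_def
  by (rule integral_eq_zero_AE, use assms in eventually_elim) (auto simp: indicator_def)

lemma spacetime_integral_nonneg:
  assumes "AE t in lebesgue. t \<in> {0<..<T} \<longrightarrow> (\<integral>x. g x t \<partial>lebesgue) \<ge> 0"
  shows "spacetime_integral T g \<ge> 0"
  unfolding spacetime_integral_def set_lebesgue_integral_def
  by (rule integral_nonneg_AE, use assms in eventually_elim) (auto simp: indicator_def)

lemma div_free_radial_terms_vanish:
  fixes u :: "real ^ 'n::finite \<Rightarrow> real \<Rightarrow> real ^ 'n"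
  assumes u: "AE t in lebesgue. t \<in> {0<..<T} \<longrightarrow> distr_div_free (\<lambda>x. u x t)"
    and F: "smooth F" "\<And>s. s \<ge> c \<Longrightarrow> F s = 0"
  shows "spacetime_integral T (\<lambda>x t. (u x t \<bullet> radial_field F x) * \<theta> t) = 0"
proof (rule spacetime_integral_zero)
  show "AE t in lebesgue. t \<in> {0<..<T} \<longrightarrow> (\<integral>x. (u x t \<bullet> radial_field F x) * \<theta> t \<partial>lebesgue) = 0"
    using u by eventually_elim (auto simp: distr_div_free_radial_field[OF _ F])
qed

text \<open>
  For a radial field the three terms that are linear in the velocity or the force vanish, and only the
  inertial and pressure terms survive. Viscosity and force disappear here.
\<close>

lemma weak_solution_radial_test:
  fixes v f :: "real ^ 'n::finite \<Rightarrow> real \<Rightarrow> real ^ 'n"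
  assumes sol: "weak_solution_NS \<nu> T f v p"
    and F: "smooth F" "\<And>s. s \<ge> c \<Longrightarrow> F s = 0" and \<xi>: "time_test_function T \<xi>"
  shows "- spacetime_integral T (\<lambda>x t. (F (x \<bullet> x) * (v x t \<bullet> v x t)
        + 2 * deriv F (x \<bullet> x) * (v x t \<bullet> x)\<^sup>2) * \<xi> t) =
    spacetime_integral T (\<lambda>x t. p x t * (real CARD('n) * F (x \<bullet> x) + 2 * (x \<bullet> x) * deriv F (x \<bullet> x)) * \<xi> t)"
proof -
  note dF = smooth_deriv[OF F(1)]
  note ddF = smooth_deriv[OF dF(2)]
  define G where "G = (\<lambda>s. (2 * real CARD('n) + 4) * deriv F s + 4 * s * deriv (deriv F) s)"
  have dF0: "deriv F s = 0" if "s \<ge> c" for s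
    using deriv_vanishing[OF dF(1) F(2) that] .
  have ddF0: "deriv (deriv F) s = 0" if "s \<ge> c" for s
    using deriv_vanishing[OF ddF(1) dF0 that] .
  have G: "smooth G" "\<And>s. s \<ge> c \<Longrightarrow> G s = 0"
    unfolding G_def using dF0 ddF0 by (auto intro!: smooth_add smooth_mult smooth_const smooth_ident dF ddF)
  have v: "AE t in lebesgue. t \<in> {0<..<T} \<longrightarrow> distr_div_free (\<lambda>x. v x t)"
  proof -
    have "AE t in lebesgue. t \<in> {0<..<T} \<longrightarrow> Lq_loc_sigma 2 (\<lambda>x. v x t)"
      using sol unfolding weak_solution_NS_def Lq_time_Lq_loc_sigma_def by blast
    then show ?thesis by eventually_elim (simp add: Lq_loc_sigma_def)
  qed
  have f: "AE t in lebesgue. t \<in> {0<..<T} \<longrightarrow> distr_div_free (\<lambda>x. f x t)"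
  proof -
    have "AE t in lebesgue. t \<in> {0<..<T} \<longrightarrow> Lq_loc_sigma 1 (\<lambda>x. f x t)"
      using sol unfolding weak_solution_NS_def Lq_time_Lq_loc_sigma_def by blast
    then show ?thesis by eventually_elim (simp add: Lq_loc_sigma_def)
  qed
  have "test_function (radial_field F :: real ^ 'n \<Rightarrow> real ^ 'n)"
    using F by (rule test_function_radial_field)
  with sol \<xi> have "- spacetime_integral T (\<lambda>x t. (v x t \<bullet> radial_field F x) * deriv \<xi> t)
      - spacetime_integral T (\<lambda>x t. double_dot (tensor (v x t) (v x t)) (jacobian_mat (radial_field F) x) * \<xi> t)
      = spacetime_integral T (\<lambda>x t. p x t * divergence (radial_field F) x * \<xi> t)
        + \<nu> * spacetime_integral T (\<lambda>x t. (v x t \<bullet> laplacian (radial_field F) x) * \<xi> t)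
        + spacetime_integral T (\<lambda>x t. (f x t \<bullet> radial_field F x) * \<xi> t)"
    unfolding weak_solution_NS_def by blast
  moreover have lap: "laplacian (radial_field F) = (radial_field G :: real ^ 'n \<Rightarrow> real ^ 'n)"
    using laplacian_radial_field[OF dF(1) ddF(1)] by (auto simp: G_def)
  ultimately show ?thesis
    by (simp add: lap div_free_radial_terms_vanish[OF v F] div_free_radial_terms_vanish[OF v G]
        div_free_radial_terms_vanish[OF f F] double_dot_jacobian_radial_field[OF dF(1)]
        divergence_radial_field[OF dF(1)])
qed

section \<open>The balance for tent profiles\<close>

lemma real_CARD_ge_1: "real CARD('a::finite) \<ge> 1"
  by (metis One_nat_def Suc_leI of_nat_1 of_nat_le_iff zero_less_card_finite)

text \<open>
  The projections as Borel maps on the product topology, so that measurability proofs need not pass to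
  the product sigma-algebra.
\<close>

lemma borel_measurable_fst_snd [measurable]:
  "(fst :: 'a::second_countable_topology \<times> 'b::second_countable_topology \<Rightarrow> 'a) \<in> borel_measurable borel"
  "(snd :: 'a \<times> 'b \<Rightarrow> 'b) \<in> borel_measurable borel"
  by (auto intro!: borel_measurable_continuous_onI continuous_intros)

lemma bounded_of_vanishing:
  assumes F: "continuous_on UNIV F" and van: "\<And>s. s \<ge> c \<Longrightarrow> F s = (0::real)"
  obtains B where "B \<ge> 0" "\<And>s::real. s \<ge> 0 \<Longrightarrow> \<bar>F s\<bar> \<le> B"
proof -
  have "compact (F ` {0..\<bar>c\<bar>})"
    by (intro compact_continuous_image continuous_on_subset[OF F]) auto
  then have "bounded (F ` {0..\<bar>c\<bar>})" by (rule compact_imp_bounded)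
  then obtain B where "\<forall>y\<in>F ` {0..\<bar>c\<bar>}. norm y \<le> B"
    unfolding bounded_iff by blast
  then have B: "\<bar>F s\<bar> \<le> B" if "s \<in> {0..\<bar>c\<bar>}" for s using that by simp
  have "\<bar>F s\<bar> \<le> max B 0" if "s \<ge> 0" for s
    using B[of s] van[of s] that by (cases "s \<in> {0..\<bar>c\<bar>}") auto
  then show ?thesis using that[of "max B 0"] by simp
qed

text \<open>
  A weak solution together with Borel representatives of velocity and pressure on space-time, set to
  zero outside the time interval. All estimates are made for the representatives.
\<close>

locale borel_solution =
  fixes \<nu> T :: real and f v :: "real ^ 'n::finite \<Rightarrow> real \<Rightarrow> real ^ 'n" and p :: "real ^ 'n \<Rightarrow> real \<Rightarrow> real"
    and V :: "(real ^ 'n) \<times> real \<Rightarrow> real ^ 'n" and P :: "(real ^ 'n) \<times> real \<Rightarrow> real"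
  assumes sol: "weak_solution_NS \<nu> T f v p"
    and V_meas [measurable]: "V \<in> borel_measurable borel"
    and V_eq: "AE z in lborel. snd z \<in> {0<..<T} \<longrightarrow> v (fst z) (snd z) = V z"
    and V_out: "\<And>z. snd z \<notin> {0<..<T} \<Longrightarrow> V z = 0"
    and P_meas [measurable]: "P \<in> borel_measurable borel"
    and P_eq: "AE z in lborel. snd z \<in> {0<..<T} \<longrightarrow> p (fst z) (snd z) = P z"
    and P_out: "\<And>z. snd z \<notin> {0<..<T} \<Longrightarrow> P z = 0"
begin

abbreviation density :: "(real ^ 'n) \<times> real \<Rightarrow> real" where
  "density z \<equiv> (norm (V z))\<^sup>2 + \<bar>P z\<bar>"

lemma local_integrable:
  fixes u :: "real ^ 'n \<Rightarrow> real \<Rightarrow> 'b::euclidean_space" and U :: "(real ^ 'n) \<times> real \<Rightarrow> 'b"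
  assumes loc: "Lq_time_Lq_loc q T u" and U [measurable]: "U \<in> borel_measurable borel"
    and eq: "AE z in lborel. snd z \<in> {0<..<T} \<longrightarrow> u (fst z) (snd z) = U z"
    and out: "\<And>z. snd z \<notin> {0<..<T} \<Longrightarrow> U z = 0"
  shows "integrable lborel (\<lambda>z. if norm (fst z) < \<rho> then norm (U z) powr q else 0)"
proof (rule integrableI_nonneg)
  have "(\<integral>\<^sup>+z. ennreal (if norm (fst z) < \<rho> then norm (U z) powr q else 0) \<partial>lborel) \<le>
      (\<integral>\<^sup>+t\<in>{0<..<T}. (\<integral>\<^sup>+x\<in>cball 0 \<rho>. ennreal (norm (u x t) powr q) \<partial>lebesgue) \<partial>lebesgue)"
  proof (rule spacetime_nn_integral_le)
    show "AE z in lborel. snd z \<in> {0<..<T} \<longrightarrow>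
        ennreal (if norm (fst z) < \<rho> then norm (U z) powr q else 0)
        \<le> ennreal (norm (u (fst z) (snd z)) powr q) * indicator (cball 0 \<rho>) (fst z)"
      using eq by eventually_elim (auto simp: indicator_def)
    show "(\<lambda>z. ennreal (if norm (fst z) < \<rho> then norm (U z) powr q else 0)) \<in> borel_measurable borel"
      by measurable
  qed (simp add: out)
  also have "\<dots> < \<infinity>"
    by (rule loc[unfolded Lq_time_Lq_loc_def, THEN conjunct2, rule_format, OF compact_cball])
  finally show "(\<integral>\<^sup>+z. ennreal (if norm (fst z) < \<rho> then norm (U z) powr q else 0) \<partial>lborel) < \<infinity>" .
qed auto

lemma density_loc: "integrable lborel (\<lambda>z. if norm (fst z) < \<rho> then density z else 0)"
proof -
  have "Lq_time_Lq_loc 2 T v" "Lq_time_Lq_loc 1 T p"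
    using sol unfolding weak_solution_NS_def Lq_time_Lq_loc_sigma_def by blast+
  from local_integrable[OF this(1) V_meas V_eq V_out, of \<rho>] local_integrable[OF this(2) P_meas P_eq P_out, of \<rho>]
  have "integrable lborel (\<lambda>z. (if norm (fst z) < \<rho> then norm (V z) powr 2 else 0)
      + (if norm (fst z) < \<rho> then norm (P z) powr 1 else 0))"
    by (rule Bochner_Integration.integrable_add)
  moreover have "(if norm (fst z) < \<rho> then norm (V z) powr 2 else 0)
      + (if norm (fst z) < \<rho> then norm (P z) powr 1 else 0) = (if norm (fst z) < \<rho> then density z else 0)" for z
    by simp
  ultimately show ?thesis by simp
qed

lemma dominated_integrable:
  assumes "h \<in> borel_measurable borel"
    and "\<And>z. norm (fst z) < \<rho> \<Longrightarrow> \<bar>h z\<bar> \<le> C * density z"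
    and "\<And>z. norm (fst z) \<ge> \<rho> \<Longrightarrow> h z = 0"
  shows "integrable lborel h"
proof (rule Bochner_Integration.integrable_bound)
  show "integrable lborel (\<lambda>z. C * (if norm (fst z) < \<rho> then density z else 0))"
    using density_loc by simp
  show "AE z in lborel. norm (h z) \<le> norm (C * (if norm (fst z) < \<rho> then density z else 0))"
  proof (rule AE_I2)
    fix z show "norm (h z) \<le> norm (C * (if norm (fst z) < \<rho> then density z else 0))"
      using assms(2,3)[of z] by (cases "norm (fst z) < \<rho>") auto
  qed
qed (use assms(1) in simp)

definition inertia :: "(real \<Rightarrow> real) \<Rightarrow> (real ^ 'n) \<times> real \<Rightarrow> real" where
  "inertia F z = F (fst z \<bullet> fst z) * (V z \<bullet> V z) + 2 * deriv F (fst z \<bullet> fst z) * (V z \<bullet> fst z)\<^sup>2"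

definition pressure_work :: "(real \<Rightarrow> real) \<Rightarrow> (real ^ 'n) \<times> real \<Rightarrow> real" where
  "pressure_work F z = P z * (real CARD('n) * F (fst z \<bullet> fst z) + 2 * (fst z \<bullet> fst z) * deriv F (fst z \<bullet> fst z))"

lemma radial_component_le: "(V z \<bullet> fst z)\<^sup>2 \<le> (norm (V z))\<^sup>2 * (norm (fst z))\<^sup>2"
  using Cauchy_Schwarz_ineq[of "V z" "fst z"] by (simp add: dot_square_norm)

lemma inertia_pressure_bound:
  assumes A: "\<bar>F (fst z \<bullet> fst z)\<bar> \<le> A" and B: "\<bar>deriv F (fst z \<bullet> fst z)\<bar> \<le> B" and z: "norm (fst z) < \<rho>"
  defines "C \<equiv> real CARD('n) * A + 2 * B * \<rho>\<^sup>2"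
  shows "\<bar>inertia F z\<bar> \<le> C * (norm (V z))\<^sup>2" and "\<bar>pressure_work F z\<bar> \<le> C * \<bar>P z\<bar>"
proof -
  note N = real_CARD_ge_1[where 'a = 'n]
  have A0: "0 \<le> A" and B0: "0 \<le> B" using A B by (auto intro: order_trans[OF abs_ge_zero])
  have r: "(norm (fst z))\<^sup>2 \<le> \<rho>\<^sup>2" using z by (intro power_mono) auto
  have "\<bar>inertia F z\<bar> \<le> \<bar>F (fst z \<bullet> fst z)\<bar> * (norm (V z))\<^sup>2 + 2 * \<bar>deriv F (fst z \<bullet> fst z)\<bar> * (V z \<bullet> fst z)\<^sup>2"
    unfolding inertia_def by (rule order_trans[OF abs_triangle_ineq]) (simp add: abs_mult dot_square_norm)
  also have "\<dots> \<le> A * (norm (V z))\<^sup>2 + 2 * B * ((norm (V z))\<^sup>2 * \<rho>\<^sup>2)"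
    using A B A0 B0 by (intro add_mono mult_mono order_trans[OF radial_component_le mult_left_mono[OF r]]) auto
  also have "\<dots> \<le> real CARD('n) * A * (norm (V z))\<^sup>2 + 2 * B * ((norm (V z))\<^sup>2 * \<rho>\<^sup>2)"
    using N A0 by (intro add_right_mono mult_right_mono) (auto simp: mult_le_cancel_right1)
  finally show "\<bar>inertia F z\<bar> \<le> C * (norm (V z))\<^sup>2" by (simp add: C_def algebra_simps)
  have "\<bar>real CARD('n) * F (fst z \<bullet> fst z) + 2 * (fst z \<bullet> fst z) * deriv F (fst z \<bullet> fst z)\<bar>
      \<le> real CARD('n) * \<bar>F (fst z \<bullet> fst z)\<bar> + 2 * (norm (fst z))\<^sup>2 * \<bar>deriv F (fst z \<bullet> fst z)\<bar>"
    by (rule order_trans[OF abs_triangle_ineq]) (simp add: abs_mult dot_square_norm)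
  also have "\<dots> \<le> real CARD('n) * A + 2 * \<rho>\<^sup>2 * B"
    using A B r by (intro add_mono mult_mono) auto
  finally show "\<bar>pressure_work F z\<bar> \<le> C * \<bar>P z\<bar>"
    unfolding pressure_work_def abs_mult C_def by (simp add: mult.commute mult_left_mono mult_ac)
qed

context
  fixes F :: "real \<Rightarrow> real" and c :: real
  assumes F: "smooth F" "\<And>s. s \<ge> c \<Longrightarrow> F s = 0"
begin

lemma deriv_vanishes: "s \<ge> c \<Longrightarrow> deriv F s = 0"
  using deriv_vanishing[OF smooth_deriv(1)[OF F(1)] F(2)] .

lemma F_measurable [measurable]: "F \<in> borel_measurable borel" "deriv F \<in> borel_measurable borel"
  using smooth_imp_continuous[OF F(1)] smooth_imp_continuous[OF smooth_deriv(2)[OF F(1)]]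
  by (auto intro: borel_measurable_continuous_onI)

lemma inertia_measurable [measurable]: "inertia F \<in> borel_measurable borel"
  unfolding inertia_def[abs_def] by measurable

lemma pressure_work_measurable [measurable]: "pressure_work F \<in> borel_measurable borel"
  unfolding pressure_work_def[abs_def] by measurable

lemma inertia_pressure_dominated:
  obtains C \<rho> where "\<And>z. norm (fst z) < \<rho> \<Longrightarrow> \<bar>inertia F z\<bar> \<le> C * density z"
    "\<And>z. norm (fst z) < \<rho> \<Longrightarrow> \<bar>pressure_work F z\<bar> \<le> C * density z"
    "\<And>z. norm (fst z) \<ge> \<rho> \<Longrightarrow> inertia F z = 0" "\<And>z. norm (fst z) \<ge> \<rho> \<Longrightarrow> pressure_work F z = 0"
proof -
  obtain A where A: "A \<ge> 0" "\<And>s. s \<ge> 0 \<Longrightarrow> \<bar>F s\<bar> \<le> A"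
    using bounded_of_vanishing[OF smooth_imp_continuous[OF F(1)] F(2)] by blast
  obtain B where B: "B \<ge> 0" "\<And>s. s \<ge> 0 \<Longrightarrow> \<bar>deriv F s\<bar> \<le> B"
    using bounded_of_vanishing[OF smooth_imp_continuous[OF smooth_deriv(2)[OF F(1)]] deriv_vanishes] by blast
  define \<rho> where "\<rho> = sqrt \<bar>c\<bar>"
  define C where "C = real CARD('n) * A + 2 * B * \<rho>\<^sup>2"
  have C: "C \<ge> 0" using A(1) B(1) by (auto simp: C_def)
  have far: "fst z \<bullet> fst z \<ge> c" if "norm (fst z) \<ge> \<rho>" for z :: "(real ^ 'n) \<times> real"
  proof -
    have "\<rho>\<^sup>2 \<le> (norm (fst z))\<^sup>2" using that by (intro power_mono) (auto simp: \<rho>_def)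
    then show ?thesis by (simp add: \<rho>_def dot_square_norm)
  qed
  show ?thesis
  proof (rule that[of \<rho> C])
    fix z :: "(real ^ 'n) \<times> real" assume z: "norm (fst z) < \<rho>"
    note bd = inertia_pressure_bound[OF A(2)[OF inner_ge_zero] B(2)[OF inner_ge_zero] z, folded C_def]
    have "C * (norm (V z))\<^sup>2 \<le> C * density z" "C * \<bar>P z\<bar> \<le> C * density z"
      using C by (auto intro!: mult_left_mono)
    with bd show "\<bar>inertia F z\<bar> \<le> C * density z" "\<bar>pressure_work F z\<bar> \<le> C * density z" by linarith+
  qed (use far F(2) deriv_vanishes in \<open>auto simp: inertia_def pressure_work_def\<close>)
qed

lemma inertia_int: "integrable lborel (inertia F)"
  and pressure_work_int: "integrable lborel (pressure_work F)"
proof -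
  obtain C \<rho> where *: "\<And>z. norm (fst z) < \<rho> \<Longrightarrow> \<bar>inertia F z\<bar> \<le> C * density z"
    "\<And>z. norm (fst z) < \<rho> \<Longrightarrow> \<bar>pressure_work F z\<bar> \<le> C * density z"
    "\<And>z. norm (fst z) \<ge> \<rho> \<Longrightarrow> inertia F z = 0" "\<And>z. norm (fst z) \<ge> \<rho> \<Longrightarrow> pressure_work F z = 0"
    by (rule inertia_pressure_dominated) blast
  show "integrable lborel (inertia F)"
    by (rule dominated_integrable[OF inertia_measurable *(1) *(3)])
  show "integrable lborel (pressure_work F)"
    by (rule dominated_integrable[OF pressure_work_measurable *(2) *(4)])
qed

lemma balance_with_cutoff:
  assumes \<xi>: "time_test_function T \<xi>" and \<xi>_meas [measurable]: "\<xi> \<in> borel_measurable borel"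
    and \<xi>_bd: "\<And>t. \<bar>\<xi> t\<bar> \<le> 1"
  shows "(\<integral>z. (inertia F z + pressure_work F z) * \<xi> (snd z) \<partial>lborel) = 0"
proof -
  have int: "integrable lborel (\<lambda>z. h z * \<xi> (snd z))" if h: "integrable lborel h" for h :: "(real ^ 'n) \<times> real \<Rightarrow> real"
  proof (rule Bochner_Integration.integrable_bound[OF h])
    have [measurable]: "h \<in> borel_measurable borel" using h by simp
    show "(\<lambda>z. h z * \<xi> (snd z)) \<in> borel_measurable lborel" by measurable
    show "AE z in lborel. norm (h z * \<xi> (snd z)) \<le> norm (h z)"
      using \<xi>_bd by (intro AE_I2) (simp add: abs_mult mult_left_le)
  qed
  have 1: "spacetime_integral T (\<lambda>x t. (F (x \<bullet> x) * (v x t \<bullet> v x t)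
        + 2 * deriv F (x \<bullet> x) * (v x t \<bullet> x)\<^sup>2) * \<xi> t) = (\<integral>z. inertia F z * \<xi> (snd z) \<partial>lborel)"
  proof (rule spacetime_integral_eq[OF int[OF inertia_int]])
    show "AE z in lborel. snd z \<in> {0<..<T} \<longrightarrow>
        (F (fst z \<bullet> fst z) * (v (fst z) (snd z) \<bullet> v (fst z) (snd z))
          + 2 * deriv F (fst z \<bullet> fst z) * (v (fst z) (snd z) \<bullet> fst z)\<^sup>2) * \<xi> (snd z) = inertia F z * \<xi> (snd z)"
      using V_eq by eventually_elim (auto simp: inertia_def)
  qed (simp add: inertia_def V_out)
  have 2: "spacetime_integral T (\<lambda>x t. p x t * (real CARD('n) * F (x \<bullet> x) + 2 * (x \<bullet> x) * deriv F (x \<bullet> x)) * \<xi> t)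
      = (\<integral>z. pressure_work F z * \<xi> (snd z) \<partial>lborel)"
  proof (rule spacetime_integral_eq[OF int[OF pressure_work_int]])
    show "AE z in lborel. snd z \<in> {0<..<T} \<longrightarrow>
        p (fst z) (snd z) * (real CARD('n) * F (fst z \<bullet> fst z) + 2 * (fst z \<bullet> fst z) * deriv F (fst z \<bullet> fst z)) * \<xi> (snd z)
          = pressure_work F z * \<xi> (snd z)"
      using P_eq by eventually_elim (auto simp: pressure_work_def)
  qed (simp add: pressure_work_def P_out)
  have "(\<integral>z. (inertia F z + pressure_work F z) * \<xi> (snd z) \<partial>lborel) =
      (\<integral>z. inertia F z * \<xi> (snd z) \<partial>lborel) + (\<integral>z. pressure_work F z * \<xi> (snd z) \<partial>lborel)"
    unfolding distrib_right
    by (rule Bochner_Integration.integral_add[OF int[OF inertia_int] int[OF pressure_work_int]])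
  also have "\<dots> = 0"
  proof -
    have "- (\<integral>z. inertia F z * \<xi> (snd z) \<partial>lborel) = (\<integral>z. pressure_work F z * \<xi> (snd z) \<partial>lborel)"
      unfolding 1[symmetric] 2[symmetric]
      by (rule weak_solution_radial_test[OF sol F(1) _ \<xi>]) (rule F(2))
    then show ?thesis by linarith
  qed
  finally show ?thesis .
qed

text \<open>
  The integrand vanishes outside the time interval, and the cutoffs in time are bounded by one
  and converge to one inside it.
\<close>

lemma balance: "(\<integral>z. inertia F z + pressure_work F z \<partial>lborel) = 0"
proof -
  have tm: "time_cutoff T n \<in> borel_measurable borel" for n
    by (intro borel_measurable_continuous_onI smooth_imp_continuous smooth_time_cutoff)
  note [measurable] = tm
  have int: "integrable lborel (\<lambda>z. inertia F z + pressure_work F z)"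
    using inertia_int pressure_work_int by (rule Bochner_Integration.integrable_add)
  have "(\<lambda>n. \<integral>z. (inertia F z + pressure_work F z) * time_cutoff T n (snd z) \<partial>lborel)
      \<longlonglongrightarrow> (\<integral>z. inertia F z + pressure_work F z \<partial>lborel)"
  proof (rule integral_dominated_convergence[OF _ _ integrable_abs[OF int]])
    show "AE z in lborel. (\<lambda>n. (inertia F z + pressure_work F z) * time_cutoff T n (snd z))
        \<longlonglongrightarrow> inertia F z + pressure_work F z"
    proof (rule AE_I2)
      fix z :: "(real ^ 'n) \<times> real"
      show "(\<lambda>n. (inertia F z + pressure_work F z) * time_cutoff T n (snd z))
          \<longlonglongrightarrow> inertia F z + pressure_work F z"
      proof (cases "snd z \<in> {0<..<T}")
        case True
        from tendsto_mult[OF tendsto_const time_cutoff_tendsto[OF True]] show ?thesis by simp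
      next
        case False
        then show ?thesis by (simp add: inertia_def pressure_work_def V_out P_out)
      qed
    qed
    show "AE z in lborel. norm ((inertia F z + pressure_work F z) * time_cutoff T n (snd z))
        \<le> \<bar>inertia F z + pressure_work F z\<bar>" for n
      using time_cutoff_bound by (intro AE_I2) (simp add: abs_mult mult_left_le)
  qed measurable
  then show ?thesis
    using balance_with_cutoff[OF time_test_function_cutoff tm time_cutoff_bound]
    by (simp add: LIMSEQ_const_iff)
qed

end

text \<open>
  The balance for the tent profile \<open>F(s) = max 0 (\<rho>\<^sup>2 - s)\<close>, whose derivative is \<open>-1\<close> inside
  the ball, as the limit of its smooth approximations.
\<close>

lemma tent_balance:
  assumes "\<rho> > 0"
  shows "(\<integral>z. (if norm (fst z) < \<rho> then
      (\<rho>\<^sup>2 - fst z \<bullet> fst z) * (V z \<bullet> V z + real CARD('n) * P z)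
      - 2 * ((V z \<bullet> fst z)\<^sup>2 + (fst z \<bullet> fst z) * P z) else 0) \<partial>lborel) = 0"
proof -
  define F where "F = tent_approx (\<rho>\<^sup>2)"
  have F: "smooth (F n)" "\<And>s. s \<ge> \<rho>\<^sup>2 \<Longrightarrow> F n s = 0" for n
    unfolding F_def by (rule smooth_tent_approx) (rule tent_approx_vanishing)
  note [measurable] = inertia_measurable[OF F] pressure_work_measurable[OF F]
  define C where "C = real CARD('n) * \<rho>\<^sup>2 + 2 * 2 * \<rho>\<^sup>2"
  have near: "fst z \<bullet> fst z < \<rho>\<^sup>2" if "norm (fst z) < \<rho>" for z :: "(real ^ 'n) \<times> real"
    using power_strict_mono[OF that norm_ge_zero, of 2] by (simp add: dot_square_norm)
  have far: "inertia (F n) z = 0" "pressure_work (F n) z = 0" if "\<not> norm (fst z) < \<rho>" for n z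
  proof -
    have "\<rho>\<^sup>2 \<le> fst z \<bullet> fst z"
      using power_mono[of \<rho> "norm (fst z)" 2] that assms by (simp add: dot_square_norm)
    then show "inertia (F n) z = 0" "pressure_work (F n) z = 0"
      using F(2) deriv_vanishes[OF F] by (simp_all add: inertia_def pressure_work_def)
  qed
  have "(\<lambda>n. \<integral>z. inertia (F n) z + pressure_work (F n) z \<partial>lborel) \<longlonglongrightarrow>
    (\<integral>z. (if norm (fst z) < \<rho> then
      (\<rho>\<^sup>2 - fst z \<bullet> fst z) * (V z \<bullet> V z + real CARD('n) * P z)
      - 2 * ((V z \<bullet> fst z)\<^sup>2 + (fst z \<bullet> fst z) * P z) else 0) \<partial>lborel)"
  proof (rule integral_dominated_convergence)
    show "integrable lborel (\<lambda>z. C * (if norm (fst z) < \<rho> then density z else 0))"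
      using density_loc by simp
    show "AE z in lborel. norm (inertia (F n) z + pressure_work (F n) z)
        \<le> C * (if norm (fst z) < \<rho> then density z else 0)" for n
    proof (rule AE_I2)
      fix z :: "(real ^ 'n) \<times> real"
      show "norm (inertia (F n) z + pressure_work (F n) z) \<le> C * (if norm (fst z) < \<rho> then density z else 0)"
      proof (cases "norm (fst z) < \<rho>")
        case True
        have "\<bar>F n (fst z \<bullet> fst z)\<bar> \<le> \<rho>\<^sup>2" "\<bar>deriv (F n) (fst z \<bullet> fst z)\<bar> \<le> 2"
          unfolding F_def
          using tent_approx_bounds[of "fst z \<bullet> fst z" "\<rho>\<^sup>2" n] near[OF True] inner_ge_zero[of "fst z"]
          by linarith+
        from inertia_pressure_bound[OF this True, folded C_def] True show ?thesis
          by (simp add: distrib_left)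
      qed (simp add: far)
    qed
    show "AE z in lborel. (\<lambda>n. inertia (F n) z + pressure_work (F n) z) \<longlonglongrightarrow>
      (if norm (fst z) < \<rho> then
      (\<rho>\<^sup>2 - fst z \<bullet> fst z) * (V z \<bullet> V z + real CARD('n) * P z)
      - 2 * ((V z \<bullet> fst z)\<^sup>2 + (fst z \<bullet> fst z) * P z) else 0)"
    proof (rule AE_I2)
      fix z :: "(real ^ 'n) \<times> real"
      show "(\<lambda>n. inertia (F n) z + pressure_work (F n) z) \<longlonglongrightarrow>
      (if norm (fst z) < \<rho> then
      (\<rho>\<^sup>2 - fst z \<bullet> fst z) * (V z \<bullet> V z + real CARD('n) * P z)
      - 2 * ((V z \<bullet> fst z)\<^sup>2 + (fst z \<bullet> fst z) * P z) else 0)"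
      proof (cases "norm (fst z) < \<rho>")
        case True
        note lim = tent_approx_tendsto[OF near[OF True], folded F_def]
        have "(\<lambda>n. inertia (F n) z + pressure_work (F n) z) \<longlonglongrightarrow>
          ((\<rho>\<^sup>2 - fst z \<bullet> fst z) * (V z \<bullet> V z) + 2 * (- 1) * (V z \<bullet> fst z)\<^sup>2)
          + P z * (real CARD('n) * (\<rho>\<^sup>2 - fst z \<bullet> fst z) + 2 * (fst z \<bullet> fst z) * (- 1))"
          unfolding inertia_def pressure_work_def
          by (intro tendsto_add tendsto_mult tendsto_const lim)
        then show ?thesis using True by (simp add: algebra_simps)
      qed (simp add: far)
    qed
  qed measurable
  then show ?thesis
    using balance[OF F] by (simp add: LIMSEQ_const_iff)
qed

end

section \<open>The weight and the stresses of a weak solution\<close>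

text \<open>
  The weight is only Lebesgue measurable, and composing such a function with a norm requires a Borel
  representative. Truncation at zero makes the representative nonnegative everywhere.
\<close>

lemma borel_weight:
  fixes w :: "real \<Rightarrow> real"
  assumes w_loc: "\<And>K. compact K \<Longrightarrow> K \<subseteq> {0..} \<Longrightarrow> set_integrable lebesgue K w"
    and w_pos: "AE s in lebesgue. s \<ge> 0 \<longrightarrow> w s > 0"
  obtains w' where "w' \<in> borel_measurable borel" "\<And>s. w' s \<ge> 0"
    "AE s in lborel. s \<ge> 0 \<longrightarrow> w s = w' s \<and> w' s > 0"
    "\<And>\<rho>. integrable lborel (\<lambda>s. if 0 < s \<and> s < \<rho> then w' s else 0)"
    "\<And>r. (LINT s:{0..r}|lebesgue. w s) = mass w' r"
proof -
  have "(\<lambda>s. indicator {0..} s * w s) \<in> borel_measurable lebesgue"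
  proof (rule borel_measurable_LIMSEQ_real)
    show "(\<lambda>n. indicator {0..real n} s * w s) \<longlonglongrightarrow> indicator {0..} s * w s" for s
    proof (rule tendsto_eventually)
      have "eventually (\<lambda>n. s \<le> real n) sequentially"
        by (meson eventually_sequentiallyI le_nat_iff nat_ceiling_le_eq of_nat_0_le_iff real_nat_ceiling_ge order_trans of_nat_le_iff)
      then show "eventually (\<lambda>n. indicator {0..real n} s * w s = indicator {0..} s * w s) sequentially"
        by eventually_elim (simp add: indicator_def)
    qed
    show "(\<lambda>s. indicator {0..real n} s * w s) \<in> borel_measurable lebesgue" for n
      using borel_measurable_integrable[OF w_loc[of "{0..real n}", unfolded set_integrable_def]] by simp
  qed
  then obtain w0 where w0: "w0 \<in> borel_measurable borel" "AE s in lborel. indicator {0..} s * w s = w0 s"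
    by (rule borel_representative)
  define w' where "w' s = max 0 (w0 s)" for s
  have meas [measurable]: "w' \<in> borel_measurable borel" unfolding w'_def using w0(1) by measurable
  have nonneg: "w' s \<ge> 0" for s by (simp add: w'_def)
  have "AE s in lborel. s \<ge> 0 \<longrightarrow> w s > 0"
    using w_pos by (simp add: AE_completion_iff)
  with w0(2) have eq: "AE s in lborel. s \<ge> 0 \<longrightarrow> w s = w' s \<and> w' s > 0"
    by eventually_elim (auto simp: w'_def)
  have eq_ind: "AE s in lebesgue. indicator {0..r} s * w s = (if 0 < s \<and> s < r then w' s else 0)" for r
  proof -
    have "AE s in lborel. indicator {0..r} s * w s = (if 0 < s \<and> s < r then w' s else 0)"
      using eq AE_lborel_singleton[of 0] AE_lborel_singleton[of r]
      by eventually_elim (auto simp: indicator_def)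
    then show ?thesis by (rule AE_completion)
  qed
  have int: "integrable lborel (\<lambda>s. if 0 < s \<and> s < r then w' s else 0)" for r
  proof -
    have "integrable lebesgue (\<lambda>s. indicator {0..r} s * w s)"
      using w_loc[of "{0..r}", unfolded set_integrable_def] by simp
    then have "integrable lebesgue (\<lambda>s. if 0 < s \<and> s < r then w' s else 0)"
      by (rule integrable_cong_AE_imp) (use eq_ind in \<open>auto intro!: measurable_completion elim: eventually_mono\<close>)
    then show ?thesis by (subst (asm) integrable_completion) auto
  qed
  have mass: "(LINT s:{0..r}|lebesgue. w s) = mass w' r" for r
  proof -
    have "(LINT s:{0..r}|lebesgue. w s) = (\<integral>s. (if 0 < s \<and> s < r then w' s else 0) \<partial>lebesgue)"
      unfolding set_lebesgue_integral_def
      by (rule integral_lebesgue_cong_AE) (use eq_ind in simp)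
    also have "\<dots> = mass w' r"
      unfolding mass_def[OF meas nonneg int] by (rule integral_completion) measurable
    finally show ?thesis .
  qed
  show ?thesis by (rule that[OF meas nonneg eq int mass])
qed

lemma mass_pos:
  assumes w: "w \<in> borel_measurable borel" "\<And>s. w s \<ge> 0"
    "\<And>\<rho>. integrable lborel (\<lambda>s. if 0 < s \<and> s < \<rho> then w s else 0)"
    and pos: "AE s in lborel. s \<ge> 0 \<longrightarrow> w s > 0" and r: "r > 0"
  shows "mass w r > 0"
proof (rule ccontr)
  assume "\<not> mass w r > 0"
  then have "(\<integral>s. (if 0 < s \<and> s < r then w s else 0) \<partial>lborel) = 0"
    using mass_nonneg[OF w, of r] unfolding mass_def[OF w] by simp
  then have "AE s in lborel. (if 0 < s \<and> s < r then w s else 0) = 0"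
    using w(2) by (subst (asm) integral_nonneg_eq_0_iff_AE[OF w(3)]) auto
  with pos have "AE s in lborel. \<not> s \<in> {0<..<r}"
    by eventually_elim (auto split: if_splits)
  then have "emeasure lborel {0<..<r} = 0"
    by (subst (asm) AE_iff_null_sets[symmetric]) auto
  then show False using r by simp
qed

lemma lebesgue_double_integral_nonneg:
  assumes "AE s in lebesgue. s \<ge> 0 \<longrightarrow> w s > (0::real)"
  shows "(LINT r:{0..R}|lebesgue. (LINT s:{0..r}|lebesgue. w s)) \<ge> 0"
proof -
  have "(LINT s:{0..r}|lebesgue. w s) \<ge> 0" for r
    unfolding set_lebesgue_integral_def
    by (rule integral_nonneg_AE, use assms in eventually_elim) (auto simp: indicator_def)
  then show ?thesis
    unfolding set_lebesgue_integral_def by (intro Bochner_Integration.integral_nonneg) simp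
qed

context borel_solution
begin

text \<open>
  The squared radial component of the velocity; at the origin the division convention gives zero.
\<close>

definition radial_energy :: "(real ^ 'n) \<times> real \<Rightarrow> real" where
  "radial_energy z = (V z \<bullet> fst z)\<^sup>2 / (norm (fst z))\<^sup>2"

lemma radial_energy_measurable [measurable]: "radial_energy \<in> borel_measurable borel"
  unfolding radial_energy_def[abs_def] by measurable

lemma radial_energy_bounds: "0 \<le> radial_energy z" "radial_energy z \<le> (norm (V z))\<^sup>2"
  using radial_component_le[of z] by (auto simp: radial_energy_def divide_le_eq)

text \<open>
  In polar terms the momentum flux \<open>v \<otimes> v + p I\<close> has one radial diagonal entry, and its
  tangential diagonal entries add up to \<open>tangential_stress\<close>.
\<close>

definition radial_stress :: "(real ^ 'n) \<times> real \<Rightarrow> real" where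
  "radial_stress z = radial_energy z + P z"

definition tangential_stress :: "(real ^ 'n) \<times> real \<Rightarrow> real" where
  "tangential_stress z = (norm (V z))\<^sup>2 - radial_energy z + (real CARD('n) - 1) * P z"

lemma stress_measurable [measurable]:
  "radial_stress \<in> borel_measurable borel" "tangential_stress \<in> borel_measurable borel"
  unfolding radial_stress_def[abs_def] tangential_stress_def[abs_def] by measurable

lemma stress_bounds:
  "\<bar>radial_stress z\<bar> \<le> density z" "\<bar>tangential_stress z\<bar> \<le> real CARD('n) * density z"
proof -
  note N = real_CARD_ge_1[where 'a = 'n]
  show "\<bar>radial_stress z\<bar> \<le> density z"
    using radial_energy_bounds[of z] unfolding radial_stress_def by linarith
  have "\<bar>tangential_stress z\<bar> \<le> \<bar>(norm (V z))\<^sup>2 - radial_energy z\<bar> + \<bar>(real CARD('n) - 1) * P z\<bar>"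
    unfolding tangential_stress_def by (rule abs_triangle_ineq)
  also have "\<dots> \<le> 1 * (norm (V z))\<^sup>2 + real CARD('n) * \<bar>P z\<bar>"
    using radial_energy_bounds[of z] N unfolding abs_mult by (intro add_mono mult_right_mono) auto
  also have "\<dots> \<le> real CARD('n) * density z"
    using mult_right_mono[OF N, of "(norm (V z))\<^sup>2"] by (simp add: distrib_left)
  finally show "\<bar>tangential_stress z\<bar> \<le> real CARD('n) * density z" .
qed

lemma radius_atomless: "AE z in (lborel :: ((real ^ 'n) \<times> real) measure). norm (fst z) \<noteq> c"
proof (rule AE_lborel_fst)
  have "AE r in lborel. r > 0 \<longrightarrow> r \<noteq> c" using AE_lborel_singleton[of c] by eventually_elim simp
  then show "AE x in (lborel :: (real ^ 'n) measure). norm x \<noteq> c" by (rule AE_lborel_norm)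
qed

text \<open>
  Since \<open>radial_stress + tangential_stress = |V|\<^sup>2 + N P\<close> and \<open>|x|\<^sup>2 radial_stress =
  (V \<bullet> x)\<^sup>2 + |x|\<^sup>2 P\<close>, the tent identity is the balance of the weak solution for the tent
  profile.
\<close>

sublocale radial_pair lborel "\<lambda>z :: (real ^ 'n) \<times> real. norm (fst z)" radial_stress tangential_stress
proof
  fix \<rho> c :: real
  show "AE z in (lborel :: ((real ^ 'n) \<times> real) measure). norm (fst z) \<noteq> c" by (rule radius_atomless)
  show "integrable lborel (\<lambda>z. if norm (fst z) < \<rho> then radial_stress z else 0)"
    by (rule dominated_integrable[where \<rho> = \<rho> and C = 1]) (use stress_bounds(1) in \<open>measurable, auto\<close>)
  show "integrable lborel (\<lambda>z. if norm (fst z) < \<rho> then tangential_stress z else 0)"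
    by (rule dominated_integrable[where \<rho> = \<rho> and C = "real CARD('n)"]) (use stress_bounds(2) in \<open>measurable, auto\<close>)
  assume \<rho>: "\<rho> > 0"
  let ?A = "\<lambda>z. if norm (fst z) < \<rho> then 2 * (norm (fst z))\<^sup>2 * radial_stress z else 0"
  let ?B = "\<lambda>z. if norm (fst z) < \<rho> then (\<rho>\<^sup>2 - (norm (fst z))\<^sup>2) * (radial_stress z + tangential_stress z) else 0"
  have sq: "(norm (fst z))\<^sup>2 \<le> \<rho>\<^sup>2" if "norm (fst z) < \<rho>" for z :: "(real ^ 'n) \<times> real"
    using that by (intro power_mono) auto
  have A: "integrable lborel ?A"
  proof (rule dominated_integrable[where \<rho> = \<rho> and C = "2 * \<rho>\<^sup>2"])
    show "\<bar>?A z\<bar> \<le> 2 * \<rho>\<^sup>2 * density z" if "norm (fst z) < \<rho>" for z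
      using that sq[OF that] stress_bounds(1)[of z] by (auto simp: abs_mult intro!: mult_mono)
    show "?A \<in> borel_measurable borel" by measurable
  qed auto
  have B: "integrable lborel ?B"
  proof (rule dominated_integrable[where \<rho> = \<rho> and C = "\<rho>\<^sup>2 * (1 + real CARD('n))"])
    show "\<bar>?B z\<bar> \<le> \<rho>\<^sup>2 * (1 + real CARD('n)) * density z" if "norm (fst z) < \<rho>" for z
    proof -
      have "\<bar>radial_stress z + tangential_stress z\<bar> \<le> (1 + real CARD('n)) * density z"
        using stress_bounds[of z] by (simp add: algebra_simps)
      then have "\<bar>\<rho>\<^sup>2 - (norm (fst z))\<^sup>2\<bar> * \<bar>radial_stress z + tangential_stress z\<bar>
          \<le> \<rho>\<^sup>2 * ((1 + real CARD('n)) * density z)"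
        using sq[OF that] by (intro mult_mono) auto
      then show ?thesis using that by (simp add: abs_mult mult.assoc)
    qed
    show "?B \<in> borel_measurable borel" by measurable
  qed auto
  have "(\<integral>z. ?B z - ?A z \<partial>lborel) = 0"
  proof -
    have "?B z - ?A z = (if norm (fst z) < \<rho> then
      (\<rho>\<^sup>2 - fst z \<bullet> fst z) * (V z \<bullet> V z + real CARD('n) * P z)
      - 2 * ((V z \<bullet> fst z)\<^sup>2 + (fst z \<bullet> fst z) * P z) else 0)" for z
    proof -
      have "(norm (fst z))\<^sup>2 * radial_energy z = (V z \<bullet> fst z)\<^sup>2" by (simp add: radial_energy_def)
      then show ?thesis
        unfolding radial_stress_def tangential_stress_def
        by (simp add: dot_square_norm algebra_simps)
    qed
    then show ?thesis using tent_balance[OF \<rho>] by simp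
  qed
  then show "(\<integral>z. ?A z \<partial>lborel) = (\<integral>z. ?B z \<partial>lborel)"
    using Bochner_Integration.integral_diff[OF B A] by simp
qed auto

section \<open>The Liouville theorem\<close>

text \<open>
  The weighted identity for the stresses of the weak solution splits into a kinetic part, nonnegative
  because the radial and the tangential kinetic energy are, and a pressure part, nonnegative by
  hypothesis. Both parts vanish, and the coefficients in the kinetic part are positive.
\<close>

theorem velocity_vanishes:
  fixes w :: "real \<Rightarrow> real"
  assumes w_loc: "\<And>K. compact K \<Longrightarrow> K \<subseteq> {0..} \<Longrightarrow> set_integrable lebesgue K w"
    and w_pos: "AE s in lebesgue. s \<ge> 0 \<longrightarrow> w s > 0"
    and finite_int:
      "(\<integral>\<^sup>+t\<in>{0<..<T}. (\<integral>\<^sup>+x. ennreal (((norm (v x t))\<^sup>2 + \<bar>p x t\<bar>) *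
          (w (norm x)
           + 1 / norm x * (LINT s:{0..norm x}|lebesgue. w s)
           + 1 / (norm x)\<^sup>2 * (LINT r:{0..norm x}|lebesgue. (LINT s:{0..r}|lebesgue. w s))))
        \<partial>lebesgue) \<partial>lebesgue) < \<infinity>"
    and pressure:
      "AE t in lebesgue. t \<in> {0<..<T} \<longrightarrow>
         (LINT x|lebesgue. p x t *
            (w (norm x) + (real CARD('n) - 1) / norm x * (LINT s:{0..norm x}|lebesgue. w s))) \<ge> 0"
  shows "AE z in lborel. snd z \<in> {0<..<T} \<longrightarrow> v (fst z) (snd z) = 0"
proof -
  obtain w' where w'_meas: "w' \<in> borel_measurable borel" and w'_nonneg: "\<And>s. w' s \<ge> 0"
    and w_eq: "AE s in lborel. s \<ge> 0 \<longrightarrow> w s = w' s \<and> w' s > 0"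
    and w'_int: "\<And>\<rho>. integrable lborel (\<lambda>s. if 0 < s \<and> s < \<rho> then w' s else 0)"
    and mass_eq: "\<And>r. (LINT s:{0..r}|lebesgue. w s) = mass w' r"
  proof (rule borel_weight[OF _ w_pos])
    show "set_integrable lebesgue K w" if "compact K" "K \<subseteq> {0..}" for K
      using w_loc that by blast
  qed (rule that)
  note w' = w'_meas w'_nonneg w'_int
  note [measurable] = w'(1) mass_measurable[OF w']
  note mass_nonneg = mass_nonneg[OF w']
  have mass_positive: "mass w' r > 0" if "r > 0" for r
    by (rule mass_pos[OF w' _ that]) (use w_eq in eventually_elim, simp)
  have weight: "AE z in (lborel :: ((real ^ 'n) \<times> real) measure). norm (fst z) > 0 \<and> w (norm (fst z)) = w' (norm (fst z))
      \<and> w' (norm (fst z)) > 0"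
  proof -
    have "AE r in lborel. r > 0 \<longrightarrow> w r = w' r \<and> w' r > 0"
      using w_eq by eventually_elim simp
    from AE_lborel_fst[OF AE_lborel_norm[OF this]] radius_atomless[of 0]
    show ?thesis by eventually_elim auto
  qed

  \<comment> \<open>This function dominates both coefficients of the weighted identity.\<close>
  define \<Phi> where "\<Phi> z = w' (norm (fst z)) + mass w' (norm (fst z)) / norm (fst z)" for z :: "(real ^ 'n) \<times> real"
  have \<Phi>_meas [measurable]: "\<Phi> \<in> borel_measurable borel" unfolding \<Phi>_def[abs_def] by measurable
  have \<Phi>_nonneg: "\<Phi> z \<ge> 0" for z using w'(2) mass_nonneg by (simp add: \<Phi>_def)
  have density_\<Phi>: "integrable lborel (\<lambda>z. density z * \<Phi> z)"
  proof (rule integrableI_nonneg)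
    have "(\<integral>\<^sup>+z. ennreal (density z * \<Phi> z) \<partial>lborel) \<le>
      (\<integral>\<^sup>+t\<in>{0<..<T}. (\<integral>\<^sup>+x. ennreal (((norm (v x t))\<^sup>2 + \<bar>p x t\<bar>) *
          (w (norm x)
           + 1 / norm x * (LINT s:{0..norm x}|lebesgue. w s)
           + 1 / (norm x)\<^sup>2 * (LINT r:{0..norm x}|lebesgue. (LINT s:{0..r}|lebesgue. w s))))
        \<partial>lebesgue) \<partial>lebesgue)"
    proof (rule spacetime_nn_integral_le)
      show "AE z in lborel. snd z \<in> {0<..<T} \<longrightarrow> ennreal (density z * \<Phi> z) \<le>
        ennreal (((norm (v (fst z) (snd z)))\<^sup>2 + \<bar>p (fst z) (snd z)\<bar>) *
          (w (norm (fst z))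
           + 1 / norm (fst z) * (LINT s:{0..norm (fst z)}|lebesgue. w s)
           + 1 / (norm (fst z))\<^sup>2 * (LINT r:{0..norm (fst z)}|lebesgue. (LINT s:{0..r}|lebesgue. w s))))"
        using weight V_eq P_eq
      proof eventually_elim
        case (elim z)
        have "0 \<le> 1 / (norm (fst z))\<^sup>2 * (LINT r:{0..norm (fst z)}|lebesgue. (LINT s:{0..r}|lebesgue. w s))"
          using lebesgue_double_integral_nonneg[OF w_pos] by (intro mult_nonneg_nonneg) auto
        then have "density z * \<Phi> z \<le> density z * (w (norm (fst z))
           + 1 / norm (fst z) * (LINT s:{0..norm (fst z)}|lebesgue. w s)
           + 1 / (norm (fst z))\<^sup>2 * (LINT r:{0..norm (fst z)}|lebesgue. (LINT s:{0..r}|lebesgue. w s)))"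
          using elim(1) unfolding mass_eq \<Phi>_def by (intro mult_left_mono) auto
        then show ?case using elim(2,3) by (auto intro: ennreal_leI)
      qed
      show "(\<lambda>z. ennreal (density z * \<Phi> z)) \<in> borel_measurable borel" by measurable
    qed (simp add: V_out P_out)
    with finite_int show "(\<integral>\<^sup>+z. ennreal (density z * \<Phi> z) \<partial>lborel) < \<infinity>" by (rule order_le_less_trans[rotated])
  qed (use \<Phi>_nonneg in auto)
  have weighted_int: "integrable lborel (\<lambda>z. k z * h z)"
    if "k \<in> borel_measurable borel" "h \<in> borel_measurable borel"
      and k: "\<And>z. \<bar>k z\<bar> \<le> \<Phi> z" and h: "\<And>z. \<bar>h z\<bar> \<le> real CARD('n) * density z"
    for k h :: "(real ^ 'n) \<times> real \<Rightarrow> real"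
  proof (rule Bochner_Integration.integrable_bound)
    show "integrable lborel (\<lambda>z. real CARD('n) * (density z * \<Phi> z))" using density_\<Phi> by simp
    have "\<bar>k z\<bar> * \<bar>h z\<bar> \<le> \<Phi> z * (real CARD('n) * density z)" for z
      using k h \<Phi>_nonneg by (intro mult_mono) auto
    then show "AE z in lborel. norm (k z * h z) \<le> norm (real CARD('n) * (density z * \<Phi> z))"
      using \<Phi>_nonneg by (intro AE_I2) (simp add: abs_mult mult_ac)
    show "(\<lambda>z. k z * h z) \<in> borel_measurable lborel" using that(1,2) by measurable
  qed
  note N = real_CARD_ge_1[where 'a = 'n]
  have dens: "x \<le> real CARD('n) * density z" if "x \<le> density z" for x z
    using mult_right_mono[OF N, of "density z"] that by simp
  have k1: "\<bar>w' (norm (fst z))\<bar> \<le> \<Phi> z" and k2: "\<bar>mass w' (norm (fst z)) / norm (fst z)\<bar> \<le> \<Phi> z"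
    for z :: "(real ^ 'n) \<times> real"
    using w'(2) mass_nonneg by (auto simp: \<Phi>_def)
  have km: "(\<lambda>z :: (real ^ 'n) \<times> real. w' (norm (fst z))) \<in> borel_measurable borel"
    "(\<lambda>z :: (real ^ 'n) \<times> real. mass w' (norm (fst z)) / norm (fst z)) \<in> borel_measurable borel"
    by measurable
  note int1 = weighted_int[OF km(1) _ k1] and int2 = weighted_int[OF km(2) _ k2]
  let ?W = "\<lambda>z. w' (norm (fst z))" and ?m = "\<lambda>z. mass w' (norm (fst z)) / norm (fst z)"
  have iw: "integrable lborel (\<lambda>z. ?W z * radial_stress z)" "integrable lborel (\<lambda>z. ?m z * radial_stress z)"
    "integrable lborel (\<lambda>z. ?m z * tangential_stress z)"
    by (rule int1[OF stress_measurable(1) dens[OF stress_bounds(1)]]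
        int2[OF stress_measurable(1) dens[OF stress_bounds(1)]]
        int2[OF stress_measurable(2) stress_bounds(2)])+

  \<comment> \<open>The kinetic and the pressure part of the weighted identity.\<close>
  define E where "E z = ?W z * radial_energy z + ?m z * ((norm (V z))\<^sup>2 - radial_energy z)" for z
  define Q where "Q z = P z * (?W z + (real CARD('n) - 1) * ?m z)" for z
  have E_nonneg: "E z \<ge> 0" for z
    unfolding E_def using radial_energy_bounds[of z] w'(2) mass_nonneg by (intro add_nonneg_nonneg mult_nonneg_nonneg divide_nonneg_nonneg) auto
  have Q_int: "integrable lborel Q"
  proof -
    have "integrable lborel (\<lambda>z. ?W z * P z)" "integrable lborel (\<lambda>z. ?m z * P z)"
      by (rule int1[OF P_meas] int2[OF P_meas], rule dens, simp)+
    then have "integrable lborel (\<lambda>z. ?W z * P z + (real CARD('n) - 1) * (?m z * P z))"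
      by (intro Bochner_Integration.integrable_add integrable_mult_right)
    moreover have "?W z * P z + (real CARD('n) - 1) * (?m z * P z) = Q z" for z
      unfolding Q_def by (simp add: algebra_simps)
    ultimately show ?thesis by (simp only:)
  qed
  have EQ: "E z + Q z = ?W z * radial_stress z + ?m z * tangential_stress z" for z
    unfolding E_def Q_def radial_stress_def tangential_stress_def
    by (simp add: algebra_simps add_divide_distrib diff_divide_distrib)
  have E_int: "integrable lborel E"
  proof -
    have "integrable lborel (\<lambda>z. (?W z * radial_stress z + ?m z * tangential_stress z) - Q z)"
      using iw Q_int by (intro Bochner_Integration.integrable_diff Bochner_Integration.integrable_add)
    then show ?thesis unfolding EQ[symmetric] by simp
  qed
  have "(\<integral>z. E z \<partial>lborel) + (\<integral>z. Q z \<partial>lborel) = (\<integral>z. ?W z * radial_stress z + ?m z * tangential_stress z \<partial>lborel)"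
    unfolding EQ[symmetric] by (rule Bochner_Integration.integral_add[OF E_int Q_int, symmetric])
  also have "\<dots> = 0"
    using weighted_identity[OF w' iw] Bochner_Integration.integral_add[OF iw(1,3)] by simp
  finally have sum0: "(\<integral>z. E z \<partial>lborel) + (\<integral>z. Q z \<partial>lborel) = 0" .
  have "(\<integral>z. Q z \<partial>lborel) \<ge> 0"
  proof -
    let ?q = "\<lambda>x t. p x t * (w (norm x) + (real CARD('n) - 1) / norm x * (LINT s:{0..norm x}|lebesgue. w s))"
    have "spacetime_integral T ?q = (\<integral>z. Q z \<partial>lborel)"
    proof (rule spacetime_integral_eq[OF Q_int])
      show "AE z in lborel. snd z \<in> {0<..<T} \<longrightarrow> ?q (fst z) (snd z) = Q z"
        using weight P_eq by eventually_elim (auto simp: Q_def mass_eq)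
    qed (simp add: Q_def P_out)
    moreover have "spacetime_integral T ?q \<ge> 0"
      using pressure by (rule spacetime_integral_nonneg)
    ultimately show ?thesis by simp
  qed
  moreover have "(\<integral>z. E z \<partial>lborel) \<ge> 0"
    by (rule Bochner_Integration.integral_nonneg) (rule E_nonneg)
  ultimately have "(\<integral>z. E z \<partial>lborel) = 0"
    using sum0 by linarith
  then have "AE z in lborel. E z = 0"
    using E_nonneg by (subst (asm) integral_nonneg_eq_0_iff_AE[OF E_int]) auto
  with weight V_eq show ?thesis
  proof eventually_elim
    case (elim z)
    have m: "?m z > 0" using elim(1) mass_positive by simp
    have "?W z * radial_energy z \<ge> 0"
      using elim(1) radial_energy_bounds(1) by (intro mult_nonneg_nonneg) auto
    moreover have "?m z * ((norm (V z))\<^sup>2 - radial_energy z) \<ge> 0"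
      by (rule mult_nonneg_nonneg[OF less_imp_le[OF m]]) (use radial_energy_bounds(2)[of z] in simp)
    moreover note elim(3)
    ultimately have "?W z * radial_energy z = 0" "?m z * ((norm (V z))\<^sup>2 - radial_energy z) = 0"
      unfolding E_def by linarith+
    then have "radial_energy z = 0" "(norm (V z))\<^sup>2 - radial_energy z = 0"
      using elim(1) m by (simp_all only: mult_eq_0_iff) auto
    then have "V z = 0" by simp
    with elim(2) show ?case by simp
  qed
qed

end

theorem theorem1p1:
  fixes T \<nu> :: real
    and w :: "real \<Rightarrow> real"
    and v f :: "real ^ 'n::finite \<Rightarrow> real \<Rightarrow> real ^ 'n"
    and p :: "real ^ 'n \<Rightarrow> real \<Rightarrow> real"
  assumes "CARD('n) \<ge> 2" and "T > 0" and "\<nu> \<ge> 0"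
    and w_loc: "\<And>K. compact K \<Longrightarrow> K \<subseteq> {0..} \<Longrightarrow> set_integrable lebesgue K w"
    and w_pos: "AE s in lebesgue. s \<ge> 0 \<longrightarrow> w s > 0"
    and sol: "weak_solution_NS \<nu> T f v p"
    and finite_int:
      "(\<integral>\<^sup>+t\<in>{0<..<T}. (\<integral>\<^sup>+x. ennreal (((norm (v x t))\<^sup>2 + \<bar>p x t\<bar>) *
          (w (norm x)
           + 1 / norm x * (LINT s:{0..norm x}|lebesgue. w s)
           + 1 / (norm x)\<^sup>2 * (LINT r:{0..norm x}|lebesgue. (LINT s:{0..r}|lebesgue. w s))))
        \<partial>lebesgue) \<partial>lebesgue) < \<infinity>"
    and pressure:
      "AE t in lebesgue. t \<in> {0<..<T} \<longrightarrow>
         (LINT x|lebesgue. p x t *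
            (w (norm x) + (real CARD('n) - 1) / norm x * (LINT s:{0..norm x}|lebesgue. w s))) \<ge> 0"
  shows "AE (x, t) in lebesgue. t \<in> {0<..<T} \<longrightarrow> v x t = 0"
proof -
  have meas_v: "(\<lambda>(x, t). v x t) \<in> borel_measurable (lebesgue_on (UNIV \<times> {0<..<T}))"
    and meas_p: "(\<lambda>(x, t). p x t) \<in> borel_measurable (lebesgue_on (UNIV \<times> {0<..<T}))"
    using sol unfolding weak_solution_NS_def Lq_time_Lq_loc_sigma_def Lq_time_Lq_loc_def by blast+
  obtain V where V: "V \<in> borel_measurable borel"
    "AE z in lborel. snd z \<in> {0<..<T} \<longrightarrow> v (fst z) (snd z) = V z"
    "\<And>z. snd z \<notin> {0<..<T} \<Longrightarrow> V z = 0"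
    using meas_v by (rule spacetime_borel_representative) blast
  obtain P where P: "P \<in> borel_measurable borel"
    "AE z in lborel. snd z \<in> {0<..<T} \<longrightarrow> p (fst z) (snd z) = P z"
    "\<And>z. snd z \<notin> {0<..<T} \<Longrightarrow> P z = 0"
    using meas_p by (rule spacetime_borel_representative) blast
  have "borel_solution \<nu> T f v p V P"
    by (rule borel_solution.intro) (fact sol V P)+
  then have "AE z in lborel. snd z \<in> {0<..<T} \<longrightarrow> v (fst z) (snd z) = 0"
    by (rule borel_solution.velocity_vanishes[OF _ _ w_pos finite_int pressure])
       (rule w_loc)
  then show ?thesis
    by (intro AE_completion) (auto simp: case_prod_unfold)
qed

end
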